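(* Let $(X_n)_{n\in\mathbb{N}_0}$ and $\Phi=(\phi_n)_{n\in\mathbb{N}_0}$ be as in the standing setting. If $J(\Phi)$ and the quotient $\hat J(\Phi)/J(\Phi)$ are both subprojective, then $\hat J(\Phi)$ is subprojective.
   Context: Standing setting. Let $\mathbb{N}_0=\mathbb{N}\cup\{0\}$ and let $\wp$ be the set of all non-empty finite subsets of $\mathbb{N}_0$. Let $(X_n,\|\cdot\|_n)_{n\in\mathbb{N}_0}$ be a sequence of Banach spaces with $\dim X_0=0$, and let $\Phi=(\phi_n)_{n\in\mathbb{N}_0}$ be a sequence of operators (bounded linear maps) $\phi_n\colon X_n\to X_{n+1}$ with $\|\phi_n\|\le 1$. For $n\le m$ put $\phi_n^m=\phi_{m-1}\circ\cdots\circ\phi_n\colon X_n\to X_m$, with $\phi_n^n=I_{X_n}$. Let $\Pi=\prod_{n\in\mathbb{N}_0}X_n$. For $x=(x_n)_{n\in\mathbb{N}_0}\in\Pi$ and $S=\{p_0<\cdots<p_k\}\in\wp$ define $$\rho(x,S)=\Bigl(\sum_{i=1}^k\bigl\|\phi_{p_{i-1}}^{p_i}(x_{p_{i-1}})-x_{p_i}\bigr\|_{p_i}^2+\|x_{p_k}\|_{p_k}^2\Bigr)^{1/2},$$ and $\|x\|_J=\frac{1}{\sqrt2}\sup_{S\in\wp}\rho(x,S)$. Let $\hat J(\Phi)=\{x\in\Pi:\|x\|_J<\infty\}$, a Banach space with norm $\|\cdot\|_J$, and let $J(\Phi)=\{(x_n)_{n\in\mathbb{N}_0}\in\hat J(\Phi):\lim_n\|x_n\|_n=0\}$,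 a closed subspace of $\hat J(\Phi)$ (equivalently, the closure of the finitely non-zero sequences of $\Pi$ in $\|\cdot\|_J$). A Banach space $X$ is subprojective if every closed infinite-dimensional subspace of $X$ contains an infinite-dimensional subspace complemented in $X$ (i.e. the range of a bounded linear projection on $X$); finite-dimensional spaces are trivially subprojective. *)

theory Defs
  imports "HOL-Analysis.Analysis" "HOL-Algebra.Module" "HOL-Algebra.AbelCoset"
begin

section \<open>Scalars\<close>

text \<open>
  Banach spaces are taken over the real or the complex numbers. The class covers both cases at once.
  The norm of a member is the usual absolute value, since the norm of a
  \<^class>\<open>real_normed_field\<close> is multiplicative.
\<close>

class real_or_complex = real_normed_field +
  assumes real_or_complex:
    "(\<forall>z. \<exists>a. z = a *\<^sub>R 1) \<or>
     (\<exists>i. i * i = - 1 \<and> (\<forall>z. \<exists>a b. z = a *\<^sub>R 1 + b *\<^sub>R i))"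

instance real :: real_or_complex
  by standard simp

instance complex :: real_or_complex
proof
  have "z = Re z *\<^sub>R 1 + Im z *\<^sub>R \<i>" for z
    by (simp add: complex_eq_iff)
  then show "(\<forall>z::complex. \<exists>a. z = a *\<^sub>R 1) \<or>
      (\<exists>i::complex. i * i = - 1 \<and> (\<forall>z. \<exists>a b. z = a *\<^sub>R 1 + b *\<^sub>R i))"
    by (intro disjI2 exI[of _ \<i>]) auto
qed

definition scalars :: "'k::real_or_complex ring" where
  "scalars = \<lparr>carrier = UNIV, monoid.mult = (*), one = 1, ring.zero = 0, add = (+)\<rparr>"


section \<open>Banach spaces, operators, complemented subspaces\<close>

text \<open>
  Spaces are records with an explicit carrier, so that a sequence of different spaces, the spaces
  built from it and their quotients are objects of the same kind. The ring fields
  \<^const>\<open>monoid.mult\<close> and \<^const>\<open>one\<close>, inherited from the record of modules, carry no meaning.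
\<close>

record ('k, 'a) nspace = "('k, 'a) module" +
  vnorm :: "'a \<Rightarrow> real"

text \<open>The value off the carrier is chosen so that the distance is a metric in the sense of
  \<^locale>\<open>Metric_space\<close>, which requires symmetry and nonnegativity everywhere.\<close>

definition ndist :: "('k, 'a) nspace \<Rightarrow> 'a \<Rightarrow> 'a \<Rightarrow> real" where
  "ndist E x y = (if x \<in> carrier E \<and> y \<in> carrier E then vnorm E (x \<ominus>\<^bsub>E\<^esub> y) else 0)"

locale normed_vspace = Module.module scalars E for E :: "('k::real_or_complex, 'a) nspace" +
  assumes vnorm_eq_0_iff: "x \<in> carrier E \<Longrightarrow> vnorm E x = 0 \<longleftrightarrow> x = \<zero>\<^bsub>E\<^esub>"
    and vnorm_smult: "x \<in> carrier E \<Longrightarrow> vnorm E (a \<odot>\<^bsub>E\<^esub> x) = norm a * vnorm E x"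
    and vnorm_triangle: "x \<in> carrier E \<Longrightarrow> y \<in> carrier E \<Longrightarrow>
      vnorm E (x \<oplus>\<^bsub>E\<^esub> y) \<le> vnorm E x + vnorm E y"

locale banach_space = normed_vspace +
  assumes complete: "Metric_space.mcomplete (carrier E) (ndist E)"

definition closed_subspace :: "('k::real_or_complex, 'a) nspace \<Rightarrow> 'a set \<Rightarrow> bool" where
  "closed_subspace E M \<longleftrightarrow> submodule M scalars E \<and>
     closedin (Metric_space.mtopology (carrier E) (ndist E)) M"

definition finite_dimensional :: "('k::real_or_complex, 'a) nspace \<Rightarrow> 'a set \<Rightarrow> bool" where
  "finite_dimensional E M \<longleftrightarrow>
     (\<exists>B. finite B \<and> B \<subseteq> M \<and> (\<forall>x\<in>M. \<exists>c. x = (\<Oplus>\<^bsub>E\<^esub>b\<in>B. c b \<odot>\<^bsub>E\<^esub> b)))"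

definition bounded_operator ::
    "('k::real_or_complex, 'a) nspace \<Rightarrow> ('k, 'b) nspace \<Rightarrow> ('a \<Rightarrow> 'b) \<Rightarrow> bool" where
  "bounded_operator E F T \<longleftrightarrow> T \<in> carrier E \<rightarrow> carrier F \<and>
     (\<forall>x\<in>carrier E. \<forall>y\<in>carrier E. T (x \<oplus>\<^bsub>E\<^esub> y) = T x \<oplus>\<^bsub>F\<^esub> T y) \<and>
     (\<forall>a. \<forall>x\<in>carrier E. T (a \<odot>\<^bsub>E\<^esub> x) = a \<odot>\<^bsub>F\<^esub> T x) \<and>
     (\<exists>K. \<forall>x\<in>carrier E. vnorm F (T x) \<le> K * vnorm E x)"

definition operator_norm :: "('k, 'a) nspace \<Rightarrow> ('k, 'b) nspace \<Rightarrow> ('a \<Rightarrow> 'b) \<Rightarrow> real" where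
  "operator_norm E F T = (SUP x\<in>{x \<in> carrier E. vnorm E x \<le> 1}. vnorm F (T x))"

definition complemented :: "('k::real_or_complex, 'a) nspace \<Rightarrow> 'a set \<Rightarrow> bool" where
  "complemented E N \<longleftrightarrow> (\<exists>P. bounded_operator E E P \<and>
     (\<forall>x\<in>carrier E. P (P x) = P x) \<and> P ` carrier E = N)"

definition subprojective :: "('k::real_or_complex, 'a) nspace \<Rightarrow> bool" where
  "subprojective E \<longleftrightarrow> banach_space E \<and>
     (\<forall>M. closed_subspace E M \<and> \<not> finite_dimensional E M \<longrightarrow>
       (\<exists>N. N \<subseteq> M \<and> submodule N scalars E \<and> \<not> finite_dimensional E N \<and> complemented E N))"

definition quotient_space :: "('k, 'a) nspace \<Rightarrow> 'a set \<Rightarrow> ('k, 'a set) nspace" where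
  "quotient_space E M =
     \<lparr>carrier = a_rcosets\<^bsub>E\<^esub> M, monoid.mult = undefined, one = undefined,
      ring.zero = M, add = set_add E,
      smult = (\<lambda>a C. \<Union>x\<in>C. M +>\<^bsub>E\<^esub> (a \<odot>\<^bsub>E\<^esub> x)),
      vnorm = (\<lambda>C. INF x\<in>C. vnorm E x)\<rparr>"


section \<open>The spaces \<open>J(\<Phi>)\<close>\<close>

text \<open>\<open>comp_maps \<phi> n m\<close> is \<open>\<phi>\<^bsub>m-1\<^esub> \<circ> \<dots> \<circ> \<phi>\<^bsub>n\<^esub>\<close>, and the identity if \<open>n = m\<close>.\<close>

definition comp_maps :: "(nat \<Rightarrow> 'a \<Rightarrow> 'a) \<Rightarrow> nat \<Rightarrow> nat \<Rightarrow> 'a \<Rightarrow> 'a" where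
  "comp_maps \<phi> n m = fold \<phi> [n..<m]"

definition rho ::
    "(nat \<Rightarrow> ('k, 'a) nspace) \<Rightarrow> (nat \<Rightarrow> 'a \<Rightarrow> 'a) \<Rightarrow> (nat \<Rightarrow> 'a) \<Rightarrow> nat set \<Rightarrow> real" where
  "rho X \<phi> x S = (let p = (\<lambda>i. sorted_list_of_set S ! i); k = card S - 1 in
     sqrt ((\<Sum>i=1..k. (vnorm (X (p i))
              (comp_maps \<phi> (p (i - 1)) (p i) (x (p (i - 1))) \<ominus>\<^bsub>X (p i)\<^esub> x (p i)))\<^sup>2)
           + (vnorm (X (p k)) (x (p k)))\<^sup>2))"

definition J_norm ::
    "(nat \<Rightarrow> ('k, 'a) nspace) \<Rightarrow> (nat \<Rightarrow> 'a \<Rightarrow> 'a) \<Rightarrow> (nat \<Rightarrow> 'a) \<Rightarrow> real" where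
  "J_norm X \<phi> x = 1 / sqrt 2 * (SUP S\<in>{S. finite S \<and> S \<noteq> {}}. rho X \<phi> x S)"

text \<open>The real-valued supremum in \<^const>\<open>J_norm\<close> is meaningful only for bounded families, so
  \<open>\<parallel>x\<parallel>\<^sub>J < \<infinity>\<close> is expressed by \<^const>\<open>bdd_above\<close>.\<close>

definition J_hat :: "(nat \<Rightarrow> ('k, 'a) nspace) \<Rightarrow> (nat \<Rightarrow> 'a \<Rightarrow> 'a) \<Rightarrow> ('k, nat \<Rightarrow> 'a) nspace" where
  "J_hat X \<phi> =
     \<lparr>carrier = {x. (\<forall>n. x n \<in> carrier (X n)) \<and> bdd_above (rho X \<phi> x ` {S. finite S \<and> S \<noteq> {}})},
      monoid.mult = undefined, one = undefined,
      ring.zero = (\<lambda>n. \<zero>\<^bsub>X n\<^esub>), add = (\<lambda>x y n. x n \<oplus>\<^bsub>X n\<^esub> y n),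
      smult = (\<lambda>a x n. a \<odot>\<^bsub>X n\<^esub> x n),
      vnorm = J_norm X \<phi>\<rparr>"

definition J_space :: "(nat \<Rightarrow> ('k, 'a) nspace) \<Rightarrow> (nat \<Rightarrow> 'a \<Rightarrow> 'a) \<Rightarrow> ('k, nat \<Rightarrow> 'a) nspace" where
  "J_space X \<phi> = (J_hat X \<phi>)
     \<lparr>carrier := {x \<in> carrier (J_hat X \<phi>). (\<lambda>n. vnorm (X n) (x n)) \<longlonglongrightarrow> 0}\<rparr>"

end

theory Submission
  imports Defs
begin

text \<open>
  Write \<open>H\<close> for the large space, \<open>J\<close> for the subspace of sequences tending to \<open>0\<close>, and \<open>q\<close> for the
  quotient map of \<open>H\<close> by \<open>J\<close>. Complemented subspaces can be pulled back: if \<open>T\<close> is an operator from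
  \<open>H\<close> to a subprojective space that is bounded below on an infinite-dimensional closed subspace \<open>L\<close>,
  then \<open>T ` L\<close> contains an infinite-dimensional subspace with a projection \<open>P\<close> onto it, and following
  \<open>P \<circ> T\<close> by the inverse of \<open>T\<close> on \<open>L\<close> gives a projection of \<open>H\<close> onto a subspace of \<open>L\<close>
  (\<open>pull_back_complemented\<close>). So it suffices to find, for each infinite-dimensional closed subspace
  \<open>M\<close> of \<open>H\<close>, an operator into \<open>J\<close> or into the quotient that is bounded below on an
  infinite-dimensional closed subspace of \<open>M\<close>. Three kinds of operators are enough.

  If some truncation \<open>trunc n\<close>, which maps \<open>H\<close> into \<open>J\<close>, is bounded below on \<open>M\<close>, it serves. Otherwise
  \<open>M\<close> contains unit vectors with arbitrarily small initial parts, and a gliding hump argument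
  yields, for every \<open>n\<close>, an infinite-dimensional subspace of \<open>M\<close> on which \<open>trunc n\<close> has small norm
  (\<open>exists_seq_span_trunc_small\<close>). If \<open>q\<close> is bounded below on one of these subspaces, it serves.
  Otherwise \<open>M\<close> contains unit vectors for which the initial part and the distance to \<open>J\<close> are
  simultaneously small, that is, unit vectors close to finitely supported sequences that start
  arbitrarily late. A second gliding hump gives a sequence \<open>x k\<close> in \<open>M\<close>, close to vectors \<open>y k\<close>
  supported strictly between consecutive members \<open>d k\<close> of a set \<open>D\<close> of indices.

  In this last case restricting a sequence to the gaps of \<open>D\<close> is not an operator into \<open>J\<close>: a
  sequence in \<open>H\<close> need not tend to \<open>0\<close>. What works is to subtract first, in each gap, the image
  under the connecting maps of the entry at its left end. The resulting operator
  \<open>anchored_diff D\<close> fixes every \<open>y k\<close>, and the entries that it produces are the differences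
  that the norm of \<open>H\<close> measures, so it is bounded and has values in \<open>J\<close>. Being close to
  the identity on the span of the \<open>x k\<close>, it is bounded below there.

  All norm estimates in \<open>H\<close> go through potentials, that is, functions of one index that drop from
  \<open>p\<close> to \<open>q\<close> by at least the square of the norm of the difference between \<open>p\<close> and \<open>q\<close>. The
  quadratic variation beyond an index is the least potential (\<open>qvar_le_potential\<close>), and
  its square root at \<open>0\<close> is an equivalent norm on \<open>H\<close>.
\<close>

section \<open>Normed spaces with explicit carrier\<close>

context normed_vspace
begin

lemma in_scalars [simp]: "a \<in> carrier scalars"
  by (simp add: scalars_def)

lemma smult_carrier [simp, intro]: "x \<in> carrier E \<Longrightarrow> a \<odot>\<^bsub>E\<^esub> x \<in> carrier E"
  by simp

lemma smult_add_left: "x \<in> carrier E \<Longrightarrow> (a + b) \<odot>\<^bsub>E\<^esub> x = a \<odot>\<^bsub>E\<^esub> x \<oplus>\<^bsub>E\<^esub> b \<odot>\<^bsub>E\<^esub> x"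
  using smult_l_distr[of a b x] by (simp add: scalars_def)

lemma smult_add_right:
  "x \<in> carrier E \<Longrightarrow> y \<in> carrier E \<Longrightarrow> a \<odot>\<^bsub>E\<^esub> (x \<oplus>\<^bsub>E\<^esub> y) = a \<odot>\<^bsub>E\<^esub> x \<oplus>\<^bsub>E\<^esub> a \<odot>\<^bsub>E\<^esub> y"
  using smult_r_distr[of a x y] by simp

lemma smult_smult: "x \<in> carrier E \<Longrightarrow> a \<odot>\<^bsub>E\<^esub> (b \<odot>\<^bsub>E\<^esub> x) = (a * b) \<odot>\<^bsub>E\<^esub> x"
  using smult_assoc1[of a b x] by (simp add: scalars_def)

lemma smult_1 [simp]: "x \<in> carrier E \<Longrightarrow> 1 \<odot>\<^bsub>E\<^esub> x = x"
  using smult_one[of x] by (simp add: scalars_def)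

lemma smult_0 [simp]: "x \<in> carrier E \<Longrightarrow> 0 \<odot>\<^bsub>E\<^esub> x = \<zero>\<^bsub>E\<^esub>"
  using smult_l_null[of x] by (simp add: scalars_def)

lemma smult_zero [simp]: "a \<odot>\<^bsub>E\<^esub> \<zero>\<^bsub>E\<^esub> = \<zero>\<^bsub>E\<^esub>"
  using smult_r_null[of a] by simp

lemma uminus_eq_smult: "x \<in> carrier E \<Longrightarrow> \<ominus>\<^bsub>E\<^esub> x = (-1) \<odot>\<^bsub>E\<^esub> x"
proof -
  assume x: "x \<in> carrier E"
  have "(-1) \<odot>\<^bsub>E\<^esub> x \<oplus>\<^bsub>E\<^esub> x = (-1 + 1) \<odot>\<^bsub>E\<^esub> x"
    using x smult_add_left[of x "-1" 1] by simp
  then show ?thesis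
    using x by (simp add: M.minus_equality)
qed

lemma diff_eq_smult: "x \<in> carrier E \<Longrightarrow> y \<in> carrier E \<Longrightarrow> x \<ominus>\<^bsub>E\<^esub> y = x \<oplus>\<^bsub>E\<^esub> (-1) \<odot>\<^bsub>E\<^esub> y"
  by (simp add: a_minus_def uminus_eq_smult)

lemma diff_carrier [simp, intro]: "x \<in> carrier E \<Longrightarrow> y \<in> carrier E \<Longrightarrow> x \<ominus>\<^bsub>E\<^esub> y \<in> carrier E"
  by (simp add: a_minus_def)

lemma vnorm_0 [simp]: "vnorm E \<zero>\<^bsub>E\<^esub> = 0"
  using vnorm_eq_0_iff[of "\<zero>\<^bsub>E\<^esub>"] by simp

lemma vnorm_uminus [simp]: "x \<in> carrier E \<Longrightarrow> vnorm E (\<ominus>\<^bsub>E\<^esub> x) = vnorm E x"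
  by (simp add: uminus_eq_smult vnorm_smult)

lemma vnorm_nonneg [simp]: "x \<in> carrier E \<Longrightarrow> 0 \<le> vnorm E x"
  using vnorm_triangle[of x "\<ominus>\<^bsub>E\<^esub> x"] by (simp add: M.r_neg)

lemma diff_self [simp]: "x \<in> carrier E \<Longrightarrow> x \<ominus>\<^bsub>E\<^esub> x = \<zero>\<^bsub>E\<^esub>"
  by (simp add: a_minus_def M.r_neg)

lemma diff_zero_right [simp]: "x \<in> carrier E \<Longrightarrow> x \<ominus>\<^bsub>E\<^esub> \<zero>\<^bsub>E\<^esub> = x"
  by (simp add: a_minus_def)

lemma diff_add_cancel [simp]: "x \<in> carrier E \<Longrightarrow> y \<in> carrier E \<Longrightarrow> (x \<ominus>\<^bsub>E\<^esub> y) \<oplus>\<^bsub>E\<^esub> y = x"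
  by (simp add: a_minus_def M.a_assoc M.l_neg)

lemma diff_eq_zero_iff: "x \<in> carrier E \<Longrightarrow> y \<in> carrier E \<Longrightarrow> x \<ominus>\<^bsub>E\<^esub> y = \<zero>\<^bsub>E\<^esub> \<longleftrightarrow> x = y"
  by (metis M.l_zero diff_add_cancel diff_self)

lemma minus_diff: "x \<in> carrier E \<Longrightarrow> y \<in> carrier E \<Longrightarrow> \<ominus>\<^bsub>E\<^esub> (x \<ominus>\<^bsub>E\<^esub> y) = y \<ominus>\<^bsub>E\<^esub> x"
  by (simp add: a_minus_def M.minus_add M.a_comm)

lemma vnorm_diff_commute:
  "x \<in> carrier E \<Longrightarrow> y \<in> carrier E \<Longrightarrow> vnorm E (x \<ominus>\<^bsub>E\<^esub> y) = vnorm E (y \<ominus>\<^bsub>E\<^esub> x)"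
  using minus_diff[of x y] vnorm_uminus[of "x \<ominus>\<^bsub>E\<^esub> y"] by simp

lemma diff_add_diff:
  "x \<in> carrier E \<Longrightarrow> y \<in> carrier E \<Longrightarrow> z \<in> carrier E \<Longrightarrow>
    (x \<ominus>\<^bsub>E\<^esub> y) \<oplus>\<^bsub>E\<^esub> (y \<ominus>\<^bsub>E\<^esub> z) = x \<ominus>\<^bsub>E\<^esub> z"
  by (simp add: a_minus_def M.a_assoc M.r_neg1)

lemma add_diff_add:
  assumes "a \<in> carrier E" "b \<in> carrier E" "c \<in> carrier E" "d \<in> carrier E"
  shows "(a \<oplus>\<^bsub>E\<^esub> b) \<ominus>\<^bsub>E\<^esub> (c \<oplus>\<^bsub>E\<^esub> d) = (a \<ominus>\<^bsub>E\<^esub> c) \<oplus>\<^bsub>E\<^esub> (b \<ominus>\<^bsub>E\<^esub> d)"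
  using assms by (simp add: a_minus_def M.minus_add M.a_ac)

lemma smult_diff:
  "x \<in> carrier E \<Longrightarrow> y \<in> carrier E \<Longrightarrow> a \<odot>\<^bsub>E\<^esub> (x \<ominus>\<^bsub>E\<^esub> y) = a \<odot>\<^bsub>E\<^esub> x \<ominus>\<^bsub>E\<^esub> a \<odot>\<^bsub>E\<^esub> y"
  by (simp add: a_minus_def smult_add_right smult_r_minus)

lemma diff_diff_cancel:
  assumes "x \<in> carrier E" "z \<in> carrier E"
  shows "x \<ominus>\<^bsub>E\<^esub> (x \<ominus>\<^bsub>E\<^esub> z) = z"
proof -
  have "x \<ominus>\<^bsub>E\<^esub> (x \<ominus>\<^bsub>E\<^esub> z) = (z \<ominus>\<^bsub>E\<^esub> x) \<oplus>\<^bsub>E\<^esub> x"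
    using assms minus_diff[OF assms] M.a_comm[of x "z \<ominus>\<^bsub>E\<^esub> x"]
    by (simp add: a_minus_def[of E x "x \<ominus>\<^bsub>E\<^esub> z"])
  then show ?thesis using assms by simp
qed

lemma diff_diff_diff:
  "a \<in> carrier E \<Longrightarrow> b \<in> carrier E \<Longrightarrow> c \<in> carrier E \<Longrightarrow>
    (a \<ominus>\<^bsub>E\<^esub> c) \<ominus>\<^bsub>E\<^esub> (b \<ominus>\<^bsub>E\<^esub> c) = a \<ominus>\<^bsub>E\<^esub> b"
  using diff_add_diff[of a c b] minus_diff[of b c] by (simp add: a_minus_def[of E "a \<ominus>\<^bsub>E\<^esub> c"])

lemma vnorm_diff_triangle:
  "x \<in> carrier E \<Longrightarrow> y \<in> carrier E \<Longrightarrow> z \<in> carrier E \<Longrightarrow>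
    vnorm E (x \<ominus>\<^bsub>E\<^esub> z) \<le> vnorm E (x \<ominus>\<^bsub>E\<^esub> y) + vnorm E (y \<ominus>\<^bsub>E\<^esub> z)"
  using vnorm_triangle[of "x \<ominus>\<^bsub>E\<^esub> y" "y \<ominus>\<^bsub>E\<^esub> z"] by (simp add: diff_add_diff)

lemma vnorm_diff_le:
  "x \<in> carrier E \<Longrightarrow> y \<in> carrier E \<Longrightarrow> vnorm E (x \<ominus>\<^bsub>E\<^esub> y) \<le> vnorm E x + vnorm E y"
  using vnorm_triangle[of x "\<ominus>\<^bsub>E\<^esub> y"] by (simp add: a_minus_def)

lemma vnorm_le_diff:
  "x \<in> carrier E \<Longrightarrow> y \<in> carrier E \<Longrightarrow> vnorm E x \<le> vnorm E (x \<ominus>\<^bsub>E\<^esub> y) + vnorm E y"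
  using vnorm_triangle[of "x \<ominus>\<^bsub>E\<^esub> y" y] by simp

lemma submodule_subset: "submodule M scalars E \<Longrightarrow> M \<subseteq> carrier E"
  by (rule submoduleE(1))

lemma submodule_smult: "submodule M scalars E \<Longrightarrow> x \<in> M \<Longrightarrow> a \<odot>\<^bsub>E\<^esub> x \<in> M"
  using submoduleE(4)[of M a x] by simp

lemma submodule_zero:
  assumes M: "submodule M scalars E"
  shows "\<zero>\<^bsub>E\<^esub> \<in> M"
proof -
  obtain x where x: "x \<in> M" using submoduleE(2)[OF M] by blast
  then have "x \<in> carrier E" using submodule_subset[OF M] by blast
  then show ?thesis using submodule_smult[OF M x, of 0] by simp
qed

lemma submodule_diff:
  "submodule M scalars E \<Longrightarrow> x \<in> M \<Longrightarrow> y \<in> M \<Longrightarrow> x \<ominus>\<^bsub>E\<^esub> y \<in> M"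
  by (simp add: a_minus_def submoduleE(3,5))

lemma submodule_finsum:
  assumes M: "submodule M scalars E" and "finite A" "A \<subseteq> M"
  shows "(\<Oplus>\<^bsub>E\<^esub>b\<in>A. c b \<odot>\<^bsub>E\<^esub> b) \<in> M"
  using assms(2,3)
proof (induction A rule: finite_induct)
  case empty
  then show ?case by (simp add: submodule_zero[OF M])
next
  case (insert b A)
  have "A \<subseteq> carrier E" "b \<in> carrier E"
    using insert.prems submodule_subset[OF M] by auto
  then have "(\<Oplus>\<^bsub>E\<^esub>b\<in>insert b A. c b \<odot>\<^bsub>E\<^esub> b) = c b \<odot>\<^bsub>E\<^esub> b \<oplus>\<^bsub>E\<^esub> (\<Oplus>\<^bsub>E\<^esub>b\<in>A. c b \<odot>\<^bsub>E\<^esub> b)"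
    using insert.hyps by (intro M.finsum_insert) auto
  then show ?case
    using insert submodule_smult[OF M] submoduleE(5)[OF M] by simp
qed

lemma Metric_space_ndist: "Metric_space (carrier E) (ndist E)"
proof
  show "0 \<le> ndist E x y" for x y
    by (simp add: ndist_def)
  show "ndist E x y = ndist E y x" for x y
    by (simp add: ndist_def vnorm_diff_commute)
  show "ndist E x y = 0 \<longleftrightarrow> x = y" if "x \<in> carrier E" "y \<in> carrier E" for x y
    using that by (simp add: ndist_def vnorm_eq_0_iff diff_eq_zero_iff)
  show "ndist E x z \<le> ndist E x y + ndist E y z"
    if "x \<in> carrier E" "y \<in> carrier E" "z \<in> carrier E" for x y z
    using that by (simp add: ndist_def vnorm_diff_triangle)
qed

sublocale metric: Metric_space "carrier E" "ndist E"
  by (rule Metric_space_ndist)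

lemma limitin_iff:
  assumes "\<And>n. \<sigma> n \<in> carrier E"
  shows "limitin metric.mtopology \<sigma> l sequentially \<longleftrightarrow>
    l \<in> carrier E \<and> (\<lambda>n. vnorm E (\<sigma> n \<ominus>\<^bsub>E\<^esub> l)) \<longlonglongrightarrow> 0"
proof (cases "l \<in> carrier E")
  case True
  then show ?thesis
    using assms unfolding metric.limit_metric_sequentially LIMSEQ_iff by (simp add: ndist_def)
qed (simp add: metric.limit_metric_sequentially)

text \<open>Closedness and completeness are used only in the two sequential forms below, which do not
  refer to the values of the distance off the carrier.\<close>

lemma closed_subspace_iff:
  "closed_subspace E M \<longleftrightarrow> submodule M scalars E \<and>
    (\<forall>\<sigma> l. (\<forall>n. \<sigma> n \<in> M) \<longrightarrow> l \<in> carrier E \<longrightarrow> (\<lambda>n. vnorm E (\<sigma> n \<ominus>\<^bsub>E\<^esub> l)) \<longlonglongrightarrow> 0 \<longrightarrow> l \<in> M)"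
proof (cases "submodule M scalars E")
  case True
  have sub: "M \<subseteq> carrier E"
    using submoduleE(1)[OF True] .
  have *: "range \<sigma> \<subseteq> M \<and> limitin metric.mtopology \<sigma> l sequentially \<longleftrightarrow>
     (\<forall>n. \<sigma> n \<in> M) \<and> l \<in> carrier E \<and> (\<lambda>n. vnorm E (\<sigma> n \<ominus>\<^bsub>E\<^esub> l)) \<longlonglongrightarrow> 0" for \<sigma> l
    using sub limitin_iff[of \<sigma> l] by (auto simp: subset_iff)
  show ?thesis
    unfolding closed_subspace_def metric.metric_closedin_iff_sequentially_closed *
    using True sub by blast
qed (simp add: closed_subspace_def)

lemma mcomplete_iff:
  "metric.mcomplete \<longleftrightarrow>
    (\<forall>\<sigma>. (\<forall>n. \<sigma> n \<in> carrier E) \<longrightarrow>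
       (\<forall>\<epsilon>>0. \<exists>N. \<forall>m\<ge>N. \<forall>n\<ge>N. vnorm E (\<sigma> m \<ominus>\<^bsub>E\<^esub> \<sigma> n) < \<epsilon>) \<longrightarrow>
       (\<exists>l\<in>carrier E. (\<lambda>n. vnorm E (\<sigma> n \<ominus>\<^bsub>E\<^esub> l)) \<longlonglongrightarrow> 0))"
proof -
  have 1: "metric.MCauchy \<sigma> \<longleftrightarrow> (\<forall>n. \<sigma> n \<in> carrier E) \<and>
      (\<forall>\<epsilon>>0. \<exists>N. \<forall>m\<ge>N. \<forall>n\<ge>N. vnorm E (\<sigma> m \<ominus>\<^bsub>E\<^esub> \<sigma> n) < \<epsilon>)" for \<sigma>
  proof (cases "\<forall>n. \<sigma> n \<in> carrier E")
    case True
    then have "range \<sigma> \<subseteq> carrier E" by blast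
    moreover have "ndist E (\<sigma> m) (\<sigma> n) = vnorm E (\<sigma> m \<ominus>\<^bsub>E\<^esub> \<sigma> n)" for m n
      using True by (simp add: ndist_def)
    ultimately show ?thesis
      unfolding metric.MCauchy_def using True by auto
  qed (auto simp: metric.MCauchy_def)
  show ?thesis
    unfolding metric.mcomplete_def 1 by (metis limitin_iff)
qed

end

lemma (in banach_space) Cauchy_converges:
  assumes "\<And>n. \<sigma> n \<in> carrier E"
    and "\<And>\<epsilon>. 0 < \<epsilon> \<Longrightarrow> \<exists>N. \<forall>m\<ge>N. \<forall>n\<ge>N. vnorm E (\<sigma> m \<ominus>\<^bsub>E\<^esub> \<sigma> n) < \<epsilon>"
  obtains l where "l \<in> carrier E" "(\<lambda>n. vnorm E (\<sigma> n \<ominus>\<^bsub>E\<^esub> l)) \<longlonglongrightarrow> 0"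
proof -
  have "(\<forall>n. \<sigma> n \<in> carrier E) \<longrightarrow>
       (\<forall>\<epsilon>>0. \<exists>N. \<forall>m\<ge>N. \<forall>n\<ge>N. vnorm E (\<sigma> m \<ominus>\<^bsub>E\<^esub> \<sigma> n) < \<epsilon>) \<longrightarrow>
       (\<exists>l\<in>carrier E. (\<lambda>n. vnorm E (\<sigma> n \<ominus>\<^bsub>E\<^esub> l)) \<longlonglongrightarrow> 0)"
    using complete unfolding mcomplete_iff by blast
  then show thesis
    using assms that by blast
qed

section \<open>Seminorms and finite linear combinations\<close>

definition seminorm :: "('k::real_or_complex, 'a) nspace \<Rightarrow> ('a \<Rightarrow> real) \<Rightarrow> bool" where
  "seminorm E p \<longleftrightarrow>
     (\<forall>x\<in>carrier E. \<forall>y\<in>carrier E. p (x \<oplus>\<^bsub>E\<^esub> y) \<le> p x + p y) \<and>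
     (\<forall>a. \<forall>x\<in>carrier E. p (a \<odot>\<^bsub>E\<^esub> x) = norm a * p x)"

definition lincomb :: "('k::real_or_complex, 'a) nspace \<Rightarrow> (nat \<Rightarrow> 'a) \<Rightarrow> (nat \<Rightarrow> 'k) \<Rightarrow> nat \<Rightarrow> 'a" where
  "lincomb E x c n = (\<Oplus>\<^bsub>E\<^esub>j\<in>{..<n}. c j \<odot>\<^bsub>E\<^esub> x j)"

definition seq_span :: "('k::real_or_complex, 'a) nspace \<Rightarrow> (nat \<Rightarrow> 'a) \<Rightarrow> 'a set" where
  "seq_span E x = {lincomb E x c n | c n. True}"

text \<open>Coefficient functionals of norm at most \<open>C\<close> on the span: the sequence is linearly independent,
  and small perturbations of its members perturb the whole span only slightly.\<close>

definition coeff_bounded ::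
    "('k::real_or_complex, 'a) nspace \<Rightarrow> real \<Rightarrow> (nat \<Rightarrow> 'a) \<Rightarrow> bool" where
  "coeff_bounded E C x \<longleftrightarrow>
     (\<forall>j. x j \<in> carrier E) \<and> (\<forall>c n. \<forall>k<n. norm (c k) \<le> C * vnorm E (lincomb E x c n))"

context normed_vspace
begin

lemma seminorm_add:
  "seminorm E p \<Longrightarrow> x \<in> carrier E \<Longrightarrow> y \<in> carrier E \<Longrightarrow> p (x \<oplus>\<^bsub>E\<^esub> y) \<le> p x + p y"
  by (simp add: seminorm_def)

lemma seminorm_smult: "seminorm E p \<Longrightarrow> x \<in> carrier E \<Longrightarrow> p (a \<odot>\<^bsub>E\<^esub> x) = norm a * p x"
  by (simp add: seminorm_def)

lemma seminorm_0:
  assumes "seminorm E p"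
  shows "p \<zero>\<^bsub>E\<^esub> = 0"
proof -
  have "p (0 \<odot>\<^bsub>E\<^esub> \<zero>\<^bsub>E\<^esub>) = norm (0::'k) * p \<zero>\<^bsub>E\<^esub>"
    using assms unfolding seminorm_def by blast
  then show ?thesis by simp
qed

lemma seminorm_nonneg:
  assumes p: "seminorm E p" and x: "x \<in> carrier E"
  shows "0 \<le> p x"
proof -
  have "p (x \<oplus>\<^bsub>E\<^esub> (-1) \<odot>\<^bsub>E\<^esub> x) \<le> p x + p ((-1) \<odot>\<^bsub>E\<^esub> x)"
    using p x unfolding seminorm_def by blast
  moreover have "p ((-1) \<odot>\<^bsub>E\<^esub> x) = p x"
    using p x unfolding seminorm_def by simp
  moreover have "x \<oplus>\<^bsub>E\<^esub> (-1) \<odot>\<^bsub>E\<^esub> x = \<zero>\<^bsub>E\<^esub>"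
    using x diff_eq_smult[of x x] by simp
  ultimately show ?thesis
    using seminorm_0[OF p] by simp
qed

lemma lincomb_carrier [simp]: "(\<And>j. x j \<in> carrier E) \<Longrightarrow> lincomb E x c n \<in> carrier E"
  unfolding lincomb_def by (rule M.finsum_closed) auto

lemma lincomb_0 [simp]: "lincomb E x c 0 = \<zero>\<^bsub>E\<^esub>"
  by (simp add: lincomb_def)

lemma lincomb_Suc:
  assumes "\<And>j. x j \<in> carrier E"
  shows "lincomb E x c (Suc n) = c n \<odot>\<^bsub>E\<^esub> x n \<oplus>\<^bsub>E\<^esub> lincomb E x c n"
  unfolding lincomb_def lessThan_Suc using assms by (subst M.finsum_insert) auto

lemma lincomb_add:
  assumes "\<And>j. x j \<in> carrier E"
  shows "lincomb E x c n \<oplus>\<^bsub>E\<^esub> lincomb E x d n = lincomb E x (\<lambda>j. c j + d j) n"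
proof (induction n)
  case (Suc n)
  show ?case
    using assms unfolding lincomb_Suc[OF assms] Suc[symmetric]
    by (simp add: smult_add_left M.a_ac)
qed simp

lemma lincomb_smult:
  assumes "\<And>j. x j \<in> carrier E"
  shows "a \<odot>\<^bsub>E\<^esub> lincomb E x c n = lincomb E x (\<lambda>j. a * c j) n"
  using assms
  by (induction n) (auto simp: lincomb_Suc smult_add_right smult_smult)

lemma lincomb_single:
  assumes x: "\<And>j. x j \<in> carrier E" and "k < n"
  shows "lincomb E x (\<lambda>j. if j = k then a else 0) n = a \<odot>\<^bsub>E\<^esub> x k"
  using \<open>k < n\<close>
proof (induction n)
  case (Suc n)
  have "lincomb E x (\<lambda>j. if j = k then a else 0) k = lincomb E x (\<lambda>j. 0) k"
    unfolding lincomb_def using x by (intro M.finsum_cong') auto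
  also have "\<dots> = \<zero>\<^bsub>E\<^esub>"
    using x by (induction k) (auto simp: lincomb_Suc)
  finally show ?case
    using Suc x by (cases "k = n") (auto simp: lincomb_Suc)
qed simp

lemma lincomb_extend:
  assumes x: "\<And>j. x j \<in> carrier E" and "n \<le> m"
  shows "lincomb E x c n = lincomb E x (\<lambda>j. if j < n then c j else 0) m"
  using \<open>n \<le> m\<close>
proof (induction m rule: dec_induct)
  case base
  show ?case
    unfolding lincomb_def using x by (intro M.finsum_cong') auto
next
  case (step m)
  then show ?case
    using x by (simp add: lincomb_Suc)
qed

lemma seq_span_submodule:
  assumes x: "\<And>j. x j \<in> carrier E"
  shows "submodule (seq_span E x) scalars E"
proof (rule submoduleI)
  show "seq_span E x \<subseteq> carrier E"
    using x by (auto simp: seq_span_def)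
  show "\<zero>\<^bsub>E\<^esub> \<in> seq_span E x"
    unfolding seq_span_def using lincomb_0[of x undefined] by (metis (mono_tags, lifting) mem_Collect_eq)
  have sm: "a \<odot>\<^bsub>E\<^esub> y \<in> seq_span E x" if "y \<in> seq_span E x" for a y
    using that lincomb_smult[of x a, OF x] unfolding seq_span_def by blast
  then show "a \<odot>\<^bsub>E\<^esub> y \<in> seq_span E x" if "y \<in> seq_span E x" for a y
    using that .
  show "\<ominus>\<^bsub>E\<^esub> y \<in> seq_span E x" if "y \<in> seq_span E x" for y
  proof -
    have "y \<in> carrier E"
      using that x by (auto simp: seq_span_def)
    then show ?thesis
      using sm[OF that, of "-1"] uminus_eq_smult by simp
  qed
  show "y \<oplus>\<^bsub>E\<^esub> z \<in> seq_span E x" if "y \<in> seq_span E x" "z \<in> seq_span E x" for y z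
  proof -
    obtain c n d m where y: "y = lincomb E x c n" and z: "z = lincomb E x d m"
      using \<open>y \<in> _\<close> \<open>z \<in> _\<close> by (auto simp: seq_span_def)
    have "y = lincomb E x (\<lambda>j. if j < n then c j else 0) (max n m)"
      "z = lincomb E x (\<lambda>j. if j < m then d j else 0) (max n m)"
      unfolding y z using x by (intro lincomb_extend; simp)+
    then show ?thesis
      using lincomb_add[OF x] by (auto simp: seq_span_def)
  qed
qed

lemma submodule_lincomb:
  assumes M: "submodule M scalars E" and x: "\<And>j. x j \<in> M"
  shows "lincomb E x c n \<in> M"
proof (induction n)
  case 0
  then show ?case by (simp add: submodule_zero[OF M])
next
  case (Suc n)
  have "x j \<in> carrier E" for j
    using x submoduleE(1)[OF M] by blast
  then show ?case
    using Suc submoduleE(4,5)[OF M] x by (simp add: lincomb_Suc)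
qed

lemma seminorm_lincomb_le:
  assumes p: "seminorm E p" and x: "\<And>j. x j \<in> carrier E"
  shows "p (lincomb E x c n) \<le> (\<Sum>j<n. norm (c j) * p (x j))"
proof (induction n)
  case 0
  then show ?case using seminorm_0[OF p] by simp
next
  case (Suc n)
  have "p (c n \<odot>\<^bsub>E\<^esub> x n \<oplus>\<^bsub>E\<^esub> lincomb E x c n) \<le> norm (c n) * p (x n) + p (lincomb E x c n)"
    using seminorm_add[OF p, of "c n \<odot>\<^bsub>E\<^esub> x n" "lincomb E x c n"] seminorm_smult[OF p, of "x n" "c n"] x
    by simp
  then show ?case
    using Suc by (simp add: lincomb_Suc[OF x])
qed

lemma seminorm_lincomb_ge:
  assumes p: "seminorm E p" and x: "\<And>j. x j \<in> carrier E" and k: "k < n"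
  shows "norm (c k) * p (x k) \<le> p (lincomb E x c n) + (\<Sum>j\<in>{..<n} - {k}. norm (c j) * p (x j))"
proof -
  define d where "d = (\<lambda>j. if j = k then 0 else - c j)"
  have "lincomb E x c n \<oplus>\<^bsub>E\<^esub> lincomb E x d n = lincomb E x (\<lambda>j. if j = k then c k else 0) n"
    unfolding lincomb_add[OF x] d_def by (rule arg_cong[where f = "\<lambda>c. lincomb E x c n"]) auto
  also have "\<dots> = c k \<odot>\<^bsub>E\<^esub> x k"
    by (rule lincomb_single[OF x k])
  finally have *: "lincomb E x c n \<oplus>\<^bsub>E\<^esub> lincomb E x d n = c k \<odot>\<^bsub>E\<^esub> x k" .
  have "norm (c k) * p (x k) = p (c k \<odot>\<^bsub>E\<^esub> x k)"
    using p x unfolding seminorm_def by simp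
  also have "\<dots> \<le> p (lincomb E x c n) + p (lincomb E x d n)"
    unfolding *[symmetric] using p x unfolding seminorm_def by simp
  also have "p (lincomb E x d n) \<le> (\<Sum>j<n. norm (d j) * p (x j))"
    by (rule seminorm_lincomb_le[OF p x])
  also have "\<dots> = (\<Sum>j\<in>{..<n} - {k}. norm (c j) * p (x j))"
    using k by (subst sum.remove[of _ k]) (auto simp: d_def intro!: sum.cong)
  finally show ?thesis by simp
qed

text \<open>The seminorms \<open>u k\<close> are nearly biorthogonal to the sequence and stand in for coefficient
  functionals. The errors that \<open>u k\<close> picks up from the other coefficients are controlled only by
  the largest of them, so that one is estimated, with the seminorm of its own index.\<close>

lemma coeff_boundedI:
  assumes x: "\<And>j. x j \<in> carrier E"
    and u: "\<And>k. seminorm E (u k)" and uA: "\<And>k y. y \<in> carrier E \<Longrightarrow> u k y \<le> A * vnorm E y"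
    and diag: "\<And>k. 1 / 2 \<le> u k (x k)"
    and off: "\<And>j k. j \<noteq> k \<Longrightarrow> u k (x j) \<le> \<delta> j"
    and \<delta>: "\<And>n. (\<Sum>j<n. \<delta> j) \<le> 1 / 4" "\<And>j. 0 \<le> \<delta> j"
  shows "coeff_bounded E (4 * A) x"
  unfolding coeff_bounded_def
proof (intro conjI allI impI)
  show "x j \<in> carrier E" for j by (rule x)
  fix c :: "nat \<Rightarrow> 'k" and n k :: nat assume "k < n"
  have "\<exists>m\<in>{..<n}. \<forall>j\<in>{..<n}. norm (c j) \<le> norm (c m)"
    using \<open>k < n\<close> Max_in[of "(\<lambda>j. norm (c j)) ` {..<n}"] Max_ge[of "(\<lambda>j. norm (c j)) ` {..<n}"]
    by fastforce
  then obtain m where m: "m < n" "\<And>j. j < n \<Longrightarrow> norm (c j) \<le> norm (c m)"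
    by auto
  have "norm (c m) * (1 / 2) \<le> norm (c m) * u m (x m)"
    using diag by (intro mult_left_mono) auto
  also have "\<dots> \<le> u m (lincomb E x c n) + (\<Sum>j\<in>{..<n} - {m}. norm (c j) * u m (x j))"
    by (rule seminorm_lincomb_ge[OF u x m(1)])
  also have "(\<Sum>j\<in>{..<n} - {m}. norm (c j) * u m (x j)) \<le> (\<Sum>j\<in>{..<n} - {m}. norm (c m) * \<delta> j)"
    using m off by (intro sum_mono mult_mono) (auto intro: seminorm_nonneg[OF u x])
  also have "\<dots> \<le> (\<Sum>j<n. norm (c m) * \<delta> j)"
    using \<delta>(2) by (intro sum_mono2) auto
  also have "\<dots> \<le> norm (c m) * (1 / 4)"
    using mult_left_mono[OF \<delta>(1)[of n], of "norm (c m)"] by (simp only: sum_distrib_left norm_ge_zero)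
  also have "u m (lincomb E x c n) \<le> A * vnorm E (lincomb E x c n)"
    by (rule uA) (simp add: x)
  finally have "norm (c m) \<le> 4 * A * vnorm E (lincomb E x c n)"
    by simp
  then show "norm (c k) \<le> 4 * A * vnorm E (lincomb E x c n)"
    using m(2)[OF \<open>k < n\<close>] by linarith
qed

lemma seminorm_le_on_seq_span:
  assumes x: "coeff_bounded E C x" and w: "seminorm E w"
    and \<delta>: "\<And>j. w (x j) \<le> \<delta> j" "\<And>n. (\<Sum>j<n. \<delta> j) \<le> \<eta>" and C: "0 \<le> C"
    and y: "y \<in> seq_span E x"
  shows "w y \<le> C * \<eta> * vnorm E y"
proof -
  have xE: "x j \<in> carrier E" for j
    using x by (simp add: coeff_bounded_def)
  obtain c n where y: "y = lincomb E x c n"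
    using y by (auto simp: seq_span_def)
  have nn: "0 \<le> w (x j)" for j
    by (rule seminorm_nonneg[OF w xE])
  have "w y \<le> (\<Sum>j<n. norm (c j) * w (x j))"
    unfolding y by (rule seminorm_lincomb_le[OF w xE])
  also have "\<dots> \<le> (\<Sum>j<n. C * vnorm E y * \<delta> j)"
    using x \<delta>(1) nn unfolding y coeff_bounded_def by (intro sum_mono mult_mono) (auto simp: C xE)
  also have "\<dots> = C * vnorm E y * (\<Sum>j<n. \<delta> j)"
    by (simp add: sum_distrib_left)
  also have "\<dots> \<le> C * vnorm E y * \<eta>"
    using \<delta>(2) C by (intro mult_left_mono) (auto simp: y xE)
  finally show ?thesis by (simp add: mult_ac)
qed

end

lemma homogeneous_system_nontrivial_solution:
  fixes a :: "'i \<Rightarrow> 'b \<Rightarrow> 'k::field"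
  assumes "finite B" "finite I" "card B < card I"
  shows "\<exists>c. (\<exists>i\<in>I. c i \<noteq> 0) \<and> (\<forall>b\<in>B. (\<Sum>i\<in>I. c i * a i b) = 0)"
  using assms
proof (induction B arbitrary: I a rule: finite_induct)
  case empty
  then have "I \<noteq> {}" by auto
  then show ?case by (intro exI[of _ "\<lambda>_. 1"]) auto
next
  case (insert b B)
  show ?case
  proof (cases "\<forall>i\<in>I. a i b = 0")
    case True
    then show ?thesis
      using insert.IH[of I a] insert.prems insert.hyps by auto
  next
    case False
    then obtain i0 where i0: "i0 \<in> I" "a i0 b \<noteq> 0" by blast
    define I' where "I' = I - {i0}"
    have I': "finite I'" "card B < card I'" "i0 \<notin> I'" "I = insert i0 I'"
      using insert.prems insert.hyps i0 by (auto simp: I'_def)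
    obtain c where c: "\<exists>i\<in>I'. c i \<noteq> 0"
      "\<And>b'. b' \<in> B \<Longrightarrow> (\<Sum>i\<in>I'. c i * (a i b' - a i b / a i0 b * a i0 b')) = 0"
      using insert.IH[OF I'(1,2), of "\<lambda>i b'. a i b' - a i b / a i0 b * a i0 b'"] by blast
    define s where "s = - (\<Sum>i\<in>I'. c i * a i b) / a i0 b"
    define d where "d = (\<lambda>i. if i = i0 then s else c i)"
    have d_sum: "(\<Sum>i\<in>I. d i * a i b') = s * a i0 b' + (\<Sum>i\<in>I'. c i * a i b')" for b'
      unfolding I'(4) using I'(1,3) by (auto simp: d_def intro!: sum.cong)
    have "(\<Sum>i\<in>I. d i * a i b') = 0" if "b' \<in> B" for b'
    proof -
      have "0 = (\<Sum>i\<in>I'. c i * a i b' - c i * a i b * (a i0 b' / a i0 b))"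
        using c(2)[OF that] by (simp add: right_diff_distrib mult.assoc mult.commute[of "a i0 b'"])
      also have "\<dots> = (\<Sum>i\<in>I'. c i * a i b') - (\<Sum>i\<in>I'. c i * a i b) * (a i0 b' / a i0 b)"
        by (simp only: sum_subtractf sum_distrib_right)
      finally show ?thesis
        by (simp add: d_sum s_def)
    qed
    moreover have "(\<Sum>i\<in>I. d i * a i b) = 0"
      using i0(2) by (simp add: d_sum s_def)
    moreover have "\<exists>i\<in>I. d i \<noteq> 0"
      using c(1) I'(3,4) by (auto simp: d_def)
    ultimately show ?thesis
      by blast
  qed
qed

text \<open>If \<open>m\<close> vectors spanned \<open>M\<close>, there would be a nontrivial linear relation between \<open>m + 1\<close>
  members of the sequence, and the bound would force all its coefficients to vanish.\<close>

lemma (in normed_vspace) coeff_bounded_not_finite_dimensional: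
  assumes x: "coeff_bounded E C x" and M: "range x \<subseteq> M" "M \<subseteq> carrier E"
  shows "\<not> finite_dimensional E M"
proof
  assume "finite_dimensional E M"
  then obtain B where B: "finite B" "B \<subseteq> M" "\<And>y. y \<in> M \<Longrightarrow> \<exists>c. y = (\<Oplus>\<^bsub>E\<^esub>b\<in>B. c b \<odot>\<^bsub>E\<^esub> b)"
    unfolding finite_dimensional_def by blast
  have BE: "b \<in> carrier E" if "b \<in> B" for b
    using that B M by blast
  have xE: "x j \<in> carrier E" for j
    using x by (simp add: coeff_bounded_def)
  have "\<forall>i. \<exists>c. x i = (\<Oplus>\<^bsub>E\<^esub>b\<in>B. c b \<odot>\<^bsub>E\<^esub> b)"
    using B(3) M(1) by blast
  from choice[OF this] obtain a where a: "\<And>i. x i = (\<Oplus>\<^bsub>E\<^esub>b\<in>B. a i b \<odot>\<^bsub>E\<^esub> b)"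
    by blast
  have comb: "lincomb E x c n = (\<Oplus>\<^bsub>E\<^esub>b\<in>B. (\<Sum>i<n. c i * a i b) \<odot>\<^bsub>E\<^esub> b)" for c n
  proof (induction n)
    case 0
    have "(\<Oplus>\<^bsub>E\<^esub>b\<in>B. 0 \<odot>\<^bsub>E\<^esub> b) = (\<Oplus>\<^bsub>E\<^esub>b\<in>B. \<zero>\<^bsub>E\<^esub>)"
      using BE by (intro M.finsum_cong') auto
    then show ?case by simp
  next
    case (Suc n)
    have "lincomb E x c (Suc n) =
        c n \<odot>\<^bsub>E\<^esub> (\<Oplus>\<^bsub>E\<^esub>b\<in>B. a n b \<odot>\<^bsub>E\<^esub> b) \<oplus>\<^bsub>E\<^esub> (\<Oplus>\<^bsub>E\<^esub>b\<in>B. (\<Sum>i<n. c i * a i b) \<odot>\<^bsub>E\<^esub> b)"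
      using Suc by (simp add: lincomb_Suc[OF xE] a[symmetric])
    also have "c n \<odot>\<^bsub>E\<^esub> (\<Oplus>\<^bsub>E\<^esub>b\<in>B. a n b \<odot>\<^bsub>E\<^esub> b) = (\<Oplus>\<^bsub>E\<^esub>b\<in>B. c n \<odot>\<^bsub>E\<^esub> (a n b \<odot>\<^bsub>E\<^esub> b))"
      using B(1) BE by (intro finsum_smult_ldistr) auto
    also have "\<dots> \<oplus>\<^bsub>E\<^esub> (\<Oplus>\<^bsub>E\<^esub>b\<in>B. (\<Sum>i<n. c i * a i b) \<odot>\<^bsub>E\<^esub> b) =
        (\<Oplus>\<^bsub>E\<^esub>b\<in>B. c n \<odot>\<^bsub>E\<^esub> (a n b \<odot>\<^bsub>E\<^esub> b) \<oplus>\<^bsub>E\<^esub> (\<Sum>i<n. c i * a i b) \<odot>\<^bsub>E\<^esub> b)"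
      using BE by (intro M.finsum_addf[symmetric]) auto
    also have "\<dots> = (\<Oplus>\<^bsub>E\<^esub>b\<in>B. (\<Sum>i<Suc n. c i * a i b) \<odot>\<^bsub>E\<^esub> b)"
      using BE by (intro M.finsum_cong') (auto simp: smult_smult smult_add_left[symmetric] add.commute)
    finally show ?case .
  qed
  obtain c where c: "\<exists>i\<in>{..<Suc (card B)}. c i \<noteq> 0"
      "\<And>b. b \<in> B \<Longrightarrow> (\<Sum>i<Suc (card B). c i * a i b) = 0"
    using homogeneous_system_nontrivial_solution[OF B(1), of "{..<Suc (card B)}" a] by auto
  have "lincomb E x c (Suc (card B)) = (\<Oplus>\<^bsub>E\<^esub>b\<in>B. \<zero>\<^bsub>E\<^esub>)"
    unfolding comb using BE c(2) by (intro M.finsum_cong') (auto simp del: sum.lessThan_Suc)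
  then have "lincomb E x c (Suc (card B)) = \<zero>\<^bsub>E\<^esub>" by simp
  moreover obtain k where "k < Suc (card B)" "c k \<noteq> 0" using c(1) by auto
  moreover have "norm (c k) \<le> C * vnorm E (lincomb E x c (Suc (card B)))"
    using x \<open>k < Suc (card B)\<close> unfolding coeff_bounded_def by blast
  ultimately show False
    by simp
qed


section \<open>Bounded operators into subprojective spaces\<close>

locale bounded_map = E: normed_vspace E + F: normed_vspace F
  for E :: "('k::real_or_complex, 'a) nspace" and F :: "('k, 'b) nspace" +
  fixes T :: "'a \<Rightarrow> 'b"
  assumes bounded_operator: "bounded_operator E F T"
begin

lemma map_carrier [simp, intro]: "x \<in> carrier E \<Longrightarrow> T x \<in> carrier F"
  using bounded_operator by (auto simp: bounded_operator_def)

lemma map_add: "x \<in> carrier E \<Longrightarrow> y \<in> carrier E \<Longrightarrow> T (x \<oplus>\<^bsub>E\<^esub> y) = T x \<oplus>\<^bsub>F\<^esub> T y"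
  using bounded_operator by (auto simp: bounded_operator_def)

lemma map_smult: "x \<in> carrier E \<Longrightarrow> T (a \<odot>\<^bsub>E\<^esub> x) = a \<odot>\<^bsub>F\<^esub> T x"
  using bounded_operator by (auto simp: bounded_operator_def)

lemma map_zero [simp]: "T \<zero>\<^bsub>E\<^esub> = \<zero>\<^bsub>F\<^esub>"
  using map_smult[of "\<zero>\<^bsub>E\<^esub>" 0] by simp

lemma map_diff: "x \<in> carrier E \<Longrightarrow> y \<in> carrier E \<Longrightarrow> T (x \<ominus>\<^bsub>E\<^esub> y) = T x \<ominus>\<^bsub>F\<^esub> T y"
  by (simp add: E.diff_eq_smult F.diff_eq_smult map_add map_smult)

lemma bound_pos:
  obtains K where "0 < K" "\<And>x. x \<in> carrier E \<Longrightarrow> vnorm F (T x) \<le> K * vnorm E x"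
proof -
  obtain K where K: "\<And>x. x \<in> carrier E \<Longrightarrow> vnorm F (T x) \<le> K * vnorm E x"
    using bounded_operator unfolding bounded_operator_def by blast
  have "vnorm F (T x) \<le> (\<bar>K\<bar> + 1) * vnorm E x" if "x \<in> carrier E" for x
  proof -
    have "K * vnorm E x \<le> (\<bar>K\<bar> + 1) * vnorm E x"
      using that by (intro mult_right_mono) auto
    then show ?thesis
      using K[OF that] by linarith
  qed
  then show thesis
    using that[of "\<bar>K\<bar> + 1"] by simp
qed

lemma map_finsum:
  assumes "finite A" "f \<in> A \<rightarrow> carrier E"
  shows "T (\<Oplus>\<^bsub>E\<^esub>i\<in>A. f i) = (\<Oplus>\<^bsub>F\<^esub>i\<in>A. T (f i))"
  using assms
proof (induction A rule: finite_induct)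
  case (insert i A)
  have 1: "f \<in> A \<rightarrow> carrier E" "f i \<in> carrier E"
    using insert.prems by auto
  then have "(\<lambda>i. T (f i)) \<in> A \<rightarrow> carrier F" by auto
  then show ?case
    using insert 1 by (simp add: map_add)
qed simp

lemma seminorm_map: "seminorm E (\<lambda>x. vnorm F (T x))"
  by (simp add: seminorm_def map_add map_smult F.vnorm_triangle F.vnorm_smult)

lemma image_submodule:
  assumes M: "submodule M scalars E"
  shows "submodule (T ` M) scalars F"
proof (rule F.submoduleI)
  have ME: "M \<subseteq> carrier E"
    using E.submoduleE(1)[OF M] .
  then show "T ` M \<subseteq> carrier F" by auto
  show "\<zero>\<^bsub>F\<^esub> \<in> T ` M"
    using E.submodule_zero[OF M] map_zero by force
  show sm: "a \<odot>\<^bsub>F\<^esub> y \<in> T ` M" if "y \<in> T ` M" for a y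
  proof -
    obtain x where x: "x \<in> M" "y = T x" using \<open>y \<in> T ` M\<close> by blast
    have "a \<odot>\<^bsub>E\<^esub> x \<in> M" using E.submoduleE(4)[OF M _ x(1)] by simp
    moreover have "a \<odot>\<^bsub>F\<^esub> y = T (a \<odot>\<^bsub>E\<^esub> x)" using x ME map_smult by auto
    ultimately show ?thesis by blast
  qed
  show "\<ominus>\<^bsub>F\<^esub> y \<in> T ` M" if "y \<in> T ` M" for y
  proof -
    have "y \<in> carrier F" using that ME by auto
    then show ?thesis
      using sm[OF that, of "-1"] F.uminus_eq_smult by simp
  qed
  show "y \<oplus>\<^bsub>F\<^esub> z \<in> T ` M" if "y \<in> T ` M" "z \<in> T ` M" for y z
  proof -
    obtain x w where x: "x \<in> M" "y = T x" "w \<in> M" "z = T w"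
      using \<open>y \<in> T ` M\<close> \<open>z \<in> T ` M\<close> by blast
    have "x \<oplus>\<^bsub>E\<^esub> w \<in> M" using E.submoduleE(5)[OF M] x by simp
    moreover have "y \<oplus>\<^bsub>F\<^esub> z = T (x \<oplus>\<^bsub>E\<^esub> w)"
      unfolding x(2,4) using map_add[OF subsetD[OF ME x(1)] subsetD[OF ME x(3)]] by simp
    ultimately show ?thesis by blast
  qed
qed

lemma finite_dimensional_image_iff:
  assumes M: "submodule M scalars E" and inj: "inj_on T M"
  shows "finite_dimensional F (T ` M) \<longleftrightarrow> finite_dimensional E M"
proof
  have ME: "M \<subseteq> carrier E"
    using E.submoduleE(1)[OF M] .
  {
    assume "finite_dimensional E M"
    then obtain B where B: "finite B" "B \<subseteq> M" "\<And>x. x \<in> M \<Longrightarrow> \<exists>c. x = (\<Oplus>\<^bsub>E\<^esub>b\<in>B. c b \<odot>\<^bsub>E\<^esub> b)"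
      unfolding finite_dimensional_def by blast
    have BE: "b \<in> carrier E" if "b \<in> B" for b using that B(2) ME by blast
    have injB: "inj_on T B" using inj B(2) inj_on_subset by blast
    have "\<exists>c. y = (\<Oplus>\<^bsub>F\<^esub>b\<in>T ` B. c b \<odot>\<^bsub>F\<^esub> b)" if "y \<in> T ` M" for y
    proof -
      obtain c where c: "y = T (\<Oplus>\<^bsub>E\<^esub>b\<in>B. c b \<odot>\<^bsub>E\<^esub> b)" using B(3) \<open>y \<in> T ` M\<close> by blast
      have "y = (\<Oplus>\<^bsub>F\<^esub>b\<in>B. T (c b \<odot>\<^bsub>E\<^esub> b))"
        unfolding c using B(1) BE by (intro map_finsum) auto
      also have "\<dots> = (\<Oplus>\<^bsub>F\<^esub>b\<in>B. c (inv_into B T (T b)) \<odot>\<^bsub>F\<^esub> T b)"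
        using BE injB by (intro F.M.finsum_cong') (auto simp: map_smult)
      also have "\<dots> = (\<Oplus>\<^bsub>F\<^esub>r\<in>T ` B. c (inv_into B T r) \<odot>\<^bsub>F\<^esub> r)"
        using BE by (intro F.M.finsum_reindex[symmetric] injB) auto
      finally show ?thesis by (rule exI[of _ "\<lambda>r. c (inv_into B T r)"])
    qed
    then show "finite_dimensional F (T ` M)"
      unfolding finite_dimensional_def using B(1,2) by (intro exI[of _ "T ` B"]) auto
  }
  {
    assume "finite_dimensional F (T ` M)"
    then obtain B where B: "finite B" "B \<subseteq> T ` M"
        "\<And>y. y \<in> T ` M \<Longrightarrow> \<exists>c. y = (\<Oplus>\<^bsub>F\<^esub>b\<in>B. c b \<odot>\<^bsub>F\<^esub> b)"
      unfolding finite_dimensional_def by blast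
    obtain A where A: "A \<subseteq> M" "inj_on T A" "B = T ` A"
      using B(2) unfolding subset_image_inj by blast
    have finA: "finite A" using A(2,3) B(1) finite_image_iff by blast
    have AE: "a \<in> carrier E" if "a \<in> A" for a using that A(1) ME by blast
    have "\<exists>c. x = (\<Oplus>\<^bsub>E\<^esub>a\<in>A. c a \<odot>\<^bsub>E\<^esub> a)" if x: "x \<in> M" for x
    proof -
      obtain c where c: "T x = (\<Oplus>\<^bsub>F\<^esub>b\<in>B. c b \<odot>\<^bsub>F\<^esub> b)" using B(3) x by blast
      have "T x = (\<Oplus>\<^bsub>F\<^esub>a\<in>A. c (T a) \<odot>\<^bsub>F\<^esub> T a)"
        unfolding c A(3) using AE by (intro F.M.finsum_reindex A(2)) auto
      also have "\<dots> = (\<Oplus>\<^bsub>F\<^esub>a\<in>A. T (c (T a) \<odot>\<^bsub>E\<^esub> a))"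
        using AE by (intro F.M.finsum_cong') (auto simp: map_smult)
      also have "\<dots> = T (\<Oplus>\<^bsub>E\<^esub>a\<in>A. c (T a) \<odot>\<^bsub>E\<^esub> a)"
        using finA AE by (intro map_finsum[symmetric]) auto
      finally have "x = (\<Oplus>\<^bsub>E\<^esub>a\<in>A. c (T a) \<odot>\<^bsub>E\<^esub> a)"
        using inj x E.submodule_finsum[OF M finA A(1)] by (simp add: inj_on_eq_iff)
      then show ?thesis by (rule exI[of _ "\<lambda>a. c (T a)"])
    qed
    then show "finite_dimensional E M"
      unfolding finite_dimensional_def using finA A(1) by (intro exI[of _ A]) blast
  }
qed

lemma bounded_below_inj_on:
  assumes M: "submodule M scalars E" and c: "0 < c" "\<And>x. x \<in> M \<Longrightarrow> c * vnorm E x \<le> vnorm F (T x)"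
  shows "inj_on T M"
proof (rule inj_onI)
  fix x y assume xy: "x \<in> M" "y \<in> M" "T x = T y"
  have E: "x \<in> carrier E" "y \<in> carrier E"
    using xy E.submoduleE(1)[OF M] by auto
  have "x \<ominus>\<^bsub>E\<^esub> y \<in> M"
    by (rule E.submodule_diff[OF M xy(1,2)])
  then have "c * vnorm E (x \<ominus>\<^bsub>E\<^esub> y) \<le> vnorm F (T x \<ominus>\<^bsub>F\<^esub> T y)"
    using c(2)[of "x \<ominus>\<^bsub>E\<^esub> y"] map_diff[OF E] by simp
  also have "\<dots> = 0" using xy E by simp
  finally have "vnorm E (x \<ominus>\<^bsub>E\<^esub> y) = 0"
    using c(1) E.vnorm_nonneg[OF E.diff_carrier[OF E]]
    by (smt (verit) mult_pos_pos)
  then show "x = y"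
    using E by (simp add: E.vnorm_eq_0_iff E.diff_eq_zero_iff)
qed

text \<open>If the images of a sequence in \<open>M\<close> converge, the sequence itself is Cauchy.\<close>

lemma closed_image:
  assumes comp: "banach_space E" and M: "closed_subspace E M"
    and c: "0 < c" "\<And>x. x \<in> M \<Longrightarrow> c * vnorm E x \<le> vnorm F (T x)"
  shows "closed_subspace F (T ` M)"
proof -
  interpret E: banach_space E by (rule comp)
  have sub: "submodule M scalars E"
    using M unfolding E.closed_subspace_iff by blast
  have ME: "M \<subseteq> carrier E"
    using E.submoduleE(1)[OF sub] .
  obtain K where K: "0 < K" "\<And>x. x \<in> carrier E \<Longrightarrow> vnorm F (T x) \<le> K * vnorm E x"
    using bound_pos by blast
  have "l \<in> T ` M"
    if \<sigma>: "\<And>n. \<sigma> n \<in> T ` M" and l: "l \<in> carrier F" and lim: "(\<lambda>n. vnorm F (\<sigma> n \<ominus>\<^bsub>F\<^esub> l)) \<longlonglongrightarrow> 0" for \<sigma> l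
  proof -
    have "\<forall>n. \<exists>x. x \<in> M \<and> \<sigma> n = T x" using \<sigma> by blast
    from choice[OF this] obtain x where x: "\<And>n. x n \<in> M" "\<And>n. \<sigma> n = T (x n)" by blast
    have xE: "x n \<in> carrier E" for n using x(1) ME by blast
    have diff: "c * vnorm E (x m \<ominus>\<^bsub>E\<^esub> x n) \<le> vnorm F (\<sigma> m \<ominus>\<^bsub>F\<^esub> l) + vnorm F (\<sigma> n \<ominus>\<^bsub>F\<^esub> l)" for m n
    proof -
      have "x m \<ominus>\<^bsub>E\<^esub> x n \<in> M"
        by (rule E.submodule_diff[OF sub x(1) x(1)])
      then have "c * vnorm E (x m \<ominus>\<^bsub>E\<^esub> x n) \<le> vnorm F (\<sigma> m \<ominus>\<^bsub>F\<^esub> \<sigma> n)"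
        using c(2)[of "x m \<ominus>\<^bsub>E\<^esub> x n"] map_diff[OF xE xE] x(2) by simp
      also have "\<dots> \<le> vnorm F (\<sigma> m \<ominus>\<^bsub>F\<^esub> l) + vnorm F (l \<ominus>\<^bsub>F\<^esub> \<sigma> n)"
        using l xE x(2) by (intro F.vnorm_diff_triangle) auto
      finally show ?thesis
        using F.vnorm_diff_commute[of l "\<sigma> n"] l xE x(2) by simp
    qed
    have "\<exists>N. \<forall>m\<ge>N. \<forall>n\<ge>N. vnorm E (x m \<ominus>\<^bsub>E\<^esub> x n) < \<epsilon>" if "0 < \<epsilon>" for \<epsilon>
    proof -
      have "0 < c * \<epsilon> / 2" using c(1) that by simp
      then have "\<forall>\<^sub>F n in sequentially. vnorm F (\<sigma> n \<ominus>\<^bsub>F\<^esub> l) < c * \<epsilon> / 2"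
        using lim order_tendstoD(2) by blast
      then obtain N where N: "\<And>n. N \<le> n \<Longrightarrow> vnorm F (\<sigma> n \<ominus>\<^bsub>F\<^esub> l) < c * \<epsilon> / 2"
        unfolding eventually_sequentially by blast
      have "vnorm E (x m \<ominus>\<^bsub>E\<^esub> x n) < \<epsilon>" if "N \<le> m" "N \<le> n" for m n
      proof -
        have "c * vnorm E (x m \<ominus>\<^bsub>E\<^esub> x n) < c * \<epsilon>"
          using diff[of m n] N[OF that(1)] N[OF that(2)] by linarith
        then show ?thesis using c(1) by simp
      qed
      then show ?thesis by blast
    qed
    then obtain y where y: "y \<in> carrier E" "(\<lambda>n. vnorm E (x n \<ominus>\<^bsub>E\<^esub> y)) \<longlonglongrightarrow> 0"
      using E.Cauchy_converges[of x] xE by blast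
    have "y \<in> M"
      using M x(1) y unfolding E.closed_subspace_iff by blast
    have "vnorm F (T y \<ominus>\<^bsub>F\<^esub> l) \<le> K * vnorm E (x n \<ominus>\<^bsub>E\<^esub> y) + vnorm F (\<sigma> n \<ominus>\<^bsub>F\<^esub> l)" for n
    proof -
      have "vnorm F (T y \<ominus>\<^bsub>F\<^esub> l) \<le> vnorm F (T y \<ominus>\<^bsub>F\<^esub> \<sigma> n) + vnorm F (\<sigma> n \<ominus>\<^bsub>F\<^esub> l)"
        using l y xE x(2) by (intro F.vnorm_diff_triangle) auto
      also have "vnorm F (T y \<ominus>\<^bsub>F\<^esub> \<sigma> n) = vnorm F (T (x n \<ominus>\<^bsub>E\<^esub> y))"
        using map_diff[OF xE y(1)] F.vnorm_diff_commute x(2) xE y(1) by simp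
      finally show ?thesis
        using K(2)[of "x n \<ominus>\<^bsub>E\<^esub> y"] xE y(1) by simp
    qed
    moreover have "(\<lambda>n. K * vnorm E (x n \<ominus>\<^bsub>E\<^esub> y) + vnorm F (\<sigma> n \<ominus>\<^bsub>F\<^esub> l)) \<longlonglongrightarrow> K * 0 + 0"
      by (intro tendsto_intros y lim)
    ultimately have "vnorm F (T y \<ominus>\<^bsub>F\<^esub> l) \<le> 0"
      using Lim_bounded2[of _ "K * 0 + 0" 0 "vnorm F (T y \<ominus>\<^bsub>F\<^esub> l)"] by simp
    then have "vnorm F (T y \<ominus>\<^bsub>F\<^esub> l) = 0"
      using F.vnorm_nonneg[OF F.diff_carrier[OF map_carrier[OF y(1)] l]] by linarith
    then have "T y = l"
      using l y(1) by (simp add: F.vnorm_eq_0_iff F.diff_eq_zero_iff)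
    then show ?thesis using \<open>y \<in> M\<close> by blast
  qed
  then show ?thesis
    unfolding F.closed_subspace_iff using image_submodule[OF sub] by blast
qed

text \<open>The isomorphic copy \<open>T ` M\<close> of \<open>M\<close> contains the range \<open>N\<close> of a projection \<open>P\<close>. With \<open>S\<close> the inverse
  of \<open>T\<close> on \<open>M\<close>, the map \<open>S \<circ> P \<circ> T\<close> is a projection onto \<open>S ` N\<close>, because \<open>T \<circ> S\<close> is the identity
  on \<open>N\<close>.\<close>

lemma pull_back_complemented:
  assumes E: "banach_space E" and F: "subprojective F"
    and M: "closed_subspace E M" "\<not> finite_dimensional E M"
    and c: "0 < c" "\<And>x. x \<in> M \<Longrightarrow> c * vnorm E x \<le> vnorm F (T x)"
  shows "\<exists>N. N \<subseteq> M \<and> submodule N scalars E \<and> \<not> finite_dimensional E N \<and> complemented E N"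
proof -
  have sub: "submodule M scalars E"
    using M(1) unfolding E.closed_subspace_iff by blast
  have ME: "M \<subseteq> carrier E"
    using E.submoduleE(1)[OF sub] .
  have inj: "inj_on T M"
    by (rule bounded_below_inj_on[OF sub c])
  have "closed_subspace F (T ` M)"
    by (rule closed_image[OF E M(1) c])
  moreover have "\<not> finite_dimensional F (T ` M)"
    using finite_dimensional_image_iff[OF sub inj] M(2) by simp
  ultimately obtain N where N: "N \<subseteq> T ` M" "submodule N scalars F" "\<not> finite_dimensional F N"
      "complemented F N"
    using F unfolding subprojective_def by blast
  obtain P where P: "bounded_operator F F P" "\<And>y. y \<in> carrier F \<Longrightarrow> P (P y) = P y" "P ` carrier F = N"
    using N(4) unfolding complemented_def by blast
  interpret P: bounded_map F F P
    by unfold_locales (rule P(1))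
  define S where "S = inv_into M T"
  have S: "S y \<in> M" "T (S y) = y" if "y \<in> N" for y
    using that N(1) by (auto simp: S_def inv_into_into f_inv_into_f subset_iff)
  have SE: "S y \<in> carrier E" if "y \<in> N" for y
    using S(1)[OF that] ME by blast
  have PN: "P y \<in> N" if "y \<in> carrier F" for y
    using that P(3) by blast
  have PT: "P (T x) = T x" if "T x \<in> N" "x \<in> carrier E" for x
    using that P(2,3) by force
  define Q where "Q = (\<lambda>x. S (P (T x)))"
  have Q: "Q x \<in> M" "T (Q x) = P (T x)" "Q x \<in> carrier E" if "x \<in> carrier E" for x
    using that S[OF PN] SE[OF PN] by (auto simp: Q_def)
  have Q_eqI: "Q x = z" if "x \<in> carrier E" "z \<in> M" "T z = P (T x)" for x z
    using that Q[of x] inj_onD[OF inj, of "Q x" z] by simp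
  define N' where "N' = {x \<in> M. T x \<in> N}"
  have TN': "T ` N' = N"
    using N(1) by (auto simp: N'_def)
  have sub': "submodule N' scalars E"
  proof (rule E.submoduleI)
    show "N' \<subseteq> carrier E" using ME by (auto simp: N'_def)
    show "\<zero>\<^bsub>E\<^esub> \<in> N'"
      using E.submodule_zero[OF sub] F.submodule_zero[OF N(2)] by (simp add: N'_def)
    have sm: "a \<odot>\<^bsub>E\<^esub> x \<in> N'" if "x \<in> N'" for a x
    proof -
      have "x \<in> M" "T x \<in> N" using that by (auto simp: N'_def)
      then show ?thesis
        using E.submoduleE(4)[OF sub, of a x] F.submoduleE(4)[OF N(2), of a "T x"] map_smult[of x a] ME
        by (auto simp: N'_def)
    qed
    then show "a \<odot>\<^bsub>E\<^esub> x \<in> N'" if "x \<in> N'" for a x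
      using that by blast
    show "\<ominus>\<^bsub>E\<^esub> x \<in> N'" if "x \<in> N'" for x
      using sm[OF that, of "-1"] that ME E.uminus_eq_smult[of x] by (auto simp: N'_def)
    show "x \<oplus>\<^bsub>E\<^esub> y \<in> N'" if "x \<in> N'" "y \<in> N'" for x y
    proof -
      have "x \<in> M" "T x \<in> N" "y \<in> M" "T y \<in> N" using that by (auto simp: N'_def)
      moreover from this have "T (x \<oplus>\<^bsub>E\<^esub> y) = T x \<oplus>\<^bsub>F\<^esub> T y"
        using ME map_add by blast
      ultimately show ?thesis
        using E.submoduleE(5)[OF sub, of x y] F.submoduleE(5)[OF N(2), of "T x" "T y"]
        by (simp add: N'_def)
    qed
  qed
  have "inj_on T N'"
    using inj by (rule inj_on_subset) (auto simp: N'_def)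
  then have "\<not> finite_dimensional E N'"
    using finite_dimensional_image_iff[OF sub'] N(3) by (simp add: TN')
  moreover have "complemented E N'"
    unfolding complemented_def
  proof (intro exI[of _ Q] conjI ballI)
    obtain K where K: "0 < K" "\<And>x. x \<in> carrier E \<Longrightarrow> vnorm F (T x) \<le> K * vnorm E x"
      using bound_pos by blast
    obtain L where L: "0 < L" "\<And>y. y \<in> carrier F \<Longrightarrow> vnorm F (P y) \<le> L * vnorm F y"
      using P.bound_pos by blast
    have "Q (x \<oplus>\<^bsub>E\<^esub> y) = Q x \<oplus>\<^bsub>E\<^esub> Q y" if "x \<in> carrier E" "y \<in> carrier E" for x y
      using that Q[of x] Q[of y] E.submoduleE(5)[OF sub, of "Q x" "Q y"]
      by (intro Q_eqI) (auto simp: map_add P.map_add)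
    moreover have "Q (a \<odot>\<^bsub>E\<^esub> x) = a \<odot>\<^bsub>E\<^esub> Q x" if "x \<in> carrier E" for a x
      using that Q[of x] E.submoduleE(4)[OF sub, of a "Q x"]
      by (intro Q_eqI) (auto simp: map_smult P.map_smult)
    moreover have "vnorm E (Q x) \<le> L * K / c * vnorm E x" if "x \<in> carrier E" for x
    proof -
      have "c * vnorm E (Q x) \<le> vnorm F (P (T x))"
        using c(2)[OF Q(1)[OF that]] Q(2)[OF that] by simp
      also have "\<dots> \<le> L * vnorm F (T x)"
        using L(2) that by blast
      also have "\<dots> \<le> L * (K * vnorm E x)"
        using K(2)[OF that] L(1) by simp
      finally show ?thesis
        using c(1) by (simp add: field_simps)
    qed
    ultimately show "bounded_operator E E Q"
      using Q(3) unfolding bounded_operator_def by (intro conjI ballI allI exI[of _ "L * K / c"]) auto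
    show "Q (Q x) = Q x" if "x \<in> carrier E" for x
      using that Q[of x] P(2) by (intro Q_eqI) auto
    show "Q ` carrier E = N'"
    proof
      show "Q ` carrier E \<subseteq> N'"
        using Q PN by (auto simp: N'_def)
      show "N' \<subseteq> Q ` carrier E"
      proof
        fix x assume x: "x \<in> N'"
        then have "x \<in> M" "T x \<in> N" "x \<in> carrier E" using ME by (auto simp: N'_def)
        then have "Q x = x" using PT by (intro Q_eqI) auto
        then show "x \<in> Q ` carrier E" using \<open>x \<in> carrier E\<close> by force
      qed
    qed
  qed
  moreover have "N' \<subseteq> M" by (auto simp: N'_def)
  ultimately show ?thesis using sub' by blast
qed

end

section \<open>Closed spans\<close>

definition vclosure :: "('k::real_or_complex, 'a) nspace \<Rightarrow> 'a set \<Rightarrow> 'a set" where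
  "vclosure E L = {x \<in> carrier E. \<forall>\<epsilon>>0. \<exists>y\<in>L. vnorm E (y \<ominus>\<^bsub>E\<^esub> x) < \<epsilon>}"

context normed_vspace
begin

lemma subset_vclosure: "L \<subseteq> carrier E \<Longrightarrow> L \<subseteq> vclosure E L"
  by (force simp: vclosure_def)

lemma vclosure_subset:
  assumes M: "closed_subspace E M" and L: "L \<subseteq> M"
  shows "vclosure E L \<subseteq> M"
proof
  fix x assume x: "x \<in> vclosure E L"
  have "\<forall>n. \<exists>y. y \<in> L \<and> vnorm E (y \<ominus>\<^bsub>E\<^esub> x) < inverse (real (Suc n))"
  proof
    fix n
    have "0 < inverse (real (Suc n))" by simp
    then show "\<exists>y. y \<in> L \<and> vnorm E (y \<ominus>\<^bsub>E\<^esub> x) < inverse (real (Suc n))"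
      using x unfolding vclosure_def by blast
  qed
  from choice[OF this] obtain y where y: "\<And>n. y n \<in> L" "\<And>n. vnorm E (y n \<ominus>\<^bsub>E\<^esub> x) < inverse (real (Suc n))"
    by blast
  have LE: "L \<subseteq> carrier E"
    using M L submoduleE(1) unfolding closed_subspace_iff by blast
  have xE: "x \<in> carrier E" using x by (simp add: vclosure_def)
  have "(\<lambda>n. vnorm E (y n \<ominus>\<^bsub>E\<^esub> x)) \<longlonglongrightarrow> 0"
  proof (rule tendsto_sandwich[OF _ _ tendsto_const LIMSEQ_inverse_real_of_nat])
    show "\<forall>\<^sub>F n in sequentially. 0 \<le> vnorm E (y n \<ominus>\<^bsub>E\<^esub> x)"
      using y(1) LE xE by (intro always_eventually allI vnorm_nonneg diff_carrier) auto
    show "\<forall>\<^sub>F n in sequentially. vnorm E (y n \<ominus>\<^bsub>E\<^esub> x) \<le> inverse (real (Suc n))"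
      using y(2) by (intro always_eventually allI less_imp_le)
  qed
  moreover have "\<forall>n. y n \<in> M" using y(1) L by blast
  ultimately show "x \<in> M"
    using M xE unfolding closed_subspace_iff by blast
qed

lemma closed_subspace_vclosure:
  assumes L: "submodule L scalars E"
  shows "closed_subspace E (vclosure E L)"
proof -
  have LE: "L \<subseteq> carrier E" using submoduleE(1)[OF L] .
  have sm: "a \<odot>\<^bsub>E\<^esub> x \<in> vclosure E L" if x: "x \<in> vclosure E L" for a x
    unfolding vclosure_def
  proof (intro CollectI conjI allI impI)
    have xE: "x \<in> carrier E" using x by (simp add: vclosure_def)
    then show "a \<odot>\<^bsub>E\<^esub> x \<in> carrier E" by simp
    fix \<epsilon> :: real assume "0 < \<epsilon>"
    then have "0 < \<epsilon> / (norm a + 1)" by (simp add: add_nonneg_pos)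
    then obtain y where y: "y \<in> L" "vnorm E (y \<ominus>\<^bsub>E\<^esub> x) < \<epsilon> / (norm a + 1)"
      using x unfolding vclosure_def by blast
    have yE: "y \<in> carrier E" using y LE by blast
    have "vnorm E (a \<odot>\<^bsub>E\<^esub> y \<ominus>\<^bsub>E\<^esub> a \<odot>\<^bsub>E\<^esub> x) = norm a * vnorm E (y \<ominus>\<^bsub>E\<^esub> x)"
      using xE yE smult_diff[of y x a] vnorm_smult[of "y \<ominus>\<^bsub>E\<^esub> x" a] by simp
    also have "\<dots> \<le> (norm a + 1) * vnorm E (y \<ominus>\<^bsub>E\<^esub> x)"
      using xE yE by (intro mult_right_mono) auto
    also have "\<dots> < \<epsilon>"
      using y(2) by (simp add: pos_less_divide_eq add_nonneg_pos mult.commute)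
    finally show "\<exists>y\<in>L. vnorm E (y \<ominus>\<^bsub>E\<^esub> a \<odot>\<^bsub>E\<^esub> x) < \<epsilon>"
      using submoduleE(4)[OF L, of a y] y(1) by auto
  qed
  have "submodule (vclosure E L) scalars E"
  proof (rule submoduleI)
    show "vclosure E L \<subseteq> carrier E" by (auto simp: vclosure_def)
    have "L \<noteq> {}" using submoduleE(2)[OF L] .
    then obtain y where y: "y \<in> L" by blast
    then have "y \<in> vclosure E L" using subset_vclosure[OF LE] by blast
    then show "\<zero>\<^bsub>E\<^esub> \<in> vclosure E L"
      using sm[of y 0] y LE by auto
    show "\<ominus>\<^bsub>E\<^esub> x \<in> vclosure E L" if "x \<in> vclosure E L" for x
    proof -
      have "x \<in> carrier E" using that by (simp add: vclosure_def)
      then show ?thesis using sm[OF that, of "-1"] uminus_eq_smult by simp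
    qed
    show "a \<odot>\<^bsub>E\<^esub> x \<in> vclosure E L" if "x \<in> vclosure E L" for a x
      by (rule sm[OF that])
    show "x \<oplus>\<^bsub>E\<^esub> y \<in> vclosure E L" if x: "x \<in> vclosure E L" and y: "y \<in> vclosure E L" for x y
      unfolding vclosure_def
    proof (intro CollectI conjI allI impI)
      have E: "x \<in> carrier E" "y \<in> carrier E" using x y by (simp_all add: vclosure_def)
      then show "x \<oplus>\<^bsub>E\<^esub> y \<in> carrier E" by simp
      fix \<epsilon> :: real assume "0 < \<epsilon>"
      then have "0 < \<epsilon> / 2" by simp
      then obtain x' y' where *: "x' \<in> L" "vnorm E (x' \<ominus>\<^bsub>E\<^esub> x) < \<epsilon> / 2" "y' \<in> L" "vnorm E (y' \<ominus>\<^bsub>E\<^esub> y) < \<epsilon> / 2"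
        using x y unfolding vclosure_def by blast
      have E': "x' \<in> carrier E" "y' \<in> carrier E" using * LE by auto
      have "vnorm E ((x' \<oplus>\<^bsub>E\<^esub> y') \<ominus>\<^bsub>E\<^esub> (x \<oplus>\<^bsub>E\<^esub> y)) < \<epsilon>"
        using vnorm_triangle[of "x' \<ominus>\<^bsub>E\<^esub> x" "y' \<ominus>\<^bsub>E\<^esub> y"] * E E' by (simp add: add_diff_add)
      then show "\<exists>z\<in>L. vnorm E (z \<ominus>\<^bsub>E\<^esub> (x \<oplus>\<^bsub>E\<^esub> y)) < \<epsilon>"
        using submoduleE(5)[OF L *(1,3)] by blast
    qed
  qed
  moreover have "l \<in> vclosure E L"
    if \<sigma>: "\<forall>n. \<sigma> n \<in> vclosure E L" and l: "l \<in> carrier E" and lim: "(\<lambda>n. vnorm E (\<sigma> n \<ominus>\<^bsub>E\<^esub> l)) \<longlonglongrightarrow> 0" for \<sigma> l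
    unfolding vclosure_def
  proof (intro CollectI conjI allI impI l)
    fix \<epsilon> :: real assume "0 < \<epsilon>"
    then have half: "0 < \<epsilon> / 2" by simp
    then obtain n where n: "vnorm E (\<sigma> n \<ominus>\<^bsub>E\<^esub> l) < \<epsilon> / 2"
      using order_tendstoD(2)[OF lim half] unfolding eventually_sequentially by blast
    have "\<sigma> n \<in> vclosure E L" using \<sigma> by blast
    then obtain y where y: "y \<in> L" "vnorm E (y \<ominus>\<^bsub>E\<^esub> \<sigma> n) < \<epsilon> / 2" and \<sigma>E: "\<sigma> n \<in> carrier E"
      using half unfolding vclosure_def by blast
    have "vnorm E (y \<ominus>\<^bsub>E\<^esub> l) < \<epsilon>"
      using vnorm_diff_triangle[of y "\<sigma> n" l] n y LE \<sigma>E l by auto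
    then show "\<exists>y\<in>L. vnorm E (y \<ominus>\<^bsub>E\<^esub> l) < \<epsilon>" using y(1) by blast
  qed
  ultimately show ?thesis
    unfolding closed_subspace_iff by blast
qed

end

text \<open>The estimate from below passes from finite linear combinations to the closure of their
  span, to which \<open>pull_back_complemented\<close> applies.\<close>

lemma (in bounded_map) pull_back_complemented_seq_span:
  assumes E: "banach_space E" and F: "subprojective F"
    and M: "closed_subspace E M"
    and x: "coeff_bounded E C x" "range x \<subseteq> M"
    and c: "0 < c" "\<And>y. y \<in> seq_span E x \<Longrightarrow> c * vnorm E y \<le> vnorm F (T y)"
  shows "\<exists>N. N \<subseteq> M \<and> submodule N scalars E \<and> \<not> finite_dimensional E N \<and> complemented E N"
proof -
  let ?L = "seq_span E x"
  have xE: "x j \<in> carrier E" for j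
    using x by (simp add: coeff_bounded_def)
  have L: "submodule ?L scalars E"
    by (rule E.seq_span_submodule[OF xE])
  have LE: "?L \<subseteq> carrier E"
    using E.submoduleE(1)[OF L] .
  have sub: "submodule M scalars E"
    using M unfolding E.closed_subspace_iff by blast
  have "?L \<subseteq> M"
    using E.submodule_lincomb[OF sub, of x] x(2) unfolding seq_span_def by blast
  then have clM: "vclosure E ?L \<subseteq> M"
    by (rule E.vclosure_subset[OF M])
  have "x k \<in> ?L" for k
  proof -
    have "lincomb E x (\<lambda>j. if j = k then 1 else 0) (Suc k) = x k"
      using E.lincomb_single[of x k "Suc k" 1, OF xE] xE by simp
    then show ?thesis
      unfolding seq_span_def by (intro CollectI exI[of _ "\<lambda>j. if j = k then 1 else 0"] exI[of _ "Suc k"]) auto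
  qed
  then have rng: "range x \<subseteq> vclosure E ?L"
    using E.subset_vclosure[OF LE] by blast
  obtain K where K: "0 < K" "\<And>x. x \<in> carrier E \<Longrightarrow> vnorm F (T x) \<le> K * vnorm E x"
    using bound_pos by blast
  have below: "c * vnorm E y \<le> vnorm F (T y)" if y: "y \<in> vclosure E ?L" for y
  proof (rule field_le_epsilon)
    fix \<epsilon> :: real assume "0 < \<epsilon>"
    then have "0 < \<epsilon> / (c + K)" using c K by simp
    then obtain z where z: "z \<in> ?L" "vnorm E (z \<ominus>\<^bsub>E\<^esub> y) < \<epsilon> / (c + K)" and yE: "y \<in> carrier E"
      using y unfolding vclosure_def by blast
    have zE: "z \<in> carrier E" using z LE by blast
    have "c * vnorm E y \<le> c * (vnorm E (z \<ominus>\<^bsub>E\<^esub> y) + vnorm E z)"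
      using E.vnorm_le_diff[OF yE zE] E.vnorm_diff_commute[OF yE zE] c by simp
    also have "\<dots> = c * vnorm E (z \<ominus>\<^bsub>E\<^esub> y) + c * vnorm E z"
      by (rule distrib_left)
    also have "c * vnorm E z \<le> vnorm F (T z)" by (rule c(2)[OF z(1)])
    also have "vnorm F (T z) \<le> vnorm F (T (z \<ominus>\<^bsub>E\<^esub> y)) + vnorm F (T y)"
      using F.vnorm_le_diff[of "T z" "T y"] zE yE by (simp add: map_diff)
    also have "vnorm F (T (z \<ominus>\<^bsub>E\<^esub> y)) \<le> K * vnorm E (z \<ominus>\<^bsub>E\<^esub> y)"
      using K(2) zE yE by simp
    finally have "c * vnorm E y \<le> (c + K) * vnorm E (z \<ominus>\<^bsub>E\<^esub> y) + vnorm F (T y)"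
      by (simp add: algebra_simps)
    also have "(c + K) * vnorm E (z \<ominus>\<^bsub>E\<^esub> y) \<le> \<epsilon>"
      using z(2) c(1) K(1) by (simp add: pos_less_divide_eq mult.commute)
    finally show "c * vnorm E y \<le> vnorm F (T y) + \<epsilon>" by simp
  qed
  have "\<not> finite_dimensional E (vclosure E ?L)"
    by (rule E.coeff_bounded_not_finite_dimensional[OF x(1) rng]) (auto simp: vclosure_def)
  from pull_back_complemented[OF E F E.closed_subspace_vclosure[OF L] this c(1) below]
  show ?thesis using clM by blast
qed


section \<open>The quotient map\<close>

lemma (in normed_vspace) bounded_operator_quotient_map:
  assumes M: "submodule M scalars E"
  shows "bounded_operator E (quotient_space E M) (\<lambda>x. M +>\<^bsub>E\<^esub> x)"
proof -
  have "additive_subgroup M E"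
    using M by (simp add: additive_subgroup_def submodule_def)
  then interpret abelian_subgroup M E
    by (rule abelian_subgroupI3) (rule M.abelian_group_axioms)
  have "(\<Union>z\<in>M +>\<^bsub>E\<^esub> x. M +>\<^bsub>E\<^esub> (a \<odot>\<^bsub>E\<^esub> z)) = M +>\<^bsub>E\<^esub> (a \<odot>\<^bsub>E\<^esub> x)" if x: "x \<in> carrier E" for a x
  proof -
    have "M +>\<^bsub>E\<^esub> (a \<odot>\<^bsub>E\<^esub> z) = M +>\<^bsub>E\<^esub> (a \<odot>\<^bsub>E\<^esub> x)" if z: "z \<in> M +>\<^bsub>E\<^esub> x" for z
    proof -
      have zE: "z \<in> carrier E" by (rule a_elemrcos_carrier[OF x z])
      have "z \<ominus>\<^bsub>E\<^esub> x \<in> M"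
        using a_rcos_module_imp[OF x z] by (simp add: a_minus_def)
      then have "a \<odot>\<^bsub>E\<^esub> (z \<ominus>\<^bsub>E\<^esub> x) \<in> M"
        using submoduleE(4)[OF M] by simp
      then have "a \<odot>\<^bsub>E\<^esub> z \<oplus>\<^bsub>E\<^esub> \<ominus>\<^bsub>E\<^esub> (a \<odot>\<^bsub>E\<^esub> x) \<in> M"
        using smult_diff[OF zE x, of a] by (simp add: a_minus_def)
      then have "a \<odot>\<^bsub>E\<^esub> z \<in> M +>\<^bsub>E\<^esub> (a \<odot>\<^bsub>E\<^esub> x)"
        using a_rcos_module_rev[of "a \<odot>\<^bsub>E\<^esub> x" "a \<odot>\<^bsub>E\<^esub> z"] x zE by simp
      then show ?thesis
        using a_repr_independence'[of "a \<odot>\<^bsub>E\<^esub> z" "a \<odot>\<^bsub>E\<^esub> x"] x by simp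
    qed
    then show ?thesis
      using a_rcos_self[OF x] by blast
  qed
  moreover have "(INF z\<in>M +>\<^bsub>E\<^esub> x. vnorm E z) \<le> 1 * vnorm E x" if x: "x \<in> carrier E" for x
  proof -
    have "bdd_below (vnorm E ` (M +>\<^bsub>E\<^esub> x))"
      using a_elemrcos_carrier[OF x] by (intro bdd_belowI2[of _ 0]) auto
    then show ?thesis
      using cINF_lower[OF _ a_rcos_self[OF x]] by simp
  qed
  ultimately show ?thesis
    unfolding bounded_operator_def quotient_space_def
    by (intro conjI ballI allI exI[of _ 1])
      (auto simp: a_rcos_sum intro: a_rcosetsI[OF a_subset])
qed

lemma (in normed_vspace) quotient_norm_less:
  assumes M: "submodule M scalars E" and x: "x \<in> carrier E"
    and less: "vnorm (quotient_space E M) (M +>\<^bsub>E\<^esub> x) < \<epsilon>"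
  obtains y where "y \<in> M" "vnorm E (x \<ominus>\<^bsub>E\<^esub> y) < \<epsilon>"
proof -
  have "additive_subgroup M E"
    using M by (simp add: additive_subgroup_def submodule_def)
  then interpret abelian_subgroup M E
    by (rule abelian_subgroupI3) (rule M.abelian_group_axioms)
  have lt: "(INF z\<in>M +>\<^bsub>E\<^esub> x. vnorm E z) < \<epsilon>"
    using less by (simp add: quotient_space_def)
  have ne: "M +>\<^bsub>E\<^esub> x \<noteq> {}" using a_rcos_self[OF x] by blast
  have bd: "bdd_below (vnorm E ` (M +>\<^bsub>E\<^esub> x))"
    using a_elemrcos_carrier[OF x] by (intro bdd_belowI2[of _ 0]) auto
  have "\<exists>z\<in>M +>\<^bsub>E\<^esub> x. vnorm E z < \<epsilon>"
    by (rule iffD1[OF cINF_less_iff[OF ne bd] lt])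
  then obtain z where z: "z \<in> M +>\<^bsub>E\<^esub> x" "vnorm E z < \<epsilon>"
    by blast
  have zE: "z \<in> carrier E" by (rule a_elemrcos_carrier[OF x z(1)])
  have "z \<ominus>\<^bsub>E\<^esub> x \<in> M"
    using a_rcos_module_imp[OF x z(1)] by (simp add: a_minus_def)
  then have "\<ominus>\<^bsub>E\<^esub> (z \<ominus>\<^bsub>E\<^esub> x) \<in> M" by simp
  then have "x \<ominus>\<^bsub>E\<^esub> z \<in> M" using minus_diff[OF zE x] by simp
  then show thesis
    using that[of "x \<ominus>\<^bsub>E\<^esub> z"] z(2) diff_diff_cancel[OF x zE] by simp
qed

section \<open>Sums of squares along chains\<close>

text \<open>For the squared differences that occur in \<^const>\<open>rho\<close>. The recursion along the chain makes
  telescoping bounds provable by induction on lists.\<close>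

fun jsum :: "(nat \<Rightarrow> nat \<Rightarrow> real) \<Rightarrow> nat list \<Rightarrow> real" where
  "jsum j (p # q # ps) = (j p q)\<^sup>2 + jsum j (q # ps)"
| "jsum j _ = 0"

lemma jsum_nonneg: "0 \<le> jsum j ps"
  by (induction j ps rule: jsum.induct) auto

lemma jsum_eq_sum: "jsum j ps = (\<Sum>i=1..length ps - 1. (j (ps ! (i - 1)) (ps ! i))\<^sup>2)"
proof (induction j ps rule: jsum.induct)
  case (1 j p q ps)
  have "(\<Sum>i=1..length (p # q # ps) - 1. (j ((p # q # ps) ! (i - 1)) ((p # q # ps) ! i))\<^sup>2) =
      (\<Sum>i<Suc (length ps). (j ((p # q # ps) ! i) ((q # ps) ! i))\<^sup>2)"
    by (rule sum.reindex_bij_witness[of _ Suc "\<lambda>i. i - 1"]) auto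
  also have "\<dots> = (j p q)\<^sup>2 + (\<Sum>i<length ps. (j ((q # ps) ! i) (ps ! i))\<^sup>2)"
    by (subst sum.lessThan_Suc_shift) simp
  also have "(\<Sum>i<length ps. (j ((q # ps) ! i) (ps ! i))\<^sup>2) =
      (\<Sum>i=1..length (q # ps) - 1. (j ((q # ps) ! (i - 1)) ((q # ps) ! i))\<^sup>2)"
    by (rule sum.reindex_bij_witness[of _ "\<lambda>i. i - 1" Suc]) auto
  finally show ?case
    using 1 by simp
qed simp_all

lemma jsum_cong:
  assumes "sorted_wrt (<) ps" "\<And>p q. p \<in> set ps \<Longrightarrow> q \<in> set ps \<Longrightarrow> p < q \<Longrightarrow> j p q = j' p q"
  shows "jsum j ps = jsum j' ps"
  using assms by (induction j ps rule: jsum.induct) auto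

lemma jsum_scale:
  assumes "sorted_wrt (<) ps" "\<And>p q. p < q \<Longrightarrow> j p q = c * j' p q"
  shows "jsum j ps = c\<^sup>2 * jsum j' ps"
  using assms by (induction j ps rule: jsum.induct) (auto simp: power_mult_distrib distrib_left)

lemma sqrt_add_sq_triangle:
  fixes a b c A B C :: real
  assumes "0 \<le> a" "a \<le> b + c" "0 \<le> b" "0 \<le> c" "0 \<le> A" "0 \<le> B" "0 \<le> C" "sqrt A \<le> sqrt B + sqrt C"
  shows "sqrt (A + a\<^sup>2) \<le> sqrt (B + b\<^sup>2) + sqrt (C + c\<^sup>2)"
proof -
  have "sqrt (A + a\<^sup>2) = sqrt ((sqrt A)\<^sup>2 + a\<^sup>2)"
    using assms by simp
  also have "\<dots> \<le> sqrt ((sqrt B + sqrt C)\<^sup>2 + (b + c)\<^sup>2)"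
    using assms by (intro real_sqrt_le_mono add_mono power_mono) auto
  also have "\<dots> \<le> sqrt ((sqrt B)\<^sup>2 + b\<^sup>2) + sqrt ((sqrt C)\<^sup>2 + c\<^sup>2)"
    by (rule real_sqrt_sum_squares_triangle_ineq)
  finally show ?thesis
    using assms by simp
qed

lemma sqrt_jsum_triangle:
  assumes "sorted_wrt (<) ps"
    "\<And>p q. p < q \<Longrightarrow> 0 \<le> j p q \<and> 0 \<le> j1 p q \<and> 0 \<le> j2 p q \<and> j p q \<le> j1 p q + j2 p q"
  shows "sqrt (jsum j ps) \<le> sqrt (jsum j1 ps) + sqrt (jsum j2 ps)"
  using assms
proof (induction j ps rule: jsum.induct)
  case (1 j p q ps)
  then have "sqrt (jsum j (q # ps) + (j p q)\<^sup>2) \<le>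
      sqrt (jsum j1 (q # ps) + (j1 p q)\<^sup>2) + sqrt (jsum j2 (q # ps) + (j2 p q)\<^sup>2)"
    by (intro sqrt_add_sq_triangle) (auto simp: jsum_nonneg)
  then show ?case by (simp add: add.commute)
qed simp_all

lemma power2_sum_le: "(a + b)\<^sup>2 \<le> 2 * a\<^sup>2 + 2 * (b::real)\<^sup>2"
  using sum_squares_bound[of a b] by (simp add: power2_sum)

section \<open>Jumps and potentials\<close>

locale J_sum =
  fixes X :: "nat \<Rightarrow> ('k::real_or_complex, 'a) nspace" and \<phi> :: "nat \<Rightarrow> 'a \<Rightarrow> 'a"
  assumes X_banach: "banach_space (X n)"
    and X_0: "carrier (X 0) = {\<zero>\<^bsub>X 0\<^esub>}"
    and \<phi>_bounded: "bounded_operator (X n) (X (Suc n)) (\<phi> n)"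
    and \<phi>_norm: "operator_norm (X n) (X (Suc n)) (\<phi> n) \<le> 1"
begin

sublocale X: banach_space "X n" for n
  by (rule X_banach)

sublocale phi: bounded_map "X n" "X (Suc n)" "\<phi> n" for n
  by unfold_locales (rule \<phi>_bounded)

lemma \<phi>_contraction:
  assumes v: "v \<in> carrier (X n)"
  shows "vnorm (X (Suc n)) (\<phi> n v) \<le> vnorm (X n) v"
proof (cases "vnorm (X n) v = 0")
  case True
  then have "v = \<zero>\<^bsub>X n\<^esub>" using v by (simp add: X.vnorm_eq_0_iff)
  then show ?thesis by simp
next
  case False
  define r where "r = vnorm (X n) v"
  have r: "0 < r" using False X.vnorm_nonneg[OF v] by (simp add: r_def)
  define w where "w = of_real (inverse r) \<odot>\<^bsub>X n\<^esub> v"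
  have w: "w \<in> carrier (X n)" "vnorm (X n) w = 1"
    using v r by (auto simp: w_def X.vnorm_smult r_def[symmetric] norm_inverse)
  obtain K where K: "0 < K" "\<And>x. x \<in> carrier (X n) \<Longrightarrow> vnorm (X (Suc n)) (\<phi> n x) \<le> K * vnorm (X n) x"
    using phi.bound_pos[of n] by blast
  have "vnorm (X (Suc n)) (\<phi> n w) \<le> operator_norm (X n) (X (Suc n)) (\<phi> n)"
    unfolding operator_norm_def
  proof (rule cSUP_upper)
    show "w \<in> {x \<in> carrier (X n). vnorm (X n) x \<le> 1}" using w by simp
    show "bdd_above ((\<lambda>x. vnorm (X (Suc n)) (\<phi> n x)) ` {x \<in> carrier (X n). vnorm (X n) x \<le> 1})"
    proof (rule bdd_aboveI2)
      fix x assume "x \<in> {x \<in> carrier (X n). vnorm (X n) x \<le> 1}"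
      then show "vnorm (X (Suc n)) (\<phi> n x) \<le> K"
        using order_trans[OF K(2)[of x] mult_left_mono[of "vnorm (X n) x" 1 K]] K(1) by simp
    qed
  qed
  also have "\<dots> \<le> 1" by (rule \<phi>_norm)
  also have "vnorm (X (Suc n)) (\<phi> n w) = inverse r * vnorm (X (Suc n)) (\<phi> n v)"
    using v r by (simp add: w_def phi.map_smult X.vnorm_smult norm_inverse)
  finally show ?thesis
    using r by (simp add: r_def[symmetric] field_simps)
qed

lemma comp_maps_self [simp]: "comp_maps \<phi> n n v = v"
  by (simp add: comp_maps_def)

lemma comp_maps_Suc: "n \<le> m \<Longrightarrow> comp_maps \<phi> n (Suc m) v = \<phi> m (comp_maps \<phi> n m v)"
  by (simp add: comp_maps_def)

lemma comp_maps_trans: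
  "p \<le> q \<Longrightarrow> q \<le> r \<Longrightarrow> comp_maps \<phi> q r (comp_maps \<phi> p q v) = comp_maps \<phi> p r v"
  using upt_add_eq_append[of p q "r - q"] by (simp add: comp_maps_def)

lemma comp_maps_props:
  assumes "p \<le> q"
  shows comp_maps_carrier: "v \<in> carrier (X p) \<Longrightarrow> comp_maps \<phi> p q v \<in> carrier (X q)"
    and comp_maps_add: "v \<in> carrier (X p) \<Longrightarrow> w \<in> carrier (X p) \<Longrightarrow>
      comp_maps \<phi> p q (v \<oplus>\<^bsub>X p\<^esub> w) = comp_maps \<phi> p q v \<oplus>\<^bsub>X q\<^esub> comp_maps \<phi> p q w"
    and comp_maps_smult: "v \<in> carrier (X p) \<Longrightarrow>
      comp_maps \<phi> p q (a \<odot>\<^bsub>X p\<^esub> v) = a \<odot>\<^bsub>X q\<^esub> comp_maps \<phi> p q v"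
    and comp_maps_contraction: "v \<in> carrier (X p) \<Longrightarrow> vnorm (X q) (comp_maps \<phi> p q v) \<le> vnorm (X p) v"
    and comp_maps_zero: "comp_maps \<phi> p q \<zero>\<^bsub>X p\<^esub> = \<zero>\<^bsub>X q\<^esub>"
proof -
  have "(\<forall>v\<in>carrier (X p). comp_maps \<phi> p q v \<in> carrier (X q) \<and>
      (\<forall>w\<in>carrier (X p). comp_maps \<phi> p q (v \<oplus>\<^bsub>X p\<^esub> w) = comp_maps \<phi> p q v \<oplus>\<^bsub>X q\<^esub> comp_maps \<phi> p q w) \<and>
      (\<forall>a. comp_maps \<phi> p q (a \<odot>\<^bsub>X p\<^esub> v) = a \<odot>\<^bsub>X q\<^esub> comp_maps \<phi> p q v) \<and>
      vnorm (X q) (comp_maps \<phi> p q v) \<le> vnorm (X p) v) \<and> comp_maps \<phi> p q \<zero>\<^bsub>X p\<^esub> = \<zero>\<^bsub>X q\<^esub>"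
    using assms
  proof (induction q rule: dec_induct)
    case base
    then show ?case by simp
  next
    case (step q)
    then show ?case
      by (auto simp: comp_maps_Suc phi.map_add phi.map_smult intro: order_trans[OF \<phi>_contraction])
  qed
  then show "v \<in> carrier (X p) \<Longrightarrow> comp_maps \<phi> p q v \<in> carrier (X q)"
    "v \<in> carrier (X p) \<Longrightarrow> w \<in> carrier (X p) \<Longrightarrow>
      comp_maps \<phi> p q (v \<oplus>\<^bsub>X p\<^esub> w) = comp_maps \<phi> p q v \<oplus>\<^bsub>X q\<^esub> comp_maps \<phi> p q w"
    "v \<in> carrier (X p) \<Longrightarrow> comp_maps \<phi> p q (a \<odot>\<^bsub>X p\<^esub> v) = a \<odot>\<^bsub>X q\<^esub> comp_maps \<phi> p q v"
    "v \<in> carrier (X p) \<Longrightarrow> vnorm (X q) (comp_maps \<phi> p q v) \<le> vnorm (X p) v"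
    "comp_maps \<phi> p q \<zero>\<^bsub>X p\<^esub> = \<zero>\<^bsub>X q\<^esub>"
    by blast+
qed

lemma comp_maps_diff:
  "p \<le> q \<Longrightarrow> v \<in> carrier (X p) \<Longrightarrow> w \<in> carrier (X p) \<Longrightarrow>
    comp_maps \<phi> p q (v \<ominus>\<^bsub>X p\<^esub> w) = comp_maps \<phi> p q v \<ominus>\<^bsub>X q\<^esub> comp_maps \<phi> p q w"
  by (simp add: X.diff_eq_smult comp_maps_add comp_maps_smult comp_maps_carrier)

definition seqs :: "(nat \<Rightarrow> 'a) set" where
  "seqs = {x. \<forall>n. x n \<in> carrier (X n)}"

lemma seqsD: "x \<in> seqs \<Longrightarrow> x n \<in> carrier (X n)"
  by (simp add: seqs_def)

lemma seqs_add [simp]: "x \<in> seqs \<Longrightarrow> y \<in> seqs \<Longrightarrow> (\<lambda>n. x n \<oplus>\<^bsub>X n\<^esub> y n) \<in> seqs"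
  by (simp add: seqs_def)

lemma seqs_smult [simp]: "x \<in> seqs \<Longrightarrow> (\<lambda>n. a \<odot>\<^bsub>X n\<^esub> x n) \<in> seqs"
  by (simp add: seqs_def)

lemma seqs_diff [simp]: "x \<in> seqs \<Longrightarrow> y \<in> seqs \<Longrightarrow> (\<lambda>n. x n \<ominus>\<^bsub>X n\<^esub> y n) \<in> seqs"
  by (simp add: seqs_def)

definition jump :: "(nat \<Rightarrow> 'a) \<Rightarrow> nat \<Rightarrow> nat \<Rightarrow> real" where
  "jump x p q = vnorm (X q) (comp_maps \<phi> p q (x p) \<ominus>\<^bsub>X q\<^esub> x q)"

abbreviation H where "H \<equiv> J_hat X \<phi>"

lemma H_ops:
  "\<zero>\<^bsub>H\<^esub> = (\<lambda>n. \<zero>\<^bsub>X n\<^esub>)" "x \<oplus>\<^bsub>H\<^esub> y = (\<lambda>n. x n \<oplus>\<^bsub>X n\<^esub> y n)"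
  "a \<odot>\<^bsub>H\<^esub> x = (\<lambda>n. a \<odot>\<^bsub>X n\<^esub> x n)"
  by (simp_all add: J_hat_def)

lemma vnorm_H: "vnorm H = J_norm X \<phi>"
  by (simp add: J_hat_def)

lemma jump_nonneg [simp]: "x \<in> seqs \<Longrightarrow> p \<le> q \<Longrightarrow> 0 \<le> jump x p q"
  by (simp add: jump_def comp_maps_carrier seqs_def)

lemma jump_self [simp]: "x \<in> seqs \<Longrightarrow> jump x p p = 0"
  by (simp add: jump_def seqs_def)

lemma jump_add:
  assumes "x \<in> seqs" "y \<in> seqs" "p \<le> q"
  shows "jump (\<lambda>n. x n \<oplus>\<^bsub>X n\<^esub> y n) p q \<le> jump x p q + jump y p q"
  using X.vnorm_triangle[of "comp_maps \<phi> p q (x p) \<ominus>\<^bsub>X q\<^esub> x q" q "comp_maps \<phi> p q (y p) \<ominus>\<^bsub>X q\<^esub> y q"] assms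
  by (simp add: jump_def comp_maps_add comp_maps_carrier X.add_diff_add seqs_def)

lemma jump_smult:
  assumes "x \<in> seqs" "p \<le> q"
  shows "jump (\<lambda>n. a \<odot>\<^bsub>X n\<^esub> x n) p q = norm a * jump x p q"
  using X.vnorm_smult[of "comp_maps \<phi> p q (x p) \<ominus>\<^bsub>X q\<^esub> x q" q a] assms
  by (simp add: jump_def comp_maps_smult comp_maps_carrier X.smult_diff seqs_def)

lemma jump_le_vnorm:
  assumes "x \<in> seqs" "p \<le> q"
  shows "jump x p q \<le> vnorm (X p) (x p) + vnorm (X q) (x q)"
proof -
  have "jump x p q \<le> vnorm (X q) (comp_maps \<phi> p q (x p)) + vnorm (X q) (x q)"
    unfolding jump_def by (rule X.vnorm_diff_le[OF comp_maps_carrier[OF assms(2) seqsD[OF assms(1)]] seqsD[OF assms(1)]])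
  then show ?thesis
    using comp_maps_contraction[OF assms(2) seqsD[OF assms(1)]] by linarith
qed

lemma jump_trans:
  assumes "x \<in> seqs" "p \<le> q" "q \<le> r"
  shows "jump x p r \<le> jump x p q + jump x q r"
proof -
  let ?u = "comp_maps \<phi> p q (x p)"
  have u: "?u \<in> carrier (X q)" "comp_maps \<phi> q r ?u \<in> carrier (X r)" "comp_maps \<phi> q r (x q) \<in> carrier (X r)"
    using comp_maps_carrier[OF assms(2) seqsD[OF assms(1)]] comp_maps_carrier[OF assms(3) seqsD[OF assms(1)]]
      comp_maps_carrier[OF assms(3)] by blast+
  have "jump x p r = vnorm (X r) (comp_maps \<phi> q r ?u \<ominus>\<^bsub>X r\<^esub> x r)"
    using assms(2,3) by (simp add: jump_def comp_maps_trans)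
  also have "\<dots> \<le> vnorm (X r) (comp_maps \<phi> q r ?u \<ominus>\<^bsub>X r\<^esub> comp_maps \<phi> q r (x q)) + jump x q r"
    unfolding jump_def by (rule X.vnorm_diff_triangle[OF u(2,3) seqsD[OF assms(1)]])
  also have "comp_maps \<phi> q r ?u \<ominus>\<^bsub>X r\<^esub> comp_maps \<phi> q r (x q) = comp_maps \<phi> q r (?u \<ominus>\<^bsub>X q\<^esub> x q)"
    using comp_maps_diff[OF assms(3) u(1) seqsD[OF assms(1)]] by simp
  also have "vnorm (X r) \<dots> \<le> jump x p q"
    unfolding jump_def by (rule comp_maps_contraction[OF assms(3) X.diff_carrier[OF u(1) seqsD[OF assms(1)]]])
  finally show ?thesis by simp
qed

lemma seq_0: "x \<in> seqs \<Longrightarrow> x 0 = \<zero>\<^bsub>X 0\<^esub>"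
  using seqsD[of x 0] X_0 by simp

text \<open>Because \<open>X 0\<close> is trivial, the norm of an entry is itself a jump, so bounds on jumps also
  bound the final term of \<^const>\<open>rho\<close>.\<close>

lemma jump_0: "x \<in> seqs \<Longrightarrow> jump x 0 q = vnorm (X q) (x q)"
  using seq_0[of x] comp_maps_zero[of 0 q] X.minus_diff[of "\<zero>\<^bsub>X q\<^esub>" q "x q"]
    X.vnorm_diff_commute[of "\<zero>\<^bsub>X q\<^esub>" q "x q"]
  by (simp add: jump_def seqs_def)

lemma vnorm_eq_0_seq: "x \<in> seqs \<Longrightarrow> vnorm (X 0) (x 0) = 0"
  by (simp add: seq_0)

lemma rho_eq:
  assumes S: "finite S" "S \<noteq> {}"
  shows "rho X \<phi> x S =
    sqrt (jsum (jump x) (sorted_list_of_set S) + (vnorm (X (Max S)) (x (Max S)))\<^sup>2)"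
proof -
  have ne: "sorted_list_of_set S \<noteq> []" using S by simp
  have last_Max: "last ps = Max (set ps)" if "sorted ps" "ps \<noteq> []" for ps :: "nat list"
    using that
  proof (induction ps)
    case (Cons p ps)
    show ?case
    proof (cases "ps = []")
      case False
      then have "p \<le> Max (set ps)"
        using Cons.prems by (meson List.finite_set Max_in Max_ge set_empty list.set_intros sorted_simps(2))
      then show ?thesis
        using Cons False by (simp add: max_def)
    qed simp
  qed simp
  have "sorted_list_of_set S ! (card S - 1) = last (sorted_list_of_set S)"
    using ne by (simp add: last_conv_nth)
  also have "\<dots> = Max S"
    using last_Max[OF _ ne] S by simp
  finally have "sorted_list_of_set S ! (card S - 1) = Max S" .
  then show ?thesis
    unfolding rho_def Let_def jsum_eq_sum by (simp add: jump_def)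
qed

lemma rho_add:
  assumes "x \<in> seqs" "y \<in> seqs" "finite S" "S \<noteq> {}"
  shows "rho X \<phi> (\<lambda>n. x n \<oplus>\<^bsub>X n\<^esub> y n) S \<le> rho X \<phi> x S + rho X \<phi> y S"
  unfolding rho_eq[OF assms(3,4)]
  using assms
  by (intro sqrt_add_sq_triangle sqrt_jsum_triangle)
    (auto simp: jsum_nonneg X.vnorm_triangle less_imp_le jump_add seqsD[OF assms(1)] seqsD[OF assms(2)])

lemma rho_smult:
  assumes "x \<in> seqs" "finite S" "S \<noteq> {}"
  shows "rho X \<phi> (\<lambda>n. a \<odot>\<^bsub>X n\<^esub> x n) S = norm a * rho X \<phi> x S"
proof -
  have "jsum (jump (\<lambda>n. a \<odot>\<^bsub>X n\<^esub> x n)) (sorted_list_of_set S) = (norm a)\<^sup>2 * jsum (jump x) (sorted_list_of_set S)"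
    using assms by (intro jsum_scale) (auto simp: jump_smult less_imp_le)
  then show ?thesis
    unfolding rho_eq[OF assms(2,3)] using assms(1)
    by (simp add: X.vnorm_smult power_mult_distrib distrib_left[symmetric] real_sqrt_mult seqsD[OF assms(1)])
qed

text \<open>Summing the inequality along a chain telescopes, so a potential bounds the sum of the squared
  jumps along every chain by its value at the first index.\<close>

definition potential :: "(nat \<Rightarrow> 'a) \<Rightarrow> (nat \<Rightarrow> real) \<Rightarrow> bool" where
  "potential x F \<longleftrightarrow> (\<forall>p. 0 \<le> F p) \<and> (\<forall>p q. p < q \<longrightarrow> (jump x p q)\<^sup>2 + F q \<le> F p)"

text \<open>The quadratic variation of \<open>x\<close> on the indices from \<open>a\<close> on.\<close>

definition qvar :: "(nat \<Rightarrow> 'a) \<Rightarrow> nat \<Rightarrow> real" where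
  "qvar x a = (SUP ps\<in>{ps. sorted_wrt (<) ps \<and> set ps \<subseteq> {a..}}. jsum (jump x) ps)"

lemma potential_nonneg: "potential x F \<Longrightarrow> 0 \<le> F p"
  by (simp add: potential_def)

lemma potential_step: "potential x F \<Longrightarrow> p < q \<Longrightarrow> (jump x p q)\<^sup>2 + F q \<le> F p"
  by (simp add: potential_def)

lemma potential_antimono: "potential x F \<Longrightarrow> p \<le> q \<Longrightarrow> F q \<le> F p"
proof (cases "p = q")
  case False
  assume "potential x F" "p \<le> q"
  then have "(jump x p q)\<^sup>2 + F q \<le> F p"
    using False potential_step by simp
  then show ?thesis
    using zero_le_power2[of "jump x p q"] by linarith
qed simp

lemma jsum_le_potential:
  assumes F: "potential x F" and ps: "sorted_wrt (<) ps" "set ps \<subseteq> {a..}"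
  shows "jsum (jump x) ps \<le> F a"
proof -
  have "jsum (jump x) (p # ps) \<le> F p" if "sorted_wrt (<) (p # ps)" for p ps
    using that
  proof (induction ps arbitrary: p)
    case (Cons q ps)
    then show ?case
      using potential_step[OF F, of p q] by force
  qed (simp add: potential_nonneg[OF F])
  then show ?thesis
    using ps potential_antimono[OF F, of a] potential_nonneg[OF F, of a]
    by (cases ps) (auto intro: order_trans)
qed

lemma chains_nonempty: "{ps. sorted_wrt (<) ps \<and> set ps \<subseteq> {a::nat..}} \<noteq> {}"
proof -
  have "[] \<in> {ps. sorted_wrt (<) ps \<and> set ps \<subseteq> {a..}}" by simp
  then show ?thesis by blast
qed

text \<open>Together with \<open>potential_qvar\<close> below: the quadratic variation is the least potential.\<close>

lemma qvar_le_potential: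
  assumes "potential x F"
  shows "qvar x a \<le> F a"
  unfolding qvar_def using jsum_le_potential[OF assms] by (intro cSUP_least chains_nonempty) auto

lemma bdd_jsum:
  assumes B: "\<And>ps. sorted_wrt (<) ps \<Longrightarrow> jsum (jump x) ps \<le> B"
  shows "bdd_above (jsum (jump x) ` {ps. sorted_wrt (<) ps \<and> set ps \<subseteq> {a..}})"
  using B by (intro bdd_aboveI2) auto

lemma potential_qvar_if_bounded:
  assumes B: "\<And>ps. sorted_wrt (<) ps \<Longrightarrow> jsum (jump x) ps \<le> B"
  shows "potential x (qvar x)"
proof -
  have up: "jsum (jump x) ps \<le> qvar x a" if "sorted_wrt (<) ps" "set ps \<subseteq> {a..}" for ps a
    unfolding qvar_def using that by (intro cSUP_upper bdd_jsum[OF B]) auto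
  have "0 \<le> qvar x p" for p
    using up[of "[]" p] by simp
  moreover have "(jump x p q)\<^sup>2 + qvar x q \<le> qvar x p" if "p < q" for p q
  proof -
    have "qvar x q \<le> qvar x p - (jump x p q)\<^sup>2"
      unfolding qvar_def[of x q]
    proof (rule cSUP_least)
      show "{ps. sorted_wrt (<) ps \<and> set ps \<subseteq> {q..}} \<noteq> {}" by (rule chains_nonempty)
      fix ps assume ps: "ps \<in> {ps. sorted_wrt (<) ps \<and> set ps \<subseteq> {q..}}"
      \<comment> \<open>prefixing \<open>q\<close>, unless it is already the first index, only enlarges the sum\<close>
      define qs where "qs = (if ps \<noteq> [] \<and> hd ps = q then ps else q # ps)"
      have qs: "sorted_wrt (<) qs" "set qs \<subseteq> {q..}" "jsum (jump x) ps \<le> jsum (jump x) qs"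
        "\<exists>rs. qs = q # rs"
        subgoal using ps by (cases ps) (auto simp: qs_def)
        subgoal using ps by (cases ps) (auto simp: qs_def)
        subgoal using ps by (cases ps) (auto simp: qs_def)
        subgoal using ps by (cases ps) (auto simp: qs_def)
        done
      have "jsum (jump x) (p # qs) \<le> qvar x p"
        using qs \<open>p < q\<close> by (intro up) force+
      moreover have "jsum (jump x) (p # qs) = (jump x p q)\<^sup>2 + jsum (jump x) qs"
        using qs(4) by auto
      ultimately show "jsum (jump x) ps \<le> qvar x p - (jump x p q)\<^sup>2"
        using qs(3) by linarith
    qed
    then show ?thesis by linarith
  qed
  ultimately show ?thesis
    by (simp add: potential_def)
qed

lemma carrier_H: "carrier H = {x \<in> seqs. bdd_above (rho X \<phi> x ` {S. finite S \<and> S \<noteq> {}})}"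
  by (simp add: J_hat_def seqs_def)

lemma H_seqs: "x \<in> carrier H \<Longrightarrow> x \<in> seqs"
  by (simp add: carrier_H)

lemma H_carrier: "x \<in> carrier H \<Longrightarrow> x n \<in> carrier (X n)"
  by (simp add: carrier_H seqs_def)

lemma rho_le_potential:
  assumes x: "x \<in> seqs" and F: "potential x F" and S: "finite S" "S \<noteq> {}"
  shows "rho X \<phi> x S \<le> sqrt (2 * F 0)"
proof -
  have "jsum (jump x) (sorted_list_of_set S) \<le> F 0"
    by (rule jsum_le_potential[OF F]) auto
  moreover have "(vnorm (X (Max S)) (x (Max S)))\<^sup>2 \<le> F 0"
  proof (cases "Max S = 0")
    case True
    then show ?thesis using vnorm_eq_0_seq[OF x] potential_nonneg[OF F, of 0] by simp
  next
    case False
    then show ?thesis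
      using potential_step[OF F, of 0 "Max S"] potential_nonneg[OF F, of "Max S"] jump_0[OF x, of "Max S"]
      by simp
  qed
  ultimately show ?thesis
    unfolding rho_eq[OF S] by simp
qed

text \<open>Membership in \<open>H\<close> and upper bounds for its norm are obtained below by exhibiting a
  potential; the supremum over finite index sets is not taken up again. The factor \<open>2\<close> for the
  two parts of \<^const>\<open>rho\<close> cancels against the normalization of \<^const>\<open>J_norm\<close>.\<close>

lemma
  assumes x: "x \<in> seqs" and F: "potential x F"
  shows carrier_H_potential: "x \<in> carrier H"
    and vnorm_le_potential: "vnorm H x \<le> sqrt (F 0)"
proof -
  have bd: "rho X \<phi> x S \<le> sqrt (2 * F 0)" if "S \<in> {S. finite S \<and> S \<noteq> {}}" for S
    using rho_le_potential[OF x F] that by blast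
  have "bdd_above (rho X \<phi> x ` {S. finite S \<and> S \<noteq> {}})"
    using bd by (rule bdd_aboveI2[where M = "sqrt (2 * F 0)"])
  then show "x \<in> carrier H"
    using x by (simp add: carrier_H)
  have "{S::nat set. finite S \<and> S \<noteq> {}} \<noteq> {}" by blast
  then have "(SUP S\<in>{S. finite S \<and> S \<noteq> {}}. rho X \<phi> x S) \<le> sqrt (2 * F 0)"
    using bd by (intro cSUP_least)
  then show "vnorm H x \<le> sqrt (F 0)"
    unfolding vnorm_H J_norm_def by (simp add: field_simps real_sqrt_mult)
qed

lemma rho_le_vnorm:
  assumes "x \<in> carrier H" "finite S" "S \<noteq> {}"
  shows "rho X \<phi> x S \<le> sqrt 2 * vnorm H x"
  using cSUP_upper[of S "{S. finite S \<and> S \<noteq> {}}" "rho X \<phi> x"] assms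
  by (simp add: carrier_H vnorm_H J_norm_def)

lemma vnorm_leI:
  assumes "\<And>S. finite S \<Longrightarrow> S \<noteq> {} \<Longrightarrow> rho X \<phi> x S \<le> sqrt 2 * c"
  shows "vnorm H x \<le> c"
proof -
  have "{S::nat set. finite S \<and> S \<noteq> {}} \<noteq> {}" by blast
  then have "(SUP S\<in>{S. finite S \<and> S \<noteq> {}}. rho X \<phi> x S) \<le> sqrt 2 * c"
    using assms by (intro cSUP_least) auto
  then show ?thesis
    unfolding vnorm_H J_norm_def by (simp add: field_simps)
qed

lemma vnorm_entry_le:
  assumes "x \<in> carrier H"
  shows "vnorm (X n) (x n) \<le> sqrt 2 * vnorm H x"
proof -
  have "rho X \<phi> x {n} = vnorm (X n) (x n)"
    using H_carrier[OF assms, of n] by (simp add: rho_eq)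
  then show ?thesis
    using rho_le_vnorm[OF assms, of "{n}"] by simp
qed

lemma vnorm_H_nonneg: "x \<in> carrier H \<Longrightarrow> 0 \<le> vnorm H x"
  using vnorm_entry_le[of x 0] X.vnorm_nonneg[of "x 0" 0]
  by (simp add: vnorm_eq_0_seq H_seqs zero_le_mult_iff)

lemma jsum_le_vnorm:
  assumes x: "x \<in> carrier H" and ps: "sorted_wrt (<) ps"
  shows "jsum (jump x) ps \<le> 2 * (vnorm H x)\<^sup>2"
proof (cases "ps = []")
  case False
  have "sorted_list_of_set (set ps) = ps"
    using ps by (simp add: strict_sorted_iff sorted_list_of_set.idem_if_sorted_distinct)
  then have "sqrt (jsum (jump x) ps) \<le> rho X \<phi> x (set ps)"
    using False by (simp add: rho_eq)
  also have "\<dots> \<le> sqrt 2 * vnorm H x"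
    using rho_le_vnorm[OF x, of "set ps"] False by simp
  finally have "sqrt (jsum (jump x) ps) \<le> sqrt (2 * (vnorm H x)\<^sup>2)"
    using vnorm_H_nonneg[OF x] by (simp add: real_sqrt_mult)
  then show ?thesis by simp
qed simp

lemma potential_qvar: "x \<in> carrier H \<Longrightarrow> potential x (qvar x)"
  by (rule potential_qvar_if_bounded) (rule jsum_le_vnorm)

lemma qvar_nonneg: "x \<in> carrier H \<Longrightarrow> 0 \<le> qvar x a"
  using potential_nonneg[OF potential_qvar] .

lemma qvar_step: "x \<in> carrier H \<Longrightarrow> p < q \<Longrightarrow> (jump x p q)\<^sup>2 + qvar x q \<le> qvar x p"
  using potential_step[OF potential_qvar] .

lemma qvar_antimono: "x \<in> carrier H \<Longrightarrow> p \<le> q \<Longrightarrow> qvar x q \<le> qvar x p"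
  using potential_antimono[OF potential_qvar] .

lemma jsum_le_qvar:
  "x \<in> carrier H \<Longrightarrow> sorted_wrt (<) ps \<Longrightarrow> set ps \<subseteq> {a..} \<Longrightarrow> jsum (jump x) ps \<le> qvar x a"
  using jsum_le_potential[OF potential_qvar] .

lemma qvar_le_vnorm: "x \<in> carrier H \<Longrightarrow> qvar x a \<le> 2 * (vnorm H x)\<^sup>2"
  unfolding qvar_def using jsum_le_vnorm by (intro cSUP_least chains_nonempty) auto

lemma vnorm_le_qvar: "x \<in> carrier H \<Longrightarrow> (vnorm H x)\<^sup>2 \<le> qvar x 0"
  using vnorm_le_potential[OF H_seqs potential_qvar, of x] vnorm_H_nonneg[of x] qvar_nonneg[of x 0]
  by (metis real_sqrt_le_iff real_sqrt_unique abs_of_nonneg real_sqrt_abs)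

lemma vnorm_sq_le_qvar: "x \<in> carrier H \<Longrightarrow> (vnorm (X n) (x n))\<^sup>2 \<le> qvar x 0"
  using qvar_step[of x 0 n] qvar_nonneg[of x n] qvar_nonneg[of x 0] jump_0[of x n]
  by (cases "n = 0") (auto simp: H_seqs vnorm_eq_0_seq)

text \<open>A potential minus its limit is again a potential, so the limit of the least potential
  is \<open>0\<close>.\<close>

lemma qvar_tendsto_0:
  assumes x: "x \<in> carrier H"
  shows "qvar x \<longlonglongrightarrow> 0"
proof -
  have dec: "decseq (qvar x)"
    using qvar_antimono[OF x] by (simp add: decseq_def)
  obtain l where l: "qvar x \<longlonglongrightarrow> l" "\<And>n. l \<le> qvar x n"
    using decseq_convergent[OF dec, of 0] qvar_nonneg[OF x] by blast
  have "potential x (\<lambda>p. qvar x p - l)"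
    using l(2) qvar_step[OF x] by (force simp: potential_def)
  then have "l \<le> 0"
    using qvar_le_potential[of x "\<lambda>p. qvar x p - l" 0] by simp
  moreover have "0 \<le> l"
    using l(1) qvar_nonneg[OF x] by (intro LIMSEQ_le_const) auto
  ultimately show ?thesis using l(1) by simp
qed

end

section \<open>Completeness of the space of sequences of bounded quadratic variation\<close>

context J_sum
begin

lemma potential_add:
  assumes "x \<in> seqs" "y \<in> seqs" "potential x F" "potential y G"
  shows "potential (\<lambda>n. x n \<oplus>\<^bsub>X n\<^esub> y n) (\<lambda>p. 2 * F p + 2 * G p)"
  unfolding potential_def
proof (intro conjI allI impI)
  show "0 \<le> 2 * F p + 2 * G p" for p
    using potential_nonneg[OF assms(3), of p] potential_nonneg[OF assms(4), of p] by simp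
  fix p q :: nat assume "p < q"
  then have "(jump (\<lambda>n. x n \<oplus>\<^bsub>X n\<^esub> y n) p q)\<^sup>2 \<le> (jump x p q + jump y p q)\<^sup>2"
    using assms by (intro power_mono jump_add jump_nonneg) auto
  also have "\<dots> \<le> 2 * (jump x p q)\<^sup>2 + 2 * (jump y p q)\<^sup>2"
    by (rule power2_sum_le)
  finally show "(jump (\<lambda>n. x n \<oplus>\<^bsub>X n\<^esub> y n) p q)\<^sup>2 + (2 * F q + 2 * G q) \<le> 2 * F p + 2 * G p"
    using potential_step[OF assms(3) \<open>p < q\<close>] potential_step[OF assms(4) \<open>p < q\<close>] by linarith
qed

lemma potential_smult:
  assumes "x \<in> seqs" "potential x F"
  shows "potential (\<lambda>n. a \<odot>\<^bsub>X n\<^esub> x n) (\<lambda>p. (norm a)\<^sup>2 * F p)"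
  unfolding potential_def
proof (intro conjI allI impI)
  show "0 \<le> (norm a)\<^sup>2 * F p" for p
    using potential_nonneg[OF assms(2), of p] by simp
  fix p q :: nat assume "p < q"
  then show "(jump (\<lambda>n. a \<odot>\<^bsub>X n\<^esub> x n) p q)\<^sup>2 + (norm a)\<^sup>2 * F q \<le> (norm a)\<^sup>2 * F p"
    using assms(1) mult_left_mono[OF potential_step[OF assms(2) \<open>p < q\<close>], of "(norm a)\<^sup>2"]
    by (simp add: jump_smult power_mult_distrib distrib_left)
qed

lemma H_add: "x \<in> carrier H \<Longrightarrow> y \<in> carrier H \<Longrightarrow> (\<lambda>n. x n \<oplus>\<^bsub>X n\<^esub> y n) \<in> carrier H"
  using carrier_H_potential[OF _ potential_add[OF _ _ potential_qvar potential_qvar]] by (simp add: H_seqs)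

lemma H_smult: "x \<in> carrier H \<Longrightarrow> (\<lambda>n. a \<odot>\<^bsub>X n\<^esub> x n) \<in> carrier H"
  using carrier_H_potential[OF _ potential_smult[OF _ potential_qvar]] by (simp add: H_seqs)

lemma H_zero: "(\<lambda>n. \<zero>\<^bsub>X n\<^esub>) \<in> carrier H"
proof (rule carrier_H_potential)
  show z: "(\<lambda>n. \<zero>\<^bsub>X n\<^esub>) \<in> seqs" by (simp add: seqs_def)
  show "potential (\<lambda>n. \<zero>\<^bsub>X n\<^esub>) (\<lambda>_. 0)"
    by (simp add: potential_def jump_def comp_maps_zero)
qed

lemma cring_scalars: "cring (scalars :: 'k ring)"
  using X.module_axioms[of 0] by (simp add: Module.module_def)

lemma vnorm_H_add:
  assumes "x \<in> carrier H" "y \<in> carrier H"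
  shows "vnorm H (\<lambda>n. x n \<oplus>\<^bsub>X n\<^esub> y n) \<le> vnorm H x + vnorm H y"
proof (rule vnorm_leI)
  fix S :: "nat set" assume S: "finite S" "S \<noteq> {}"
  show "rho X \<phi> (\<lambda>n. x n \<oplus>\<^bsub>X n\<^esub> y n) S \<le> sqrt 2 * (vnorm H x + vnorm H y)"
    using rho_add[OF H_seqs[OF assms(1)] H_seqs[OF assms(2)] S]
      rho_le_vnorm[OF assms(1) S] rho_le_vnorm[OF assms(2) S] by (simp add: distrib_left)
qed

lemma vnorm_H_smult_le:
  assumes "x \<in> carrier H"
  shows "vnorm H (\<lambda>n. a \<odot>\<^bsub>X n\<^esub> x n) \<le> norm a * vnorm H x"
proof (rule vnorm_leI)
  fix S :: "nat set" assume S: "finite S" "S \<noteq> {}"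
  show "rho X \<phi> (\<lambda>n. a \<odot>\<^bsub>X n\<^esub> x n) S \<le> sqrt 2 * (norm a * vnorm H x)"
    using mult_left_mono[OF rho_le_vnorm[OF assms S], of "norm a"]
    by (simp add: rho_smult[OF H_seqs[OF assms] S] mult_ac)
qed

lemma normed_vspace_H: "normed_vspace H"
proof (intro normed_vspace.intro normed_vspace_axioms.intro)
  have "abelian_group H"
  proof (rule abelian_groupI)
    fix x assume x: "x \<in> carrier H"
    have "(\<lambda>n. (-1) \<odot>\<^bsub>X n\<^esub> x n) \<oplus>\<^bsub>H\<^esub> x = \<zero>\<^bsub>H\<^esub>"
      using x by (auto simp: H_ops X.uminus_eq_smult[symmetric] H_carrier X.M.l_neg)
    then show "\<exists>y\<in>carrier H. y \<oplus>\<^bsub>H\<^esub> x = \<zero>\<^bsub>H\<^esub>"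
      using H_smult[OF x] by blast
  qed (auto simp: H_ops H_add H_zero H_carrier X.M.a_ac)
  then show "Module.module scalars H"
    by (intro Module.moduleI cring_scalars)
      (auto simp: H_ops H_smult H_carrier X.smult_add_left X.smult_add_right X.smult_smult scalars_def)
next
  fix x y and a :: 'k assume x: "x \<in> carrier H"
  show "vnorm H x = 0 \<longleftrightarrow> x = \<zero>\<^bsub>H\<^esub>"
  proof
    assume 0: "vnorm H x = 0"
    have "x n = \<zero>\<^bsub>X n\<^esub>" for n
    proof -
      have "vnorm (X n) (x n) = 0"
        using vnorm_entry_le[OF x, of n] X.vnorm_nonneg[OF H_carrier[OF x], of n] 0 by simp
      then show ?thesis
        using X.vnorm_eq_0_iff[OF H_carrier[OF x], of n] by simp
    qed
    then show "x = \<zero>\<^bsub>H\<^esub>" by (auto simp: H_ops)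
  next
    assume "x = \<zero>\<^bsub>H\<^esub>"
    then have "x = (\<lambda>n. 0 \<odot>\<^bsub>X n\<^esub> x n)" using x by (auto simp: H_ops)
    then have "vnorm H x \<le> 0"
      using vnorm_H_smult_le[OF x, of 0] by simp
    then show "vnorm H x = 0"
      using vnorm_H_nonneg[OF x] by simp
  qed
  show "vnorm H (a \<odot>\<^bsub>H\<^esub> x) = norm a * vnorm H x"
  proof (cases "a = 0")
    case True
    then show ?thesis
      using vnorm_H_smult_le[OF x, of 0] vnorm_H_nonneg[OF H_smult[OF x, of 0]] by (simp add: H_ops)
  next
    case False
    have "(\<lambda>n. inverse a \<odot>\<^bsub>X n\<^esub> (a \<odot>\<^bsub>X n\<^esub> x n)) = x"
      using x False by (auto simp: X.smult_smult H_carrier)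
    then have "vnorm H x \<le> norm (inverse a) * vnorm H (\<lambda>n. a \<odot>\<^bsub>X n\<^esub> x n)"
      using vnorm_H_smult_le[OF H_smult[OF x], of "inverse a" a] by simp
    then have "norm a * vnorm H x \<le> vnorm H (\<lambda>n. a \<odot>\<^bsub>X n\<^esub> x n)"
      using False unfolding norm_inverse by (simp add: field_simps)
    then show ?thesis
      using vnorm_H_smult_le[OF x, of a] by (simp add: H_ops)
  qed
  show "vnorm H (x \<oplus>\<^bsub>H\<^esub> y) \<le> vnorm H x + vnorm H y" if "y \<in> carrier H"
    using vnorm_H_add[OF x that] by (simp add: H_ops)
qed

sublocale H: normed_vspace H
  by (rule normed_vspace_H)

lemma H_diff: "x \<in> carrier H \<Longrightarrow> y \<in> carrier H \<Longrightarrow> x \<ominus>\<^bsub>H\<^esub> y = (\<lambda>n. x n \<ominus>\<^bsub>X n\<^esub> y n)"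
  by (simp add: H.diff_eq_smult H_ops X.diff_eq_smult H_carrier)

lemma jsum_tendsto_0:
  assumes z: "\<And>k. z k \<in> seqs" and lim: "\<And>p. (\<lambda>k. vnorm (X p) (z k p)) \<longlonglongrightarrow> 0"
    and ps: "sorted_wrt (<) ps"
  shows "(\<lambda>k. jsum (jump (z k)) ps) \<longlonglongrightarrow> 0"
  using ps
proof (induction ps rule: induct_list012)
  case (3 p q ps)
  have "(\<lambda>k. jump (z k) p q) \<longlonglongrightarrow> 0"
  proof (rule tendsto_sandwich[OF _ _ tendsto_const])
    show "\<forall>\<^sub>F k in sequentially. 0 \<le> jump (z k) p q"
      using 3 z by (intro always_eventually allI jump_nonneg) auto
    show "\<forall>\<^sub>F k in sequentially. jump (z k) p q \<le> vnorm (X p) (z k p) + vnorm (X q) (z k q)"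
      using 3 z by (intro always_eventually allI jump_le_vnorm) auto
    show "(\<lambda>k. vnorm (X p) (z k p) + vnorm (X q) (z k q)) \<longlonglongrightarrow> 0"
      using tendsto_add[OF lim lim, of p q] by simp
  qed
  then have "(\<lambda>k. (jump (z k) p q)\<^sup>2 + jsum (jump (z k)) (q # ps)) \<longlonglongrightarrow> 0\<^sup>2 + 0"
    using 3 by (intro tendsto_intros) auto
  then show ?case by simp
qed auto

text \<open>A Cauchy sequence converges in every coordinate, and for a fixed finite index set
  \<^const>\<open>rho\<close> depends on finitely many coordinates only. So the Cauchy estimate for \<^const>\<open>rho\<close>, which is
  uniform in the index set, passes to the limit.\<close>

lemma banach_space_H: "banach_space H"
proof (intro banach_space.intro banach_space_axioms.intro normed_vspace_H)
  show "H.metric.mcomplete"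
    unfolding H.mcomplete_iff
  proof (intro allI impI)
    fix \<sigma> :: "nat \<Rightarrow> nat \<Rightarrow> 'a" assume \<sigma>: "\<forall>n. \<sigma> n \<in> carrier H"
      and Cauchy: "\<forall>\<epsilon>>0. \<exists>N. \<forall>m\<ge>N. \<forall>n\<ge>N. vnorm H (\<sigma> m \<ominus>\<^bsub>H\<^esub> \<sigma> n) < \<epsilon>"
    have \<sigma>s: "\<sigma> n \<in> seqs" for n using \<sigma> H_seqs by blast
    have \<sigma>X: "\<sigma> n p \<in> carrier (X p)" for n p using \<sigma> H_carrier by blast
    have "\<exists>v. v \<in> carrier (X p) \<and> (\<lambda>n. vnorm (X p) (\<sigma> n p \<ominus>\<^bsub>X p\<^esub> v)) \<longlonglongrightarrow> 0" for p
    proof -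
      have C: "\<exists>N. \<forall>m\<ge>N. \<forall>n\<ge>N. vnorm (X p) (\<sigma> m p \<ominus>\<^bsub>X p\<^esub> \<sigma> n p) < \<epsilon>" if "0 < \<epsilon>" for \<epsilon>
      proof -
        have "0 < \<epsilon> / sqrt 2" using that by simp
        then obtain N where N: "\<And>m n. N \<le> m \<Longrightarrow> N \<le> n \<Longrightarrow> vnorm H (\<sigma> m \<ominus>\<^bsub>H\<^esub> \<sigma> n) < \<epsilon> / sqrt 2"
          using Cauchy by blast
        have "vnorm (X p) (\<sigma> m p \<ominus>\<^bsub>X p\<^esub> \<sigma> n p) < \<epsilon>" if "N \<le> m" "N \<le> n" for m n
        proof -
          have "vnorm (X p) ((\<sigma> m \<ominus>\<^bsub>H\<^esub> \<sigma> n) p) \<le> sqrt 2 * vnorm H (\<sigma> m \<ominus>\<^bsub>H\<^esub> \<sigma> n)"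
            using \<sigma> by (intro vnorm_entry_le) auto
          also have "\<dots> < \<epsilon>" using N[OF that] by (simp add: field_simps)
          finally show ?thesis using \<sigma> by (simp add: H_diff)
        qed
        then show ?thesis by blast
      qed
      show ?thesis
        by (rule X.Cauchy_converges[of "\<lambda>n. \<sigma> n p" p, OF \<sigma>X C]) blast+
    qed
    then have "\<forall>p. \<exists>v. v \<in> carrier (X p) \<and> (\<lambda>n. vnorm (X p) (\<sigma> n p \<ominus>\<^bsub>X p\<^esub> v)) \<longlonglongrightarrow> 0" by blast
    from choice[OF this] obtain l
      where l: "\<And>p. l p \<in> carrier (X p)" "\<And>p. (\<lambda>n. vnorm (X p) (\<sigma> n p \<ominus>\<^bsub>X p\<^esub> l p)) \<longlonglongrightarrow> 0"
      by blast
    have ls: "l \<in> seqs" using l(1) by (simp add: seqs_def)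
    define z where "z = (\<lambda>k p. \<sigma> k p \<ominus>\<^bsub>X p\<^esub> l p)"
    have zs: "z k \<in> seqs" for k using \<sigma>s ls by (simp add: z_def)
    have z_split: "z m = (\<lambda>p. (\<sigma> m \<ominus>\<^bsub>H\<^esub> \<sigma> k) p \<oplus>\<^bsub>X p\<^esub> z k p)" for m k
      using \<sigma> \<sigma>X l(1) by (simp add: z_def H_diff X.diff_add_diff)
    have rho0: "(\<lambda>k. rho X \<phi> (z k) S) \<longlonglongrightarrow> 0" if S: "finite S" "S \<noteq> {}" for S
    proof -
      have "(\<lambda>k. sqrt (jsum (jump (z k)) (sorted_list_of_set S) + (vnorm (X (Max S)) (z k (Max S)))\<^sup>2)) \<longlonglongrightarrow> sqrt (0 + 0\<^sup>2)"
        using l(2) zs by (intro tendsto_intros jsum_tendsto_0) (auto simp: z_def)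
      then show ?thesis by (simp add: rho_eq[OF S])
    qed
    have rho_small: "rho X \<phi> (z m) S \<le> sqrt 2 * \<epsilon>"
      if N: "\<And>k. N \<le> k \<Longrightarrow> vnorm H (\<sigma> m \<ominus>\<^bsub>H\<^esub> \<sigma> k) < \<epsilon>" and S: "finite S" "S \<noteq> {}" for m N \<epsilon> S
    proof -
      have "rho X \<phi> (z m) S \<le> sqrt 2 * \<epsilon> + rho X \<phi> (z k) S" if "N \<le> k" for k
      proof -
        have d: "\<sigma> m \<ominus>\<^bsub>H\<^esub> \<sigma> k \<in> carrier H" using \<sigma> by simp
        have "rho X \<phi> (z m) S \<le> rho X \<phi> (\<sigma> m \<ominus>\<^bsub>H\<^esub> \<sigma> k) S + rho X \<phi> (z k) S"
          by (subst z_split[of m k]) (rule rho_add[OF H_seqs[OF d] zs S])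
        also have "rho X \<phi> (\<sigma> m \<ominus>\<^bsub>H\<^esub> \<sigma> k) S \<le> sqrt 2 * vnorm H (\<sigma> m \<ominus>\<^bsub>H\<^esub> \<sigma> k)"
          by (rule rho_le_vnorm[OF d S])
        also have "\<dots> \<le> sqrt 2 * \<epsilon>" using N[OF that] by simp
        finally show ?thesis by simp
      qed
      moreover have "(\<lambda>k. sqrt 2 * \<epsilon> + rho X \<phi> (z k) S) \<longlonglongrightarrow> sqrt 2 * \<epsilon> + 0"
        by (intro tendsto_intros rho0 S)
      ultimately show ?thesis
        using LIMSEQ_le_const[of _ "sqrt 2 * \<epsilon> + 0" "rho X \<phi> (z m) S"] by auto
    qed
    have zH: "z m \<in> carrier H" "vnorm H (z m) \<le> \<epsilon>"
      if N: "\<And>k. N \<le> k \<Longrightarrow> vnorm H (\<sigma> m \<ominus>\<^bsub>H\<^esub> \<sigma> k) < \<epsilon>" for m N \<epsilon>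
    proof -
      have "bdd_above (rho X \<phi> (z m) ` {S. finite S \<and> S \<noteq> {}})"
        using rho_small[OF N] by (intro bdd_aboveI2[of _ _ "sqrt 2 * \<epsilon>"]) auto
      then show "z m \<in> carrier H" using zs by (simp add: carrier_H)
      show "vnorm H (z m) \<le> \<epsilon>" by (rule vnorm_leI) (rule rho_small[OF N])
    qed
    obtain N where N: "\<And>m k. N \<le> m \<Longrightarrow> N \<le> k \<Longrightarrow> vnorm H (\<sigma> m \<ominus>\<^bsub>H\<^esub> \<sigma> k) < 1"
      using Cauchy zero_less_one by blast
    have zN: "z N \<in> carrier H" using zH(1)[of N N 1] N by blast
    have "\<sigma> N \<ominus>\<^bsub>H\<^esub> z N = l"
    proof -
      have "\<sigma> N p \<ominus>\<^bsub>X p\<^esub> (\<sigma> N p \<ominus>\<^bsub>X p\<^esub> l p) = l p" for p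
        by (rule X.diff_diff_cancel[OF \<sigma>X l(1)])
      then show ?thesis using \<sigma> zN by (simp add: H_diff) (simp add: z_def)
    qed
    then have lH: "l \<in> carrier H" using \<sigma> zN H.diff_carrier by metis
    have zeq: "\<sigma> m \<ominus>\<^bsub>H\<^esub> l = z m" for m
      using \<sigma> lH by (simp add: H_diff z_def)
    have "(\<lambda>m. vnorm H (\<sigma> m \<ominus>\<^bsub>H\<^esub> l)) \<longlonglongrightarrow> 0"
    proof (rule LIMSEQ_I)
      fix \<epsilon> :: real assume "0 < \<epsilon>"
      then have "0 < \<epsilon> / 2" by simp
      then obtain N where N: "\<And>m k. N \<le> m \<Longrightarrow> N \<le> k \<Longrightarrow> vnorm H (\<sigma> m \<ominus>\<^bsub>H\<^esub> \<sigma> k) < \<epsilon> / 2"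
        using Cauchy by blast
      have "norm (vnorm H (\<sigma> m \<ominus>\<^bsub>H\<^esub> l) - 0) < \<epsilon>" if "N \<le> m" for m
        using zH[of N m "\<epsilon> / 2"] N[OF that] \<open>0 < \<epsilon>\<close> H.vnorm_nonneg[of "z m"] by (simp add: zeq)
      then show "\<exists>N. \<forall>m\<ge>N. norm (vnorm H (\<sigma> m \<ominus>\<^bsub>H\<^esub> l) - 0) < \<epsilon>" by blast
    qed
    then show "\<exists>l\<in>carrier H. (\<lambda>m. vnorm H (\<sigma> m \<ominus>\<^bsub>H\<^esub> l)) \<longlonglongrightarrow> 0"
      using lH by blast
  qed
qed

end

section \<open>Truncations and anchored differences\<close>

context J_sum
begin

abbreviation J where "J \<equiv> J_space X \<phi>"

lemma J_ops:
  "\<zero>\<^bsub>J\<^esub> = \<zero>\<^bsub>H\<^esub>" "x \<oplus>\<^bsub>J\<^esub> y = x \<oplus>\<^bsub>H\<^esub> y" "a \<odot>\<^bsub>J\<^esub> x = a \<odot>\<^bsub>H\<^esub> x" "vnorm J = vnorm H"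
  by (simp_all add: J_space_def)

lemma carrier_J: "carrier J = {x \<in> carrier H. (\<lambda>n. vnorm (X n) (x n)) \<longlonglongrightarrow> 0}"
  by (simp add: J_space_def)

lemma J_subset_H: "x \<in> carrier J \<Longrightarrow> x \<in> carrier H"
  by (simp add: carrier_J)

lemma J_submodule: "submodule (carrier J) scalars H"
proof (rule H.submoduleI)
  show "carrier J \<subseteq> carrier H" by (auto simp: carrier_J)
  show "\<zero>\<^bsub>H\<^esub> \<in> carrier J" by (simp add: carrier_J) (simp add: H_ops)
  have sm: "a \<odot>\<^bsub>H\<^esub> x \<in> carrier J" if "x \<in> carrier J" for a x
  proof -
    have "(\<lambda>n. norm a * vnorm (X n) (x n)) \<longlonglongrightarrow> norm a * 0"
      using that by (intro tendsto_intros) (simp add: carrier_J)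
    then show ?thesis
      using that H.smult_carrier[of x a] by (simp add: carrier_J) (simp add: H_ops X.vnorm_smult H_carrier)
  qed
  then show "a \<odot>\<^bsub>H\<^esub> x \<in> carrier J" if "x \<in> carrier J" for a x using that .
  show "\<ominus>\<^bsub>H\<^esub> x \<in> carrier J" if "x \<in> carrier J" for x
    using sm[OF that, of "-1"] H.uminus_eq_smult[OF J_subset_H[OF that]] by simp
  show "x \<oplus>\<^bsub>H\<^esub> y \<in> carrier J" if x: "x \<in> carrier J" and y: "y \<in> carrier J" for x y
  proof -
    have H: "x \<in> carrier H" "y \<in> carrier H" using x y by (auto simp: carrier_J)
    have "(\<lambda>n. vnorm (X n) (x n \<oplus>\<^bsub>X n\<^esub> y n)) \<longlonglongrightarrow> 0"
    proof (rule tendsto_sandwich[OF _ _ tendsto_const])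
      show "\<forall>\<^sub>F n in sequentially. 0 \<le> vnorm (X n) (x n \<oplus>\<^bsub>X n\<^esub> y n)"
        by (intro always_eventually allI X.vnorm_nonneg X.M.a_closed H_carrier H)
      show "\<forall>\<^sub>F n in sequentially. vnorm (X n) (x n \<oplus>\<^bsub>X n\<^esub> y n) \<le> vnorm (X n) (x n) + vnorm (X n) (y n)"
        by (intro always_eventually allI X.vnorm_triangle H_carrier H)
      show "(\<lambda>n. vnorm (X n) (x n) + vnorm (X n) (y n)) \<longlonglongrightarrow> 0"
        using x y tendsto_add[of "\<lambda>n. vnorm (X n) (x n)" 0 sequentially "\<lambda>n. vnorm (X n) (y n)" 0]
        by (simp add: carrier_J)
    qed
    then show ?thesis
      using H H.M.a_closed[OF H] by (simp add: carrier_J) (simp add: H_ops)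
  qed
qed

definition trunc :: "nat \<Rightarrow> (nat \<Rightarrow> 'a) \<Rightarrow> nat \<Rightarrow> 'a" where
  "trunc n x = (\<lambda>p. if p < n then x p else \<zero>\<^bsub>X p\<^esub>)"

lemma trunc_seqs: "x \<in> seqs \<Longrightarrow> trunc n x \<in> seqs"
  by (simp add: trunc_def seqs_def)

lemma jump_trunc: "q < n \<Longrightarrow> p \<le> q \<Longrightarrow> jump (trunc n x) p q = jump x p q"
  by (simp add: jump_def trunc_def)

text \<open>The only jump that truncation adds to those of \<open>x\<close> is the one to \<open>0\<close>, which a chain makes at most
  once. It is at most the norm of an entry, whose square the summand \<open>qvar x 0\<close> pays for.\<close>

lemma potential_trunc:
  assumes x: "x \<in> carrier H"
  shows "potential (trunc n x) (\<lambda>p. if p < n then qvar x p + qvar x 0 else 0)"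
  unfolding potential_def
proof (intro conjI allI impI)
  show "0 \<le> (if p < n then qvar x p + qvar x 0 else 0)" for p
    using qvar_nonneg[OF x] by (simp add: add_nonneg_nonneg)
  fix p q :: nat assume "p < q"
  consider "q < n" | "p < n" "n \<le> q" | "n \<le> p" by linarith
  then show "(jump (trunc n x) p q)\<^sup>2 + (if q < n then qvar x q + qvar x 0 else 0)
      \<le> (if p < n then qvar x p + qvar x 0 else 0)"
  proof cases
    case 1
    then show ?thesis
      using qvar_step[OF x \<open>p < q\<close>] \<open>p < q\<close> by (simp add: jump_trunc)
  next
    case 2
    have "jump (trunc n x) p q \<le> vnorm (X p) (trunc n x p) + vnorm (X q) (trunc n x q)"
      using \<open>p < q\<close> by (intro jump_le_vnorm trunc_seqs H_seqs x) auto
    then have "jump (trunc n x) p q \<le> vnorm (X p) (x p)"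
      using 2 by (simp add: trunc_def)
    then have "(jump (trunc n x) p q)\<^sup>2 \<le> (vnorm (X p) (x p))\<^sup>2"
      using \<open>p < q\<close> by (intro power_mono jump_nonneg trunc_seqs H_seqs x) auto
    also have "\<dots> \<le> qvar x 0" by (rule vnorm_sq_le_qvar[OF x])
    finally show ?thesis
      using 2 qvar_nonneg[OF x, of p] by simp
  next
    case 3
    have "jump (trunc n x) p q = 0"
      using 3 \<open>p < q\<close> by (simp add: jump_def trunc_def comp_maps_zero)
    then show ?thesis using 3 \<open>p < q\<close> by simp
  qed
qed

lemma trunc_J:
  assumes x: "x \<in> carrier H"
  shows "trunc n x \<in> carrier J"
proof -
  have "\<forall>\<^sub>F p in sequentially. vnorm (X p) (trunc n x p) = 0"
    using eventually_ge_at_top[of n] by eventually_elim (simp add: trunc_def)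
  then show ?thesis
    using carrier_H_potential[OF trunc_seqs[OF H_seqs[OF x]] potential_trunc[OF x]]
    by (simp add: carrier_J tendsto_eventually)
qed

lemma trunc_H: "x \<in> carrier H \<Longrightarrow> trunc n x \<in> carrier H"
  using trunc_J J_subset_H by blast

lemma sqrt_le_mult_vnorm:
  assumes x: "x \<in> carrier H" and le: "s \<le> c * qvar x 0" and c: "2 * c \<le> K\<^sup>2" "0 \<le> K" "0 \<le> c"
  shows "sqrt s \<le> K * vnorm H x"
proof -
  have "s \<le> c * (2 * (vnorm H x)\<^sup>2)"
    using le mult_left_mono[OF qvar_le_vnorm[OF x, of 0] c(3)] by linarith
  also have "\<dots> \<le> K\<^sup>2 * (vnorm H x)\<^sup>2"
    using mult_right_mono[OF c(1), of "(vnorm H x)\<^sup>2"] by (simp add: mult_ac)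
  finally have "sqrt s \<le> sqrt ((K * vnorm H x)\<^sup>2)"
    by (simp add: power_mult_distrib)
  then show ?thesis
    using c(2) x by simp
qed

lemma vnorm_trunc_le:
  assumes x: "x \<in> carrier H"
  shows "vnorm H (trunc n x) \<le> 2 * vnorm H x"
proof -
  have "vnorm H (trunc n x) \<le> sqrt (if 0 < n then qvar x 0 + qvar x 0 else 0)"
    by (rule vnorm_le_potential[OF trunc_seqs[OF H_seqs[OF x]] potential_trunc[OF x]])
  also have "\<dots> \<le> 2 * vnorm H x"
    using qvar_nonneg[OF x, of 0] by (intro sqrt_le_mult_vnorm[OF x, where c = 2]) auto
  finally show ?thesis .
qed

lemma trunc_add: "x \<in> carrier H \<Longrightarrow> y \<in> carrier H \<Longrightarrow> trunc n (x \<oplus>\<^bsub>H\<^esub> y) = trunc n x \<oplus>\<^bsub>H\<^esub> trunc n y"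
  by (auto simp: trunc_def H_ops)

lemma trunc_smult: "x \<in> carrier H \<Longrightarrow> trunc n (a \<odot>\<^bsub>H\<^esub> x) = a \<odot>\<^bsub>H\<^esub> trunc n x"
  by (auto simp: trunc_def H_ops)

lemma bounded_operator_trunc: "bounded_operator H J (trunc n)"
  unfolding bounded_operator_def J_ops
  using trunc_J trunc_add trunc_smult vnorm_trunc_le by (intro conjI ballI allI exI[of _ 2]) auto

sublocale trunc: bounded_map H H "trunc n" for n
  by unfold_locales (use trunc_H trunc_add trunc_smult vnorm_trunc_le in
      \<open>auto simp: bounded_operator_def intro!: exI[of _ 2]\<close>)

lemma trunc_trunc: "n \<le> m \<Longrightarrow> trunc n (trunc m x) = trunc n x"
  by (auto simp: trunc_def)

text \<open>The finitely supported sequences are dense in \<open>J\<close>. A chain for the tail of \<open>y\<close> has one jump from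
  \<open>0\<close> to an entry, small because \<open>y\<close> tends to \<open>0\<close>, and otherwise jumps of \<open>y\<close> beyond \<open>b\<close>.\<close>

lemma trunc_tail_small:
  assumes y: "y \<in> carrier J" and \<epsilon>: "0 < \<epsilon>"
  shows "\<exists>B. \<forall>b\<ge>B. vnorm H (y \<ominus>\<^bsub>H\<^esub> trunc b y) \<le> \<epsilon>"
proof -
  have yH: "y \<in> carrier H" using y by (rule J_subset_H)
  have ys: "y \<in> seqs" using yH by (rule H_seqs)
  have "0 < \<epsilon> / 2" "0 < \<epsilon>\<^sup>2 / 2" using \<epsilon> by auto
  then have "\<forall>\<^sub>F b in sequentially. vnorm (X b) (y b) < \<epsilon> / 2 \<and> qvar y b < \<epsilon>\<^sup>2 / 2"
    using y by (intro eventually_conj order_tendstoD(2)[OF qvar_tendsto_0[OF yH]] order_tendstoD(2)[of _ 0])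
      (auto simp: carrier_J)
  then obtain B where B: "\<And>b. B \<le> b \<Longrightarrow> vnorm (X b) (y b) < \<epsilon> / 2" "\<And>b. B \<le> b \<Longrightarrow> qvar y b < \<epsilon>\<^sup>2 / 2"
    unfolding eventually_sequentially by blast
  have "vnorm H (y \<ominus>\<^bsub>H\<^esub> trunc b y) \<le> \<epsilon>" if "B \<le> b" for b
  proof -
    define t where "t = (\<lambda>p. if p < b then \<zero>\<^bsub>X p\<^esub> else y p)"
    have t: "y \<ominus>\<^bsub>H\<^esub> trunc b y = t"
      using H_diff[OF yH trunc_H[OF yH]] H_carrier[OF yH] by (auto simp: t_def trunc_def)
    have ts: "t \<in> seqs" using ys by (simp add: t_def seqs_def)
    define F where "F = (\<lambda>p. qvar y (max p b) + (if p < b then \<epsilon>\<^sup>2 / 2 else 0))"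
    have "potential t F"
      unfolding potential_def
    proof (intro conjI allI impI)
      show "0 \<le> F p" for p using qvar_nonneg[OF yH] by (simp add: F_def)
      fix p q :: nat assume "p < q"
      consider "q < b" | "p < b" "b \<le> q" | "b \<le> p" by linarith
      then show "(jump t p q)\<^sup>2 + F q \<le> F p"
      proof cases
        case 1
        then have "jump t p q = 0" using \<open>p < q\<close> by (simp add: jump_def t_def comp_maps_zero)
        then show ?thesis using 1 \<open>p < q\<close> by (simp add: F_def max_def)
      next
        case 2
        have "jump t p q \<le> vnorm (X p) (t p) + vnorm (X q) (t q)"
          using \<open>p < q\<close> by (intro jump_le_vnorm ts) auto
        then have "jump t p q \<le> \<epsilon> / 2"
          using 2 B(1)[of q] \<open>B \<le> b\<close> by (simp add: t_def)
        then have "(jump t p q)\<^sup>2 \<le> (\<epsilon> / 2)\<^sup>2"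
          using \<open>p < q\<close> by (intro power_mono jump_nonneg ts) auto
        also have "\<dots> \<le> \<epsilon>\<^sup>2 / 2" by (simp add: power_divide)
        finally show ?thesis
          using 2 qvar_antimono[OF yH, of b q] by (simp add: F_def max_def)
      next
        case 3
        then have "jump t p q = jump y p q" using \<open>p < q\<close> by (simp add: jump_def t_def)
        then show ?thesis
          using 3 \<open>p < q\<close> qvar_step[OF yH \<open>p < q\<close>] by (simp add: F_def max_def)
      qed
    qed
    then have "vnorm H t \<le> sqrt (F 0)"
      by (rule vnorm_le_potential[OF ts])
    also have "F 0 \<le> qvar y b + \<epsilon>\<^sup>2 / 2"
      by (simp add: F_def)
    also have "\<dots> \<le> \<epsilon>\<^sup>2"
      using B(2)[OF \<open>B \<le> b\<close>] by simp
    finally show ?thesis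
      using \<epsilon> t by simp
  qed
  then show ?thesis by blast
qed

text \<open>A chain is cut at \<open>d\<close>; the factor \<open>2\<close> comes from the one jump that passes over \<open>d\<close>. So a vector
  with small initial part has nearly half of its quadratic variation beyond \<open>d\<close>.\<close>

lemma qvar_le_trunc:
  assumes x: "x \<in> carrier H"
  shows "qvar x 0 \<le> 2 * qvar (trunc (Suc d) x) 0 + 2 * qvar x d"
proof -
  let ?z = "trunc (Suc d) x"
  have z: "?z \<in> carrier H" by (rule trunc_H[OF x])
  have xs: "x \<in> seqs" by (rule H_seqs[OF x])
  define F where "F = (\<lambda>p. 2 * qvar ?z p + 2 * qvar x (max p d))"
  have "potential x F"
    unfolding potential_def
  proof (intro conjI allI impI)
    show "0 \<le> F p" for p
      using qvar_nonneg[OF x] qvar_nonneg[OF z] by (simp add: F_def)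
    fix p q :: nat assume "p < q"
    have sq: "0 \<le> (jump x p q)\<^sup>2" by simp
    consider "q \<le> d" | "p < d" "d < q" | "d \<le> p" by linarith
    then show "(jump x p q)\<^sup>2 + F q \<le> F p"
    proof cases
      case 1
      then have "(jump x p q)\<^sup>2 + qvar ?z q \<le> qvar ?z p"
        using qvar_step[OF z \<open>p < q\<close>] \<open>p < q\<close> by (simp add: jump_trunc)
      moreover have "F q = 2 * qvar ?z q + 2 * qvar x d" "F p = 2 * qvar ?z p + 2 * qvar x d"
        using 1 \<open>p < q\<close> by (simp_all add: F_def max_def)
      ultimately show ?thesis using sq by linarith
    next
      case 2
      have "jump x p q \<le> jump x p d + jump x d q"
        using 2 by (intro jump_trans xs) auto
      then have "(jump x p q)\<^sup>2 \<le> (jump x p d + jump x d q)\<^sup>2"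
        using \<open>p < q\<close> by (intro power_mono jump_nonneg xs) auto
      also have "\<dots> \<le> 2 * (jump x p d)\<^sup>2 + 2 * (jump x d q)\<^sup>2" by (rule power2_sum_le)
      finally have 3: "(jump x p q)\<^sup>2 \<le> 2 * (jump x p d)\<^sup>2 + 2 * (jump x d q)\<^sup>2" .
      have "(jump x p d)\<^sup>2 + qvar ?z d \<le> qvar ?z p"
        using qvar_step[OF z \<open>p < d\<close>] \<open>p < d\<close> by (simp add: jump_trunc)
      moreover have "qvar ?z q \<le> qvar ?z d"
        using 2 by (intro qvar_antimono z) auto
      moreover have "(jump x d q)\<^sup>2 + qvar x q \<le> qvar x d"
        by (rule qvar_step[OF x \<open>d < q\<close>])
      ultimately show ?thesis
        using 2 3 by (simp add: F_def max_def)
    next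
      case 3
      then have "F q = 2 * qvar ?z q + 2 * qvar x q" "F p = 2 * qvar ?z p + 2 * qvar x p"
        using \<open>p < q\<close> by (simp_all add: F_def max_def)
      moreover have "qvar ?z q \<le> qvar ?z p"
        using \<open>p < q\<close> by (intro qvar_antimono[OF z]) auto
      ultimately show ?thesis
        using qvar_step[OF x \<open>p < q\<close>] sq by linarith
    qed
  qed
  then show ?thesis
    using qvar_le_potential[of x F 0] by (simp add: F_def)
qed

definition anchor :: "nat set \<Rightarrow> nat \<Rightarrow> nat" where
  "anchor D n = Max (D \<inter> {..n})"

text \<open>Each entry is compared with the last entry at an index of \<open>D\<close>, transported to its place by
  the connecting maps. On sequences vanishing on \<open>D\<close> this is the identity. For other sequences the
  entries of the result are differences that the norm of \<open>H\<close> controls, and this is what makes the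
  operator map \<open>H\<close> into \<open>J\<close>.\<close>

definition anchored_diff :: "nat set \<Rightarrow> (nat \<Rightarrow> 'a) \<Rightarrow> nat \<Rightarrow> 'a" where
  "anchored_diff D x = (\<lambda>n. x n \<ominus>\<^bsub>X n\<^esub> comp_maps \<phi> (anchor D n) n (x (anchor D n)))"

context
  fixes D :: "nat set"
  assumes D0: "0 \<in> D"
begin

lemma anchor_in: "anchor D n \<in> D" and anchor_le: "anchor D n \<le> n"
proof -
  have "Max (D \<inter> {..n}) \<in> D \<inter> {..n}"
    using D0 by (intro Max_in) auto
  then show "anchor D n \<in> D" "anchor D n \<le> n" by (auto simp: anchor_def)
qed

lemma le_anchor: "d \<in> D \<Longrightarrow> d \<le> n \<Longrightarrow> d \<le> anchor D n"
  unfolding anchor_def by (rule Max_ge) auto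

text \<open>Two indices lie in the same gap of \<open>D\<close>, or the anchor of the later one separates them.\<close>

lemma anchor_cases:
  assumes "p < q"
  obtains "anchor D p = anchor D q" | "p < anchor D q"
proof (cases "p < anchor D q")
  case False
  then have "anchor D q \<le> anchor D p"
    by (intro le_anchor anchor_in) auto
  moreover have "anchor D p \<le> anchor D q"
    using anchor_le[of p] assms by (intro le_anchor anchor_in) auto
  ultimately show thesis using that(1) by simp
qed

lemma anchored_diff_seqs: "x \<in> seqs \<Longrightarrow> anchored_diff D x \<in> seqs"
  by (simp add: anchored_diff_def seqs_def comp_maps_carrier anchor_le)

lemma vnorm_anchored_diff:
  "x \<in> seqs \<Longrightarrow> vnorm (X n) (anchored_diff D x n) = jump x (anchor D n) n"
  unfolding anchored_diff_def jump_def
  by (intro X.vnorm_diff_commute comp_maps_carrier anchor_le) (auto simp: seqs_def)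

lemma jump_anchored_diff:
  assumes x: "x \<in> seqs" and "p \<le> q" and eq: "anchor D p = anchor D q"
  shows "jump (anchored_diff D x) p q = jump x p q"
proof -
  let ?a = "anchor D q"
  have a: "?a \<le> p" "?a \<le> q" using anchor_le[of p] anchor_le[of q] eq by auto
  have c: "x n \<in> carrier (X n)" for n using x by (simp add: seqs_def)
  have "comp_maps \<phi> p q (anchored_diff D x p) = comp_maps \<phi> p q (x p) \<ominus>\<^bsub>X q\<^esub> comp_maps \<phi> ?a q (x ?a)"
    using a \<open>p \<le> q\<close> c by (simp add: anchored_diff_def eq comp_maps_diff comp_maps_carrier comp_maps_trans)
  then show ?thesis
    using a \<open>p \<le> q\<close> c unfolding jump_def
    by (simp add: anchored_diff_def X.diff_diff_diff comp_maps_carrier)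
qed

text \<open>Inside a gap the jumps are those of \<open>x\<close>, as the two anchored terms cancel. A jump from \<open>p\<close> to \<open>q\<close>
  between gaps is at most the sum of the norms of the two entries, and these are jumps of \<open>x\<close>
  from \<open>anchor D p\<close> to \<open>p\<close> and from \<open>anchor D q\<close> to \<open>q\<close>, over disjoint intervals. Since \<open>p\<close> lies
  before \<open>anchor D q\<close>, the drops of the quadratic variation over these two intervals, counted twice,
  add up to at most the drop of the potential.\<close>

lemma potential_anchored_diff:
  assumes x: "x \<in> carrier H"
  shows "potential (anchored_diff D x) (\<lambda>p. 2 * qvar x p + 2 * qvar x (anchor D p))"
  unfolding potential_def
proof (intro conjI allI impI)
  show "0 \<le> 2 * qvar x p + 2 * qvar x (anchor D p)" for p
    using qvar_nonneg[OF x] by simp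
  have xs: "x \<in> seqs" by (rule H_seqs[OF x])
  have own: "(vnorm (X n) (anchored_diff D x n))\<^sup>2 + qvar x n \<le> qvar x (anchor D n)" for n
    using qvar_step[OF x, of "anchor D n" n] anchor_le[of n] xs
    by (cases "anchor D n = n") (auto simp: vnorm_anchored_diff)
  fix p q :: nat assume "p < q"
  from \<open>p < q\<close> show "(jump (anchored_diff D x) p q)\<^sup>2 + (2 * qvar x q + 2 * qvar x (anchor D q))
      \<le> 2 * qvar x p + 2 * qvar x (anchor D p)"
  proof (cases rule: anchor_cases)
    case 1
    then have eq: "jump (anchored_diff D x) p q = jump x p q"
      using \<open>p < q\<close> xs by (intro jump_anchored_diff) auto
    show ?thesis
      using qvar_step[OF x \<open>p < q\<close>] unfolding eq 1 using zero_le_power2[of "jump x p q"] by linarith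
  next
    case 2
    have "jump (anchored_diff D x) p q \<le> vnorm (X p) (anchored_diff D x p) + vnorm (X q) (anchored_diff D x q)"
      using \<open>p < q\<close> by (intro jump_le_vnorm anchored_diff_seqs xs) auto
    then have "(jump (anchored_diff D x) p q)\<^sup>2 \<le>
        (vnorm (X p) (anchored_diff D x p) + vnorm (X q) (anchored_diff D x q))\<^sup>2"
      using \<open>p < q\<close> by (intro power_mono jump_nonneg anchored_diff_seqs xs) auto
    also have "\<dots> \<le> 2 * (vnorm (X p) (anchored_diff D x p))\<^sup>2 + 2 * (vnorm (X q) (anchored_diff D x q))\<^sup>2"
      by (rule power2_sum_le)
    finally show ?thesis
      using own[of p] own[of q] qvar_antimono[OF x, of p "anchor D q"] 2 by linarith
  qed
qed

lemma anchored_diff_H: "x \<in> carrier H \<Longrightarrow> anchored_diff D x \<in> carrier H"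
  using carrier_H_potential[OF anchored_diff_seqs potential_anchored_diff] H_seqs by blast

lemma vnorm_anchored_diff_le:
  assumes x: "x \<in> carrier H"
  shows "vnorm H (anchored_diff D x) \<le> 3 * vnorm H x"
proof -
  have "vnorm H (anchored_diff D x) \<le> sqrt (2 * qvar x 0 + 2 * qvar x (anchor D 0))"
    by (rule vnorm_le_potential[OF anchored_diff_seqs[OF H_seqs[OF x]] potential_anchored_diff[OF x]])
  also have "\<dots> \<le> 3 * vnorm H x"
    using anchor_le[of 0] by (intro sqrt_le_mult_vnorm[OF x, where c = 4]) auto
  finally show ?thesis .
qed

text \<open>The entry at \<open>n\<close> is a jump of \<open>x\<close> beyond \<open>anchor D n\<close>, which tends to infinity with \<open>n\<close>.\<close>

lemma anchored_diff_J:
  assumes x: "x \<in> carrier H" and D: "infinite D"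
  shows "anchored_diff D x \<in> carrier J"
proof -
  have lim: "filterlim (anchor D) at_top sequentially"
    unfolding filterlim_at_top
  proof
    fix Z :: nat
    obtain d where d: "d \<in> D" "Z \<le> d"
      using D unfolding infinite_nat_iff_unbounded_le by blast
    have "Z \<le> anchor D n" if "d \<le> n" for n
      using le_anchor[OF d(1) that] d(2) by linarith
    then show "\<forall>\<^sub>F n in sequentially. Z \<le> anchor D n"
      using eventually_ge_at_top[of d] by (rule eventually_mono[rotated]) auto
  qed
  have "(\<lambda>n. sqrt (qvar x (anchor D n))) \<longlonglongrightarrow> sqrt 0"
    by (intro tendsto_intros filterlim_compose[OF qvar_tendsto_0[OF x] lim])
  then have "(\<lambda>n. sqrt (qvar x (anchor D n))) \<longlonglongrightarrow> 0" by simp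
  then have "(\<lambda>n. vnorm (X n) (anchored_diff D x n)) \<longlonglongrightarrow> 0"
  proof (rule tendsto_sandwich[OF _ _ tendsto_const, rotated 2])
    have xs: "x \<in> seqs" by (rule H_seqs[OF x])
    show "\<forall>\<^sub>F n in sequentially. 0 \<le> vnorm (X n) (anchored_diff D x n)"
      using anchored_diff_seqs[OF xs] by (intro always_eventually allI X.vnorm_nonneg) (simp add: seqs_def)
    show "\<forall>\<^sub>F n in sequentially. vnorm (X n) (anchored_diff D x n) \<le> sqrt (qvar x (anchor D n))"
    proof (intro always_eventually allI real_le_rsqrt)
      fix n
      show "(vnorm (X n) (anchored_diff D x n))\<^sup>2 \<le> qvar x (anchor D n)"
        using qvar_step[OF x, of "anchor D n" n] anchor_le[of n] xs qvar_nonneg[OF x, of n]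
        by (cases "anchor D n = n") (auto simp: vnorm_anchored_diff)
    qed
  qed
  then show ?thesis
    using anchored_diff_H[OF x] by (simp add: carrier_J)
qed

lemma anchored_diff_add:
  assumes "x \<in> carrier H" "y \<in> carrier H"
  shows "anchored_diff D (x \<oplus>\<^bsub>H\<^esub> y) = anchored_diff D x \<oplus>\<^bsub>H\<^esub> anchored_diff D y"
  using assms
  by (auto simp: anchored_diff_def H_ops comp_maps_add comp_maps_carrier anchor_le H_carrier X.add_diff_add)

lemma anchored_diff_smult:
  assumes "x \<in> carrier H"
  shows "anchored_diff D (a \<odot>\<^bsub>H\<^esub> x) = a \<odot>\<^bsub>H\<^esub> anchored_diff D x"
  using assms
  by (auto simp: anchored_diff_def H_ops comp_maps_smult comp_maps_carrier anchor_le H_carrier X.smult_diff)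

lemma bounded_operator_anchored_diff:
  "infinite D \<Longrightarrow> bounded_operator H J (anchored_diff D)"
  unfolding bounded_operator_def J_ops
  using anchored_diff_J anchored_diff_add anchored_diff_smult vnorm_anchored_diff_le
  by (intro conjI ballI allI exI[of _ 3]) auto

lemma anchored_diff_fixes:
  assumes y: "y \<in> seqs" and 0: "\<And>d. d \<in> D \<Longrightarrow> y d = \<zero>\<^bsub>X d\<^esub>"
  shows "anchored_diff D y = y"
  using y by (auto simp: anchored_diff_def 0[OF anchor_in] comp_maps_zero anchor_le seqs_def)

end

end

section \<open>Gliding humps\<close>

lemma sum_halving_le: "0 \<le> \<eta> \<Longrightarrow> (\<Sum>j<n. \<eta> / 2 ^ Suc j) \<le> (\<eta>::real)"
proof -
  assume "0 \<le> \<eta>"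
  have "(\<Sum>j<n. \<eta> / 2 ^ Suc j) = \<eta> - \<eta> / 2 ^ n"
    by (induction n) (auto simp: field_simps)
  then show ?thesis using \<open>0 \<le> \<eta>\<close> by simp
qed

lemma (in normed_vspace) unit_vector_small:
  assumes L: "submodule L scalars E" and p: "seminorm E p"
    and x: "x \<in> L" "p x < \<epsilon> * vnorm E x"
  obtains y where "y \<in> L" "vnorm E y = 1" "p y < \<epsilon>"
proof -
  have xE: "x \<in> carrier E" using x(1) submoduleE(1)[OF L] by blast
  have r: "0 < vnorm E x"
    using seminorm_nonneg[OF p xE] x(2) vnorm_nonneg[OF xE] by (cases "vnorm E x = 0") auto
  define a :: 'k where "a = of_real (inverse (vnorm E x))"
  have a: "norm a = inverse (vnorm E x)"
    using r by (simp add: a_def norm_inverse)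
  show thesis
  proof (rule that)
    show "a \<odot>\<^bsub>E\<^esub> x \<in> L" using submoduleE(4)[OF L] x(1) by simp
    show "vnorm E (a \<odot>\<^bsub>E\<^esub> x) = 1" using r by (simp add: vnorm_smult xE a)
    show "p (a \<odot>\<^bsub>E\<^esub> x) < \<epsilon>"
      using r x(2) by (simp add: seminorm_smult[OF p xE] a field_simps)
  qed
qed

context J_sum
begin

lemma seminorm_sqrt_jsum:
  assumes ps: "sorted_wrt (<) ps"
  shows "seminorm H (\<lambda>x. sqrt (jsum (jump x) ps))"
  unfolding seminorm_def
proof (intro conjI ballI allI)
  fix x y assume "x \<in> carrier H" "y \<in> carrier H"
  then have s: "x \<in> seqs" "y \<in> seqs" by (auto simp: H_seqs)
  then show "sqrt (jsum (jump (x \<oplus>\<^bsub>H\<^esub> y)) ps) \<le> sqrt (jsum (jump x) ps) + sqrt (jsum (jump y) ps)"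
    by (intro sqrt_jsum_triangle[OF ps]) (auto simp: H_ops jump_add)
next
  fix a x assume "x \<in> carrier H"
  then have "x \<in> seqs" by (rule H_seqs)
  then have "jsum (jump (a \<odot>\<^bsub>H\<^esub> x)) ps = (norm a)\<^sup>2 * jsum (jump x) ps"
    by (intro jsum_scale[OF ps]) (auto simp: H_ops jump_smult)
  then show "sqrt (jsum (jump (a \<odot>\<^bsub>H\<^esub> x)) ps) = norm a * sqrt (jsum (jump x) ps)"
    by (simp add: real_sqrt_mult)
qed

lemma sqrt_jsum_le_vnorm:
  assumes "x \<in> carrier H" "sorted_wrt (<) ps"
  shows "sqrt (jsum (jump x) ps) \<le> 2 * vnorm H x"
proof -
  have "jsum (jump x) ps \<le> 2 * (vnorm H x)\<^sup>2" by (rule jsum_le_vnorm[OF assms])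
  also have "\<dots> \<le> (2 * vnorm H x)\<^sup>2" by (simp add: power_mult_distrib)
  finally show ?thesis using assms by (intro real_le_lsqrt) auto
qed

text \<open>Vectors \<open>x k\<close> and indices \<open>d k\<close> are chosen alternately. The variation of \<open>x k\<close> beyond
  \<open>d k\<close> exceeds \<open>1 / 4\<close>, so some chain \<open>ps k\<close> beyond \<open>d k\<close> sees that much of it; \<open>d (Suc k)\<close> is then taken past
  this chain and so far out that the variation of \<open>x k\<close> beyond it is negligible. Thus \<open>ps k\<close> hardly
  sees \<open>x j\<close>: for \<open>j < k\<close> it lies beyond \<open>d (Suc j)\<close>, and for \<open>k < j\<close> it lies in the initial part of \<open>x j\<close>.
  The seminorms belonging to the chains therefore satisfy the hypotheses of
  \<open>coeff_boundedI\<close>. The parameter \<open>R\<close> is a further condition on \<open>x k\<close> and \<open>d (Suc k)\<close> that holds as soon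
  as the index is large.\<close>

lemma gliding_hump:
  fixes \<epsilon> :: "nat \<Rightarrow> real" and R :: "nat \<Rightarrow> (nat \<Rightarrow> 'a) \<Rightarrow> nat \<Rightarrow> bool"
  assumes M: "M \<subseteq> carrier H"
    and \<epsilon>: "\<And>k. 0 < \<epsilon> k" "\<And>n. (\<Sum>j<n. \<epsilon> j) \<le> 1 / 8"
    and small: "\<And>k n. \<exists>x\<in>M. vnorm H x = 1 \<and> vnorm H (trunc n x) \<le> \<epsilon> k \<and> (\<exists>B. \<forall>b\<ge>B. R k x b)"
  obtains d x where "strict_mono d" "d 0 = n0" "range x \<subseteq> M" "coeff_bounded H 8 x"
    "\<And>k. vnorm H (trunc (Suc (d k)) (x k)) \<le> \<epsilon> k" "\<And>k. R k (x k) (d (Suc k))"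
proof -
  \<comment> \<open>\<open>P\<close> is the condition on stage \<open>k\<close> alone, \<open>Q\<close> the one that the next index has to satisfy\<close>
  define P where "P = (\<lambda>k (d, x, ps). x \<in> M \<and> vnorm H (trunc (Suc d) x) \<le> \<epsilon> k \<and>
      (\<exists>B. \<forall>b\<ge>B. R k x b) \<and> sorted_wrt (<) ps \<and> set ps \<subseteq> {d..} \<and> 1 / 4 \<le> jsum (jump x) ps)"
  define Q where "Q = (\<lambda>k (d, x, ps) (d', x' :: nat \<Rightarrow> 'a, ps' :: nat list).
      d < d' \<and> set ps \<subseteq> {..<d'} \<and> qvar x d' \<le> (\<epsilon> k)\<^sup>2 \<and> R k x d')"
  have \<epsilon>_le: "\<epsilon> k \<le> 1 / 8" for k
  proof -
    have "\<epsilon> k \<le> (\<Sum>j<Suc k. \<epsilon> j)"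
      using \<epsilon>(1) by (intro member_le_sum) (auto intro: less_imp_le)
    then show ?thesis using \<epsilon>(2)[of "Suc k"] by linarith
  qed
  have start: "\<exists>x ps. P k (d, x, ps)" for k d
  proof -
    obtain x where x: "x \<in> M" "vnorm H x = 1" "vnorm H (trunc (Suc d) x) \<le> \<epsilon> k" "\<exists>B. \<forall>b\<ge>B. R k x b"
      using small[of "Suc d" k] by blast
    have xH: "x \<in> carrier H" using x(1) M by blast
    have "(vnorm H (trunc (Suc d) x))\<^sup>2 \<le> (1 / 8)\<^sup>2"
      using x(3) \<epsilon>_le[of k] trunc_H[OF xH] by (intro power_mono) auto
    then have "qvar (trunc (Suc d) x) 0 \<le> 2 * (1 / 8)\<^sup>2"
      using qvar_le_vnorm[OF trunc_H[OF xH], of "Suc d" 0] by linarith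
    \<comment> \<open>the variation beyond \<open>d\<close> is at least \<open>(1 - 2 * 2 / 64) / 2 = 15 / 32\<close>\<close>
    then have "1 / 4 < qvar x d"
      using vnorm_le_qvar[OF xH] qvar_le_trunc[OF xH, of d] x(2) by (simp add: power2_eq_square)
    moreover have "bdd_above (jsum (jump x) ` {ps. sorted_wrt (<) ps \<and> set ps \<subseteq> {d..}})"
      by (rule bdd_jsum) (rule jsum_le_vnorm[OF xH])
    ultimately have "\<exists>ps\<in>{ps. sorted_wrt (<) ps \<and> set ps \<subseteq> {d..}}. 1 / 4 < jsum (jump x) ps"
      unfolding qvar_def using less_cSUP_iff[OF chains_nonempty, of "jsum (jump x)" d "1 / 4"] by simp
    then obtain ps where "sorted_wrt (<) ps" "set ps \<subseteq> {d..}" "1 / 4 < jsum (jump x) ps"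
      by blast
    then have "P k (d, x, ps)" using x by (simp add: P_def)
    then show ?thesis by blast
  qed
  have "\<exists>f. \<forall>k. (P k (f k) \<and> (k = 0 \<longrightarrow> fst (f k) = n0)) \<and> Q k (f k) (f (Suc k))"
  proof (rule dependent_nat_choice)
    show "\<exists>s. P 0 s \<and> (0 = (0::nat) \<longrightarrow> fst s = n0)"
      using start[of 0 n0] by force
    fix s k assume s: "P k s \<and> (k = 0 \<longrightarrow> fst s = n0)"
    obtain d x ps where s_eq: "s = (d, x, ps)" by (cases s)
    have Ps: "x \<in> M" "\<exists>B. \<forall>b\<ge>B. R k x b" using s by (auto simp: s_eq P_def)
    have xH: "x \<in> carrier H" using Ps(1) M by blast
    obtain B where B: "\<And>b. B \<le> b \<Longrightarrow> R k x b" using Ps(2) by blast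
    have "0 < (\<epsilon> k)\<^sup>2" using \<epsilon>(1)[of k] by simp
    then obtain B' where B': "\<And>b. B' \<le> b \<Longrightarrow> qvar x b < (\<epsilon> k)\<^sup>2"
      using order_tendstoD(2)[OF qvar_tendsto_0[OF xH]] unfolding eventually_sequentially by blast
    \<comment> \<open>the sum of the list exceeds each of its members\<close>
    define d' where "d' = Suc (d + B + B' + sum_list ps)"
    have "set ps \<subseteq> {..<d'}"
      using member_le_sum_list[of _ ps] by (force simp: d'_def)
    then have "\<And>x' ps'. Q k s (d', x', ps')"
      using B[of d'] B'[of d'] by (auto simp: Q_def s_eq d'_def)
    moreover obtain x' ps' where "P (Suc k) (d', x', ps')"
      using start by blast
    ultimately show "\<exists>s'. (P (Suc k) s' \<and> (Suc k = 0 \<longrightarrow> fst s' = n0)) \<and> Q k s s'"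
      by blast
  qed
  then obtain f where f: "\<And>k. P k (f k)" "fst (f 0) = n0" "\<And>k. Q k (f k) (f (Suc k))"
    by blast
  define d where "d = (\<lambda>k. fst (f k))"
  define x where "x = (\<lambda>k. fst (snd (f k)))"
  define ps where "ps = (\<lambda>k. snd (snd (f k)))"
  have f_eq: "f k = (d k, x k, ps k)" for k by (simp add: d_def x_def ps_def)
  have P: "x k \<in> M" "vnorm H (trunc (Suc (d k)) (x k)) \<le> \<epsilon> k" "sorted_wrt (<) (ps k)"
      "set (ps k) \<subseteq> {d k..}" "1 / 4 \<le> jsum (jump (x k)) (ps k)" for k
    using f(1)[of k] by (auto simp: f_eq P_def)
  have Q: "d k < d (Suc k)" "set (ps k) \<subseteq> {..<d (Suc k)}" "qvar (x k) (d (Suc k)) \<le> (\<epsilon> k)\<^sup>2"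
      "R k (x k) (d (Suc k))" for k
    using f(3)[of k] by (auto simp: f_eq Q_def)
  have mono: "strict_mono d" using Q(1) by (rule strict_monoI_Suc)
  have xH: "x k \<in> carrier H" for k using P(1) M by blast
  have "coeff_bounded H (4 * 2) x"
  proof (rule H.coeff_boundedI[where u = "\<lambda>k y. sqrt (jsum (jump y) (ps k))" and \<delta> = "\<lambda>j. 2 * \<epsilon> j"])
    show "x k \<in> carrier H" for k by (rule xH)
    show "seminorm H (\<lambda>y. sqrt (jsum (jump y) (ps k)))" for k
      by (rule seminorm_sqrt_jsum[OF P(3)])
    show "sqrt (jsum (jump y) (ps k)) \<le> 2 * vnorm H y" if "y \<in> carrier H" for k y
      by (rule sqrt_jsum_le_vnorm[OF that P(3)])
    show "1 / 2 \<le> sqrt (jsum (jump (x k)) (ps k))" for k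
      using P(5)[of k] by (intro real_le_rsqrt) (simp add: power2_eq_square)
    show "sqrt (jsum (jump (x j)) (ps k)) \<le> 2 * \<epsilon> j" if "j \<noteq> k" for j k
    proof (cases "j < k")
      case True
      then have "d (Suc j) \<le> d k" using strict_mono_less_eq[OF mono] by simp
      then have "jsum (jump (x j)) (ps k) \<le> qvar (x j) (d (Suc j))"
        using P(4)[of k] by (intro jsum_le_qvar[OF xH P(3)]) auto
      then have "jsum (jump (x j)) (ps k) \<le> (\<epsilon> j)\<^sup>2"
        using Q(3)[of j] by linarith
      then have "sqrt (jsum (jump (x j)) (ps k)) \<le> \<epsilon> j"
        using \<epsilon>(1)[of j] by (intro real_le_lsqrt) auto
      then show ?thesis using \<epsilon>(1)[of j] by linarith
    next
      case False
      then have "d (Suc k) \<le> d j" using that strict_mono_less_eq[OF mono] by simp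
      then have "jsum (jump (x j)) (ps k) = jsum (jump (trunc (Suc (d j)) (x j))) (ps k)"
        using Q(2)[of k] by (intro jsum_cong[OF P(3)] jump_trunc[symmetric]) auto
      then have "sqrt (jsum (jump (x j)) (ps k)) \<le> 2 * vnorm H (trunc (Suc (d j)) (x j))"
        using sqrt_jsum_le_vnorm[OF trunc_H[OF xH] P(3)] by simp
      then show ?thesis using P(2)[of j] by linarith
    qed
    show "(\<Sum>j<n. 2 * \<epsilon> j) \<le> 1 / 4" for n
      using \<epsilon>(2)[of n] by (simp add: sum_distrib_left[symmetric])
    show "0 \<le> 2 * \<epsilon> j" for j using \<epsilon>(1)[of j] by simp
  qed
  then have "coeff_bounded H 8 x" by simp
  then show thesis
    using that[of d x] mono f(2) P(1,2) Q(4) by (auto simp: d_def)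
qed

text \<open>Starting the gliding hump at index \<open>n\<close> makes \<open>trunc n\<close> small on every member of the sequence,
  hence on the span.\<close>

lemma exists_seq_span_trunc_small:
  assumes M: "M \<subseteq> carrier H"
    and small: "\<And>n \<epsilon>. 0 < \<epsilon> \<Longrightarrow> \<exists>x\<in>M. vnorm H x = 1 \<and> vnorm H (trunc n x) < \<epsilon>"
    and \<epsilon>: "0 < \<epsilon>"
  obtains x where "range x \<subseteq> M" "coeff_bounded H 8 x"
    "\<And>y. y \<in> seq_span H x \<Longrightarrow> vnorm H (trunc n y) \<le> \<epsilon> * vnorm H y"
proof -
  \<comment> \<open>\<open>8\<close> bounds the coefficients and \<open>2\<close> the norm of \<open>trunc n\<close>, so \<open>16 * \<eta> \<le> \<epsilon>\<close> is required\<close>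
  define \<eta> where "\<eta> = min (1 / 8) (\<epsilon> / 16)"
  have \<eta>: "0 < \<eta>" "\<eta> \<le> 1 / 8" "\<eta> \<le> \<epsilon> / 16" using \<epsilon> by (auto simp: \<eta>_def)
  have sm: "\<exists>x\<in>M. vnorm H x = 1 \<and> vnorm H (trunc m x) \<le> \<eta> / 2 ^ Suc k \<and> (\<exists>B. \<forall>b\<ge>B. True)"
    for k m :: nat
    using small[of "\<eta> / 2 ^ Suc k" m] \<eta>(1) less_imp_le by fastforce
  have sum: "(\<Sum>j<k. \<eta> / 2 ^ Suc j) \<le> 1 / 8" for k
    using sum_halving_le[of \<eta> k] \<eta> by linarith
  obtain d x where *: "strict_mono d" "d 0 = n" "range x \<subseteq> M" "coeff_bounded H 8 x"
      "\<And>k. vnorm H (trunc (Suc (d k)) (x k)) \<le> \<eta> / 2 ^ Suc k"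
    by (rule gliding_hump[OF M _ sum sm, of n]) (use \<eta>(1) in auto)
  have xH: "x k \<in> carrier H" for k using *(3) M by blast
  have "vnorm H (trunc n y) \<le> \<epsilon> * vnorm H y" if y: "y \<in> seq_span H x" for y
  proof -
    have bound: "vnorm H (trunc n (x k)) \<le> 2 * (\<eta> / 2 ^ Suc k)" for k
    proof -
      have "n \<le> Suc (d k)"
        using *(2) strict_mono_less_eq[OF *(1), of 0 k] by simp
      then have "vnorm H (trunc n (x k)) \<le> 2 * vnorm H (trunc (Suc (d k)) (x k))"
        using vnorm_trunc_le[OF trunc_H[OF xH], of n "Suc (d k)" k] by (simp add: trunc_trunc)
      then show ?thesis using *(5)[of k] by linarith
    qed
    have sum2: "(\<Sum>j<k. 2 * (\<eta> / 2 ^ Suc j)) \<le> 2 * \<eta>" for k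
      using sum_halving_le[of \<eta> k] \<eta>(1) by (simp only: sum_distrib_left[symmetric]) simp
    have "vnorm H (trunc n y) \<le> 8 * (2 * \<eta>) * vnorm H y"
      by (rule H.seminorm_le_on_seq_span[OF *(4) trunc.seminorm_map bound sum2 _ y]) simp
    also have "\<dots> \<le> \<epsilon> * vnorm H y"
    proof (rule mult_right_mono)
      show "0 \<le> vnorm H y"
        using y H.submoduleE(1)[OF H.seq_span_submodule[of x, OF xH]] by (intro H.vnorm_nonneg) auto
    qed (use \<eta>(3) in simp)
    finally show ?thesis .
  qed
  then show thesis using that *(3,4) by blast
qed

text \<open>With \<open>D\<close> the range of the indices \<open>d k\<close>, the part \<open>y\<close> of \<open>x k\<close> strictly between \<open>d k\<close> and
  \<open>d (Suc k)\<close> is fixed by \<open>anchored_diff D\<close>, and \<open>x k\<close> is close to it. So the operator nearly fixes every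
  \<open>x k\<close>, and by the bound on coefficients every vector of the span.\<close>

lemma exists_anchored_diff_bounded_below:
  assumes M: "M \<subseteq> carrier H"
    and small: "\<And>n \<epsilon>. 0 < \<epsilon> \<Longrightarrow> \<exists>x\<in>M. vnorm H x = 1 \<and> vnorm H (trunc n x) \<le> \<epsilon> \<and>
      (\<exists>B. \<forall>b\<ge>B. vnorm H (x \<ominus>\<^bsub>H\<^esub> trunc b x) \<le> \<epsilon>)"
  obtains D x where "0 \<in> D" "infinite D" "range x \<subseteq> M" "coeff_bounded H 8 x"
    "\<forall>y\<in>seq_span H x. 1 / 2 * vnorm H y \<le> vnorm H (anchored_diff D y)"
proof -
  \<comment> \<open>\<open>x k\<close> moves by at most \<open>8 * (\<eta> / 2 ^ Suc k)\<close>, so vectors of the span move by at most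
      \<open>8 * 8 * \<eta> = 1 / 2\<close> times their norm\<close>
  define \<eta> :: real where "\<eta> = 1 / 128"
  have sum: "(\<Sum>j<k. \<eta> / 2 ^ Suc j) \<le> 1 / 8" for k
    using sum_halving_le[of \<eta> k] by (simp add: \<eta>_def)
  obtain d x where *: "strict_mono d" "d 0 = 0" "range x \<subseteq> M" "coeff_bounded H 8 x"
      "\<And>k. vnorm H (trunc (Suc (d k)) (x k)) \<le> \<eta> / 2 ^ Suc k"
      "\<And>k. vnorm H (x k \<ominus>\<^bsub>H\<^esub> trunc (d (Suc k)) (x k)) \<le> \<eta> / 2 ^ Suc k"
    by (rule gliding_hump[OF M _ sum small, of 0]) (auto simp: \<eta>_def)
  have xH: "x k \<in> carrier H" for k using *(3) M by blast
  define D where "D = range d"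
  have D: "0 \<in> D" "infinite D"
    using *(1,2) unfolding D_def by (metis rangeI, simp add: range_inj_infinite strict_mono_imp_inj_on)
  note TH = anchored_diff_H[OF D(1)]
  have TD: "bounded_operator H H (anchored_diff D)"
    unfolding bounded_operator_def
    using TH anchored_diff_add[OF D(1)] anchored_diff_smult[OF D(1)] vnorm_anchored_diff_le[OF D(1)]
    by (intro conjI ballI allI exI[of _ 3]) auto
  interpret T: bounded_map H H "anchored_diff D"
    by unfold_locales (rule TD)
  define w where "w = (\<lambda>y. vnorm H (y \<ominus>\<^bsub>H\<^esub> anchored_diff D y))"
  have w: "seminorm H w"
    unfolding seminorm_def w_def
  proof (intro conjI ballI allI)
    fix y z assume yz: "y \<in> carrier H" "z \<in> carrier H"
    show "vnorm H ((y \<oplus>\<^bsub>H\<^esub> z) \<ominus>\<^bsub>H\<^esub> anchored_diff D (y \<oplus>\<^bsub>H\<^esub> z)) \<le>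
        vnorm H (y \<ominus>\<^bsub>H\<^esub> anchored_diff D y) + vnorm H (z \<ominus>\<^bsub>H\<^esub> anchored_diff D z)"
      using H.vnorm_triangle[of "y \<ominus>\<^bsub>H\<^esub> anchored_diff D y" "z \<ominus>\<^bsub>H\<^esub> anchored_diff D z"] yz TH
      by (simp add: T.map_add H.add_diff_add)
  next
    fix a y assume y: "y \<in> carrier H"
    show "vnorm H (a \<odot>\<^bsub>H\<^esub> y \<ominus>\<^bsub>H\<^esub> anchored_diff D (a \<odot>\<^bsub>H\<^esub> y)) = norm a * vnorm H (y \<ominus>\<^bsub>H\<^esub> anchored_diff D y)"
      using H.vnorm_smult[of "y \<ominus>\<^bsub>H\<^esub> anchored_diff D y" a] y TH
      by (simp add: T.map_smult H.smult_diff)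
  qed
  have w_x: "w (x k) \<le> 8 * (\<eta> / 2 ^ Suc k)" for k
  proof -
    let ?a = "trunc (d (Suc k)) (x k)" and ?b = "trunc (Suc (d k)) (x k)"
    have ab: "?a \<in> carrier H" "?b \<in> carrier H" by (rule trunc_H[OF xH])+
    define y where "y = ?a \<ominus>\<^bsub>H\<^esub> ?b"
    have yH: "y \<in> carrier H" using ab by (simp add: y_def)
    have "y e = \<zero>\<^bsub>X e\<^esub>" if eD: "e \<in> D" for e
    proof -
      obtain j where j: "e = d j" using eD unfolding D_def by blast
      have "d j < d (Suc k) \<longleftrightarrow> d j < Suc (d k)"
        using strict_mono_less[OF *(1), of j "Suc k"] strict_mono_less_eq[OF *(1), of j k]
        by (simp add: less_Suc_eq_le)
      then have "?a e = ?b e" by (simp add: trunc_def j)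
      then show ?thesis
        using H_carrier[OF ab(2), of e] by (simp add: y_def H_diff[OF ab])
    qed
    then have "anchored_diff D y = y"
      using D(1) H_seqs[OF yH] by (intro anchored_diff_fixes) auto
    then have wy: "w y = 0" using yH by (simp add: w_def)
    define v where "v = x k \<ominus>\<^bsub>H\<^esub> y"
    have vH: "v \<in> carrier H" using xH yH by (simp add: v_def)
    have "vnorm H v \<le> vnorm H (x k \<ominus>\<^bsub>H\<^esub> ?a) + vnorm H (?a \<ominus>\<^bsub>H\<^esub> y)"
      unfolding v_def by (rule H.vnorm_diff_triangle[OF xH ab(1) yH])
    also have "?a \<ominus>\<^bsub>H\<^esub> y = ?b"
      unfolding y_def by (rule H.diff_diff_cancel[OF ab])
    finally have v_le: "vnorm H v \<le> 2 * (\<eta> / 2 ^ Suc k)"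
      using *(5)[of k] *(6)[of k] by linarith
    have "w (x k) = w (v \<oplus>\<^bsub>H\<^esub> y)"
      using xH yH by (simp add: v_def)
    also have "\<dots> \<le> w v"
      using H.seminorm_add[OF w vH yH] wy by simp
    also have "\<dots> \<le> vnorm H v + vnorm H (anchored_diff D v)"
      unfolding w_def by (rule H.vnorm_diff_le[OF vH TH[OF vH]])
    also have "\<dots> \<le> 4 * vnorm H v"
      using vnorm_anchored_diff_le[OF D(1) vH] by simp
    finally show ?thesis using v_le by linarith
  qed
  have sum8: "(\<Sum>j<k. 8 * (\<eta> / 2 ^ Suc j)) \<le> 1 / 16" for k
    using sum_halving_le[of \<eta> k] by (simp only: sum_distrib_left[symmetric]) (simp add: \<eta>_def)
  have "1 / 2 * vnorm H y \<le> vnorm H (anchored_diff D y)" if y: "y \<in> seq_span H x" for y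
  proof -
    have yH: "y \<in> carrier H"
      using y H.submoduleE(1)[OF H.seq_span_submodule[of x, OF xH]] by auto
    have "w y \<le> 8 * (1 / 16) * vnorm H y"
      by (rule H.seminorm_le_on_seq_span[OF *(4) w w_x sum8 _ y]) simp
    then show ?thesis
      using H.vnorm_le_diff[OF yH TH[OF yH]] by (simp add: w_def)
  qed
  then show thesis using that D *(3,4) by blast
qed

section \<open>Subprojectivity\<close>

text \<open>If \<open>M\<close> contains no infinite-dimensional complemented subspace, then by the pull-back lemmas neither
  the truncations nor the quotient map are bounded below on the spans in question. This provides
  the vectors for the two gliding humps, and the second of them contradicts the pull-back lemma for
  \<open>anchored_diff\<close>.\<close>

theorem subprojective_J_hat:
  assumes J: "subprojective J" and Q: "subprojective (quotient_space H (carrier J))"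
  shows "subprojective H"
proof -
  let ?Q = "quotient_space H (carrier J)" and ?q = "\<lambda>x. carrier J +>\<^bsub>H\<^esub> x"
  interpret J: banach_space J
    using J by (simp add: subprojective_def)
  interpret Q: banach_space ?Q
    using Q by (simp add: subprojective_def)
  interpret q: bounded_map H ?Q ?q
    by unfold_locales (rule H.bounded_operator_quotient_map[OF J_submodule])
  have "\<exists>N. N \<subseteq> M \<and> submodule N scalars H \<and> \<not> finite_dimensional H N \<and> complemented H N"
    if M: "closed_subspace H M" "\<not> finite_dimensional H M" for M
  proof (rule ccontr)
    assume no: "\<not> ?thesis"
    have sub: "submodule M scalars H"
      using M(1) unfolding H.closed_subspace_iff by blast
    have MH: "M \<subseteq> carrier H" by (rule H.submoduleE(1)[OF sub])
    have trunc_small: "\<exists>x\<in>M. vnorm H x = 1 \<and> vnorm H (trunc n x) < \<epsilon>" if \<epsilon>: "0 < \<epsilon>" for n \<epsilon>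
    proof -
      interpret trunc_J: bounded_map H J "trunc n"
        by unfold_locales (rule bounded_operator_trunc)
      have "\<not> (\<forall>x\<in>M. \<epsilon> * vnorm H x \<le> vnorm J (trunc n x))"
        using trunc_J.pull_back_complemented[OF banach_space_H J M \<epsilon>] no by blast
      then obtain x where "x \<in> M" "vnorm H (trunc n x) < \<epsilon> * vnorm H x"
        by (auto simp: J_ops)
      from H.unit_vector_small[OF sub trunc.seminorm_map this] show ?thesis by blast
    qed
    have "\<exists>z\<in>M. vnorm H z = 1 \<and> vnorm H (trunc n z) \<le> \<epsilon> \<and>
        (\<exists>B. \<forall>b\<ge>B. vnorm H (z \<ominus>\<^bsub>H\<^esub> trunc b z) \<le> \<epsilon>)" if "0 < \<epsilon>" for n \<epsilon>
    proof -
      have \<epsilon>4: "0 < \<epsilon> / 4" using that by simp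
      obtain x where x: "range x \<subseteq> M" "coeff_bounded H 8 x"
          "\<And>y. y \<in> seq_span H x \<Longrightarrow> vnorm H (trunc n y) \<le> \<epsilon> / 4 * vnorm H y"
        using exists_seq_span_trunc_small[OF MH trunc_small \<epsilon>4, of n] by blast
      have xH: "x k \<in> carrier H" for k using x(1) MH by blast
      have "\<not> (\<forall>y\<in>seq_span H x. \<epsilon> / 4 * vnorm H y \<le> vnorm ?Q (?q y))"
        using q.pull_back_complemented_seq_span[OF banach_space_H Q M(1) x(2,1) \<epsilon>4] no by blast
      then obtain y where "y \<in> seq_span H x" "vnorm ?Q (?q y) < \<epsilon> / 4 * vnorm H y"
        by (auto simp: not_le)
      from H.unit_vector_small[OF H.seq_span_submodule[of x, OF xH] q.seminorm_map this]
      obtain z where z: "z \<in> seq_span H x" "vnorm H z = 1" "vnorm ?Q (?q z) < \<epsilon> / 4" by blast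
      have zM: "z \<in> M"
        using z(1) H.submodule_lincomb[OF sub, of x] x(1) unfolding seq_span_def by blast
      have zH: "z \<in> carrier H" using zM MH by blast
      obtain y where y: "y \<in> carrier J" "vnorm H (z \<ominus>\<^bsub>H\<^esub> y) < \<epsilon> / 4"
        using H.quotient_norm_less[OF J_submodule zH z(3)] by blast
      have yH: "y \<in> carrier H" by (rule J_subset_H[OF y(1)])
      obtain B where B: "\<And>b. B \<le> b \<Longrightarrow> vnorm H (y \<ominus>\<^bsub>H\<^esub> trunc b y) \<le> \<epsilon> / 4"
        using trunc_tail_small[OF y(1) \<epsilon>4] by blast
      have "vnorm H (z \<ominus>\<^bsub>H\<^esub> trunc b z) \<le> \<epsilon>" if "B \<le> b" for b
      proof -
        have "vnorm H (z \<ominus>\<^bsub>H\<^esub> trunc b z) \<le> vnorm H (z \<ominus>\<^bsub>H\<^esub> y) + vnorm H (y \<ominus>\<^bsub>H\<^esub> trunc b z)"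
          by (rule H.vnorm_diff_triangle[OF zH yH trunc_H[OF zH]])
        also have "vnorm H (y \<ominus>\<^bsub>H\<^esub> trunc b z) \<le>
            vnorm H (y \<ominus>\<^bsub>H\<^esub> trunc b y) + vnorm H (trunc b y \<ominus>\<^bsub>H\<^esub> trunc b z)"
          by (rule H.vnorm_diff_triangle[OF yH trunc_H[OF yH] trunc_H[OF zH]])
        also have "trunc b y \<ominus>\<^bsub>H\<^esub> trunc b z = trunc b (y \<ominus>\<^bsub>H\<^esub> z)"
          by (rule trunc.map_diff[OF yH zH, symmetric])
        also have "vnorm H (trunc b (y \<ominus>\<^bsub>H\<^esub> z)) \<le> 2 * vnorm H (z \<ominus>\<^bsub>H\<^esub> y)"
          using vnorm_trunc_le[OF H.diff_carrier[OF yH zH], of b] H.vnorm_diff_commute[OF yH zH] by simp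
        finally show ?thesis using y(2) B[OF that] by linarith
      qed
      moreover have "vnorm H (trunc n z) \<le> \<epsilon>"
        using x(3)[OF z(1)] z(2) that by simp
      ultimately show ?thesis using zM z(2) by blast
    qed
    then obtain D x where Dx: "0 \<in> D" "infinite D" "range x \<subseteq> M" "coeff_bounded H 8 x"
        "\<forall>y\<in>seq_span H x. 1 / 2 * vnorm H y \<le> vnorm H (anchored_diff D y)"
      by (rule exists_anchored_diff_bounded_below[OF MH]) blast
    interpret T: bounded_map H J "anchored_diff D"
      by unfold_locales (rule bounded_operator_anchored_diff[OF Dx(1,2)])
    have "\<exists>N. N \<subseteq> M \<and> submodule N scalars H \<and> \<not> finite_dimensional H N \<and> complemented H N"
      by (rule T.pull_back_complemented_seq_span[OF banach_space_H J M(1) Dx(4,3), of "1 / 2"])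
        (use Dx(5) in \<open>simp_all add: J_ops\<close>)
    then show False using no by blast
  qed
  then show ?thesis
    unfolding subprojective_def using banach_space_H by blast
qed

end

theorem proposition5p5:
  fixes X :: "nat \<Rightarrow> ('k::real_or_complex, 'a) nspace"
    and \<phi> :: "nat \<Rightarrow> 'a \<Rightarrow> 'a"
  assumes "\<And>n. banach_space (X n)"
    and "carrier (X 0) = {\<zero>\<^bsub>X 0\<^esub>}"
    and "\<And>n. bounded_operator (X n) (X (Suc n)) (\<phi> n)"
    and "\<And>n. operator_norm (X n) (X (Suc n)) (\<phi> n) \<le> 1"
    and "subprojective (J_space X \<phi>)"
    and "subprojective (quotient_space (J_hat X \<phi>) (carrier (J_space X \<phi>)))"
  shows "subprojective (J_hat X \<phi>)"
proof -
  interpret J_sum X \<phi>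
    by (rule J_sum.intro[OF assms(1-4)])
  show ?thesis
    by (rule subprojective_J_hat[OF assms(5,6)])
qed


end
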